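(* Let $X$ be a continuum with compact universal cover $\widehat{\phi}:\widehat{X}\to X=\widehat{X}/\pi_P(X)$. Then $\widehat{X}$ is compactly simply connected, and if $f:Y\to X=Y/G$ is a generalized regular covering map by a compactly simply connected continuum $Y$, then $f$ is equivalent to $\widehat{\phi}$.
   Context: A continuum is a compact, connected, metrizable space. A regular covering map $f:Y\to X=Y/G$ between topological spaces is a covering map that is also the quotient map of a free action of a group $G$ of homeomorphisms of $Y$. A cover of $X$ by a continuum is a regular covering map $f:Y\to X$ with $Y$ a continuum. Uniform spaces: a uniform space is a topological space with a compatible uniformity, whose entourages are taken to be symmetric; a compact space carries its unique compatible uniformity. For a map $g$ and $E\subset Y\times Y$, $g(E)$ means $(g\times g)(E)$. A group $G$ of bijections of a uniform space $Y$ acts isomorphically if $Y$ has a basis of entourages $E$ with $g(E)=E$ for all $g\in G$; $Y/G$ then has the quotient uniformity, consisting of the images of entourages. For an entourage $E$ let $U_E(G)=\{g\in G:(y,g(y))\in E\ \forall y\in Y\}$, $S_E(G)=\{g\in G:(y,g(y))\in E\text{ for some }y\in Y\}$, and $N_E(G)$ the subgroup generated by $S_E(G)$. $G$ acts prodiscretely if for every entourage $E$ there is an entourage $F$ with $N_F(G)\subset U_E(G)$. $G$ has the topology (and uniformity) of uniform convergence, for which the $U_E(G)$ form a basis at the identity. A generalized regular covering map $f:Y\to X=Y/G$ with deck group $G$ is the quotient map of an isomorphic and prodiscrete action of a complete group $G$ on $Y$ (with $X$ identified with $Y/G$). Equivalence: quotient maps $f_i:Y_i\to X=Y_i/G_i$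 ($i=1,2$) of isomorphic actions are equivalent if there are a uniform homeomorphism $h:Y_1\to Y_2$ and an isomorphism $\theta:G_1\to G_2$ with $h\circ g=\theta(g)\circ h$ for all $g\in G_1$ and $f_2\circ h=f_1$. Compact universal cover: let $\{f_i:X_i\to X=X_i/G_i\}$ be the family of all covers of $X$ by continua, one from each equivalence class, with basepoints $*$ in $X$ and the $X_i$ such that $f_i( * )=*$. Write $f_i\leq f_j$ if there is a continuous surjection $f_{ij}:X_j\to X_i$ with $f_j=f_i\circ f_{ij}$; this is a directed order, the basepoint preserving $f_{ij}$ is unique, and there are homomorphisms $\theta_{ij}:G_j\to G_i$ with $\theta_{ij}(g)\circ f_{ij}=f_{ij}\circ g$. Put $\widehat{X}=\varprojlim X_i$ and $\pi_P(X)=\varprojlim G_i$ (the profinite fundamental group), acting coordinatewise on $\widehat{X}$; $\widehat{\phi}:\widehat{X}\to X=\widehat{X}/\pi_P(X)$ is the projection, a generalized regular covering map. A continuum $Z$ is compactly simply connected if $\pi_P(Z)=1$. *)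

theory Defs
  imports "HOL-Analysis.Analysis" "HOL-Algebra.Product_Groups" "HOL-Algebra.Generated_Groups"
    "HOL-Algebra.Bij"
begin

section \<open>Continua and regular covering maps\<close>

text \<open>Basepoints are chosen in every continuum, so the empty space is excluded.\<close>

definition continuum :: "'a topology \<Rightarrow> bool" where
  "continuum X \<longleftrightarrow>
     compact_space X \<and> connected_space X \<and> metrizable_space X \<and> topspace X \<noteq> {}"

text \<open>The analogue, for abstract topologies, of the library's \<open>covering_space\<close>.\<close>

definition covering_map :: "'b topology \<Rightarrow> 'a topology \<Rightarrow> ('b \<Rightarrow> 'a) \<Rightarrow> bool" where
  "covering_map Y X f \<longleftrightarrow>
     continuous_map Y X f \<and> f ` topspace Y = topspace X \<and>
     (\<forall>x\<in>topspace X. \<exists>U. openin X U \<and> x \<in> U \<and>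
        (\<exists>\<V>. \<Union>\<V> = {y \<in> topspace Y. f y \<in> U} \<and>
             (\<forall>V\<in>\<V>. openin Y V) \<and> pairwise disjnt \<V> \<and>
             (\<forall>V\<in>\<V>. homeomorphic_map (subtopology Y V) (subtopology X U) f)))"

text \<open>
  A group of bijections of \<open>S\<close> is a subgroup of the library's \<open>BijGroup S\<close>; its elements are
  extensional, so that they are determined by their values on \<open>S\<close>.
\<close>

abbreviation bij_subgroup :: "'a set \<Rightarrow> ('a \<Rightarrow> 'a) set \<Rightarrow> ('a \<Rightarrow> 'a) monoid" where
  "bij_subgroup S G \<equiv> BijGroup S\<lparr>carrier := G\<rparr>"

definition orbit_map :: "'b set \<Rightarrow> ('b \<Rightarrow> 'b) set \<Rightarrow> ('b \<Rightarrow> 'a) \<Rightarrow> 'a set \<Rightarrow> bool" where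
  "orbit_map S G f T \<longleftrightarrow>
     f ` S = T \<and> (\<forall>x\<in>S. \<forall>y\<in>S. f x = f y \<longleftrightarrow> (\<exists>g\<in>G. g x = y))"

definition regular_covering_map ::
    "'b topology \<Rightarrow> ('b \<Rightarrow> 'b) set \<Rightarrow> ('b \<Rightarrow> 'a) \<Rightarrow> 'a topology \<Rightarrow> bool" where
  "regular_covering_map Y G f X \<longleftrightarrow>
     covering_map Y X f \<and>
     subgroup G (BijGroup (topspace Y)) \<and>
     (\<forall>g\<in>G. homeomorphic_map Y Y g) \<and>
     (\<forall>g\<in>G. \<forall>y\<in>topspace Y. g y = y \<longrightarrow> g = \<one>\<^bsub>BijGroup (topspace Y)\<^esub>) \<and>
     orbit_map (topspace Y) G f (topspace X) \<and> quotient_map Y X f"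

section \<open>Uniform spaces\<close>

text \<open>
  A uniformity on \<open>S\<close> is given by its symmetric entourages, i.e. all entourages are symmetric
  by convention (and upward closure is among symmetric relations).
\<close>

definition uniformity_on :: "'a set \<Rightarrow> ('a \<times> 'a) set set \<Rightarrow> bool" where
  "uniformity_on S \<U> \<longleftrightarrow>
     \<U> \<noteq> {} \<and>
     (\<forall>E\<in>\<U>. Id_on S \<subseteq> E \<and> E \<subseteq> S \<times> S \<and> sym E) \<and>
     (\<forall>E\<in>\<U>. \<forall>F. E \<subseteq> F \<and> F \<subseteq> S \<times> S \<and> sym F \<longrightarrow> F \<in> \<U>) \<and>
     (\<forall>E\<in>\<U>. \<forall>F\<in>\<U>. E \<inter> F \<in> \<U>) \<and>
     (\<forall>E\<in>\<U>. \<exists>F\<in>\<U>. F O F \<subseteq> E)"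

definition compatible_uniformity :: "'a topology \<Rightarrow> ('a \<times> 'a) set set \<Rightarrow> bool" where
  "compatible_uniformity X \<U> \<longleftrightarrow>
     uniformity_on (topspace X) \<U> \<and>
     (\<forall>U. openin X U \<longleftrightarrow> U \<subseteq> topspace X \<and> (\<forall>x\<in>U. \<exists>E\<in>\<U>. E `` {x} \<subseteq> U))"

text \<open>Meaningful for compact Hausdorff \<open>X\<close>, which has exactly one compatible uniformity.\<close>

definition compact_uniformity :: "'a topology \<Rightarrow> ('a \<times> 'a) set set" where
  "compact_uniformity X = (THE \<U>. compatible_uniformity X \<U>)"

definition uniformly_continuous_between ::
    "'a set \<Rightarrow> ('a \<times> 'a) set set \<Rightarrow> ('b \<times> 'b) set set \<Rightarrow> ('a \<Rightarrow> 'b) \<Rightarrow> bool" where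
  "uniformly_continuous_between S \<U> \<V> h \<longleftrightarrow>
     (\<forall>F\<in>\<V>. \<exists>E\<in>\<U>. \<forall>x\<in>S. \<forall>y\<in>S. (x, y) \<in> E \<longrightarrow> (h x, h y) \<in> F)"

definition uniform_homeomorphism ::
    "'a set \<Rightarrow> ('a \<times> 'a) set set \<Rightarrow> 'b set \<Rightarrow> ('b \<times> 'b) set set \<Rightarrow> ('a \<Rightarrow> 'b) \<Rightarrow> bool" where
  "uniform_homeomorphism S \<U> T \<V> h \<longleftrightarrow>
     bij_betw h S T \<and> uniformly_continuous_between S \<U> \<V> h \<and>
     uniformly_continuous_between T \<V> \<U> (inv_into S h)"

text \<open>Completeness in the sense of the library's type-class notions \<open>cauchy_filter\<close>, \<open>complete\<close>.\<close>

definition complete_uniformity :: "'a set \<Rightarrow> ('a \<times> 'a) set set \<Rightarrow> bool" where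
  "complete_uniformity S \<U> \<longleftrightarrow>
     (\<forall>F. F \<le> principal S \<and> F \<noteq> bot \<and> (\<forall>E\<in>\<U>. \<forall>\<^sub>F p in F \<times>\<^sub>F F. p \<in> E)
        \<longrightarrow> (\<exists>x\<in>S. \<forall>E\<in>\<U>. \<forall>\<^sub>F y in F. (x, y) \<in> E))"

section \<open>Isomorphic and prodiscrete actions\<close>

definition acts_isomorphically :: "('a \<times> 'a) set set \<Rightarrow> ('a \<Rightarrow> 'a) set \<Rightarrow> bool" where
  "acts_isomorphically \<U> G \<longleftrightarrow>
     (\<forall>E\<in>\<U>. \<exists>F\<in>\<U>. F \<subseteq> E \<and> (\<forall>g\<in>G. map_prod g g ` F = F))"

definition U_set :: "'a set \<Rightarrow> ('a \<Rightarrow> 'a) set \<Rightarrow> ('a \<times> 'a) set \<Rightarrow> ('a \<Rightarrow> 'a) set" where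
  "U_set S G E = {g \<in> G. \<forall>y\<in>S. (y, g y) \<in> E}"

definition S_set :: "'a set \<Rightarrow> ('a \<Rightarrow> 'a) set \<Rightarrow> ('a \<times> 'a) set \<Rightarrow> ('a \<Rightarrow> 'a) set" where
  "S_set S G E = {g \<in> G. \<exists>y\<in>S. (y, g y) \<in> E}"

definition N_subgroup :: "'a set \<Rightarrow> ('a \<Rightarrow> 'a) set \<Rightarrow> ('a \<times> 'a) set \<Rightarrow> ('a \<Rightarrow> 'a) set" where
  "N_subgroup S G E = generate (bij_subgroup S G) (S_set S G E)"

definition acts_prodiscretely ::
    "'a set \<Rightarrow> ('a \<times> 'a) set set \<Rightarrow> ('a \<Rightarrow> 'a) set \<Rightarrow> bool" where
  "acts_prodiscretely S \<U> G \<longleftrightarrow>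
     (\<forall>E\<in>\<U>. \<exists>F\<in>\<U>. N_subgroup S G F \<subseteq> U_set S G E)"

text \<open>
  The uniformity of uniform convergence. If \<open>E\<close> is \<open>G\<close>-invariant, then
  \<open>(g y, h y) \<in> E\<close> for all \<open>y\<close> iff \<open>g\<inverse> h\<close> lies in \<open>U_set S G E\<close>, so for isomorphic actions the
  \<open>U_set S G E\<close> form a basis at the identity.
\<close>

definition uniform_convergence ::
    "'a set \<Rightarrow> ('a \<times> 'a) set set \<Rightarrow> ('a \<Rightarrow> 'a) set \<Rightarrow> (('a \<Rightarrow> 'a) \<times> ('a \<Rightarrow> 'a)) set set" where
  "uniform_convergence S \<U> G =
     {W. W \<subseteq> G \<times> G \<and> sym W \<and>
         (\<exists>E\<in>\<U>. {(g, h) \<in> G \<times> G. \<forall>y\<in>S. (g y, h y) \<in> E} \<subseteq> W)}"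

text \<open>The last conjunct says that \<open>T\<close> carries the quotient uniformity.\<close>

definition generalized_regular_covering_map ::
    "'b set \<Rightarrow> ('b \<times> 'b) set set \<Rightarrow> ('b \<Rightarrow> 'b) set \<Rightarrow> ('b \<Rightarrow> 'a) \<Rightarrow>
     'a set \<Rightarrow> ('a \<times> 'a) set set \<Rightarrow> bool" where
  "generalized_regular_covering_map S \<U> G f T \<V> \<longleftrightarrow>
     uniformity_on S \<U> \<and> uniformity_on T \<V> \<and>
     subgroup G (BijGroup S) \<and>
     acts_isomorphically \<U> G \<and> acts_prodiscretely S \<U> G \<and>
     complete_uniformity G (uniform_convergence S \<U> G) \<and>
     orbit_map S G f T \<and> \<V> = (\<lambda>E. map_prod f f ` E) ` \<U>"

section \<open>Equivalence of quotient maps\<close>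

text \<open>
  Groups act through explicit action maps \<open>\<alpha>\<close>, so that the definition applies both to groups of
  bijections (where \<open>\<alpha>\<close> is evaluation) and to a group of sequences acting coordinatewise.
\<close>

definition equivalent_quotient_maps ::
    "'b set \<Rightarrow> ('b \<times> 'b) set set \<Rightarrow> ('g, 'm) monoid_scheme \<Rightarrow> ('g \<Rightarrow> 'b \<Rightarrow> 'b) \<Rightarrow> ('b \<Rightarrow> 'a) \<Rightarrow>
     'c set \<Rightarrow> ('c \<times> 'c) set set \<Rightarrow> ('h, 'n) monoid_scheme \<Rightarrow> ('h \<Rightarrow> 'c \<Rightarrow> 'c) \<Rightarrow> ('c \<Rightarrow> 'a) \<Rightarrow> bool"
  where
  "equivalent_quotient_maps S1 \<U>1 G1 \<alpha>1 f1 S2 \<U>2 G2 \<alpha>2 f2 \<longleftrightarrow>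
     (\<exists>h \<theta>. uniform_homeomorphism S1 \<U>1 S2 \<U>2 h \<and> \<theta> \<in> iso G1 G2 \<and>
        (\<forall>g\<in>carrier G1. \<forall>y\<in>S1. h (\<alpha>1 g y) = \<alpha>2 (\<theta> g) (h y)) \<and>
        (\<forall>y\<in>S1. f2 (h y) = f1 y))"

section \<open>Covers by continua\<close>

text \<open>
  A continuum is compact metrizable and hence has at most continuum many points, so every cover
  by a continuum is equivalent to one whose points are real numbers (with an arbitrary topology,
  unrelated to the usual one). The type \<open>real\<close> thus serves as a universe for all covers.
\<close>

datatype 'a cover =
  Cover (cspace: "real topology") (cdeck: "(real \<Rightarrow> real) set") (cmap: "real \<Rightarrow> 'a")

abbreviation cpoints :: "'a cover \<Rightarrow> real set" where
  "cpoints c \<equiv> topspace (cspace c)"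

abbreviation cgroup :: "'a cover \<Rightarrow> (real \<Rightarrow> real) monoid" where
  "cgroup c \<equiv> bij_subgroup (cpoints c) (cdeck c)"

definition cover_by_continuum :: "'a topology \<Rightarrow> 'a cover \<Rightarrow> bool" where
  "cover_by_continuum X c \<longleftrightarrow>
     regular_covering_map (cspace c) (cdeck c) (cmap c) X \<and> continuum (cspace c)"

definition equivalent_covers :: "'a cover \<Rightarrow> 'a cover \<Rightarrow> bool" where
  "equivalent_covers c d \<longleftrightarrow>
     equivalent_quotient_maps
       (cpoints c) (compact_uniformity (cspace c)) (cgroup c) (\<lambda>g. g) (cmap c)
       (cpoints d) (compact_uniformity (cspace d)) (cgroup d) (\<lambda>g. g) (cmap d)"

text \<open>\<open>C\<close> contains one cover from each equivalence class, and \<open>b c\<close> is the basepoint of \<open>c\<close>.\<close>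

definition pointed_cover_system :: "'a topology \<Rightarrow> 'a cover set \<Rightarrow> ('a cover \<Rightarrow> real) \<Rightarrow> bool" where
  "pointed_cover_system X C b \<longleftrightarrow>
     (\<forall>c\<in>C. cover_by_continuum X c) \<and>
     (\<forall>d. cover_by_continuum X d \<longrightarrow> (\<exists>!c. c \<in> C \<and> equivalent_covers d c)) \<and>
     (\<exists>x\<in>topspace X. \<forall>c\<in>C. b c \<in> cpoints c \<and> cmap c (b c) = x)"

definition cover_morphism :: "'a cover \<Rightarrow> 'a cover \<Rightarrow> (real \<Rightarrow> real) \<Rightarrow> bool" where
  "cover_morphism c d h \<longleftrightarrow>
     continuous_map (cspace d) (cspace c) h \<and> h ` cpoints d = cpoints c \<and>
     (\<forall>y\<in>cpoints d. cmap d y = cmap c (h y))"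

definition cover_le :: "'a cover \<Rightarrow> 'a cover \<Rightarrow> bool" where
  "cover_le c d \<longleftrightarrow> (\<exists>h. cover_morphism c d h)"

definition bonding_map :: "('a cover \<Rightarrow> real) \<Rightarrow> 'a cover \<Rightarrow> 'a cover \<Rightarrow> real \<Rightarrow> real" where
  "bonding_map b c d =
     (THE h. h \<in> extensional (cpoints d) \<and> cover_morphism c d h \<and> h (b d) = b c)"

definition bonding_hom ::
    "('a cover \<Rightarrow> real) \<Rightarrow> 'a cover \<Rightarrow> 'a cover \<Rightarrow> (real \<Rightarrow> real) \<Rightarrow> (real \<Rightarrow> real)" where
  "bonding_hom b c d g =
     (THE k. k \<in> cdeck c \<and> (\<forall>y\<in>cpoints d. k (bonding_map b c d y) = bonding_map b c d (g y)))"

section \<open>The compact universal cover and the profinite fundamental group\<close>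

definition compact_universal_cover ::
    "'a cover set \<Rightarrow> ('a cover \<Rightarrow> real) \<Rightarrow> ('a cover \<Rightarrow> real) topology" where
  "compact_universal_cover C b =
     subtopology (product_topology cspace C)
       {x. \<forall>c\<in>C. \<forall>d\<in>C. cover_le c d \<longrightarrow> bonding_map b c d (x d) = x c}"

definition profinite_fundamental_group ::
    "'a cover set \<Rightarrow> ('a cover \<Rightarrow> real) \<Rightarrow> ('a cover \<Rightarrow> real \<Rightarrow> real) monoid" where
  "profinite_fundamental_group C b =
     product_group C cgroup
       \<lparr>carrier := {\<gamma> \<in> carrier (product_group C cgroup).
          \<forall>c\<in>C. \<forall>d\<in>C. cover_le c d \<longrightarrow> bonding_hom b c d (\<gamma> d) = \<gamma> c}\<rparr>"

definition coordinatewise_action ::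
    "'a cover set \<Rightarrow> ('a cover \<Rightarrow> real \<Rightarrow> real) \<Rightarrow> ('a cover \<Rightarrow> real) \<Rightarrow> ('a cover \<Rightarrow> real)" where
  "coordinatewise_action C \<gamma> x = (\<lambda>c\<in>C. \<gamma> c (x c))"

text \<open>On the compact universal cover, \<open>cmap c (x c)\<close> does not depend on \<open>c\<close>.\<close>

definition universal_projection :: "'a cover set \<Rightarrow> ('a cover \<Rightarrow> real) \<Rightarrow> 'a" where
  "universal_projection C x = (THE p. \<forall>c\<in>C. cmap c (x c) = p)"

text \<open>
  Up to isomorphism, the profinite fundamental group does not depend on the choice of
  representatives and basepoints; the lemma \<open>pointed_cover_system_exists\<close> below shows that such
  a choice is always possible.
\<close>

definition compactly_simply_connected :: "'a topology \<Rightarrow> bool" where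
  "compactly_simply_connected Z \<longleftrightarrow>
     continuum Z \<and>
     (\<forall>C b. pointed_cover_system Z C b \<longrightarrow>
        carrier (profinite_fundamental_group C b) = {\<one>\<^bsub>profinite_fundamental_group C b\<^esub>})"

subsection \<open>Existence of cover systems\<close>

lemma uniform_homeomorphism_id: "uniform_homeomorphism S \<U> S \<U> (\<lambda>x. x)"
  unfolding uniform_homeomorphism_def uniformly_continuous_between_def
  by (auto simp: bij_betw_def inj_on_def)

lemma uniform_homeomorphism_inv:
  assumes "uniform_homeomorphism S \<U> T \<V> h"
  shows "uniform_homeomorphism T \<V> S \<U> (inv_into S h)"
proof -
  have h: "bij_betw h S T" and u: "uniformly_continuous_between S \<U> \<V> h"
    and v: "uniformly_continuous_between T \<V> \<U> (inv_into S h)"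
    using assms by (auto simp: uniform_homeomorphism_def)
  have "inv_into T (inv_into S h) x = h x" if "x \<in> S" for x
    using inv_into_inv_into_eq[OF h that] .
  then have "uniformly_continuous_between S \<U> \<V> (inv_into T (inv_into S h))"
    using u by (auto simp: uniformly_continuous_between_def)
  then show ?thesis
    using v bij_betw_inv_into[OF h] by (simp add: uniform_homeomorphism_def)
qed

lemma uniform_homeomorphism_comp:
  assumes "uniform_homeomorphism S \<U> T \<V> h" "uniform_homeomorphism T \<V> R \<W> k"
  shows "uniform_homeomorphism S \<U> R \<W> (k \<circ> h)"
proof -
  have h: "bij_betw h S T" and k: "bij_betw k T R"
    using assms by (auto simp: uniform_homeomorphism_def)
  have comp: "uniformly_continuous_between A \<A> \<C> (q \<circ> p)"
    if pq: "uniformly_continuous_between A \<A> \<B> p" "uniformly_continuous_between B \<B> \<C> q" "p ` A \<subseteq> B"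
    for A :: "'d set" and \<A> and B :: "'e set" and \<B> and \<C> :: "('f \<times> 'f) set set" and p q
    unfolding uniformly_continuous_between_def
  proof
    fix F assume "F \<in> \<C>"
    then obtain E where E: "E \<in> \<B>" "\<forall>x\<in>B. \<forall>y\<in>B. (x, y) \<in> E \<longrightarrow> (q x, q y) \<in> F"
      using pq(2) unfolding uniformly_continuous_between_def by blast
    then obtain D where D: "D \<in> \<A>" "\<forall>x\<in>A. \<forall>y\<in>A. (x, y) \<in> D \<longrightarrow> (p x, p y) \<in> E"
      using pq(1) unfolding uniformly_continuous_between_def by blast
    show "\<exists>E\<in>\<A>. \<forall>x\<in>A. \<forall>y\<in>A. (x, y) \<in> E \<longrightarrow> ((q \<circ> p) x, (q \<circ> p) y) \<in> F"
      using D E pq(3) by (intro bexI[of _ D]) (auto simp: image_subset_iff)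
  qed
  have 1: "uniformly_continuous_between S \<U> \<W> (k \<circ> h)"
    using assms h by (intro comp[of S \<U> \<V> h T]) (auto simp: uniform_homeomorphism_def bij_betw_def)
  have 2: "uniformly_continuous_between R \<W> \<U> (inv_into S h \<circ> inv_into T k)"
    using assms k by (intro comp[of R \<W> \<V> _ T])
      (auto simp: uniform_homeomorphism_def bij_betw_def inv_into_into)
  have "inv_into S (k \<circ> h) z = (inv_into S h \<circ> inv_into T k) z" if "z \<in> R" for z
    using h k that by (subst inv_into_comp) (auto simp: bij_betw_def)
  then have "uniformly_continuous_between R \<W> \<U> (inv_into S (k \<circ> h))"
    using 2 by (auto simp: uniformly_continuous_between_def)
  then show ?thesis
    using 1 bij_betw_trans[OF h k] by (simp add: uniform_homeomorphism_def)
qed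

lemma equivalent_covers_refl: "equivalent_covers c c"
  unfolding equivalent_covers_def equivalent_quotient_maps_def
  by (rule exI[of _ "\<lambda>x. x"], rule exI[of _ "\<lambda>x. x"])
     (auto simp: uniform_homeomorphism_id iso_def hom_def bij_betw_def inj_on_def)

lemma equivalent_covers_trans:
  assumes "equivalent_covers c d" "equivalent_covers d e"
  shows "equivalent_covers c e"
proof -
  obtain h \<theta> where h:
      "uniform_homeomorphism (cpoints c) (compact_uniformity (cspace c))
         (cpoints d) (compact_uniformity (cspace d)) h"
      "\<theta> \<in> iso (cgroup c) (cgroup d)"
      "\<forall>g\<in>carrier (cgroup c). \<forall>y\<in>cpoints c. h (g y) = \<theta> g (h y)"
      "\<forall>y\<in>cpoints c. cmap d (h y) = cmap c y"
    using assms(1) unfolding equivalent_covers_def equivalent_quotient_maps_def by blast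
  obtain k \<eta> where k:
      "uniform_homeomorphism (cpoints d) (compact_uniformity (cspace d))
         (cpoints e) (compact_uniformity (cspace e)) k"
      "\<eta> \<in> iso (cgroup d) (cgroup e)"
      "\<forall>g\<in>carrier (cgroup d). \<forall>y\<in>cpoints d. k (g y) = \<eta> g (k y)"
      "\<forall>y\<in>cpoints d. cmap e (k y) = cmap d y"
    using assms(2) unfolding equivalent_covers_def equivalent_quotient_maps_def by blast
  have hd: "h y \<in> cpoints d" if "y \<in> cpoints c" for y
    using h(1) that by (auto simp: uniform_homeomorphism_def bij_betw_def)
  have \<theta>d: "\<theta> g \<in> carrier (cgroup d)" if "g \<in> carrier (cgroup c)" for g
    using h(2) that by (auto simp: iso_def hom_def)
  show ?thesis
    unfolding equivalent_covers_def equivalent_quotient_maps_def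
  proof (intro exI conjI ballI)
    show "uniform_homeomorphism (cpoints c) (compact_uniformity (cspace c))
        (cpoints e) (compact_uniformity (cspace e)) (k \<circ> h)"
      using uniform_homeomorphism_comp[OF h(1) k(1)] .
    show "\<eta> \<circ> \<theta> \<in> iso (cgroup c) (cgroup e)"
      using iso_set_trans[OF h(2) k(2)] .
  qed (use h k hd \<theta>d in auto)
qed

lemma equivalent_covers_sym:
  assumes eq: "equivalent_covers c d"
    and c: "cover_by_continuum X c"
  shows "equivalent_covers d c"
proof -
  obtain h \<theta> where h:
      "uniform_homeomorphism (cpoints c) (compact_uniformity (cspace c))
         (cpoints d) (compact_uniformity (cspace d)) h"
      "\<theta> \<in> iso (cgroup c) (cgroup d)"
      "\<forall>g\<in>carrier (cgroup c). \<forall>y\<in>cpoints c. h (g y) = \<theta> g (h y)"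
      "\<forall>y\<in>cpoints c. cmap d (h y) = cmap c y"
    using eq unfolding equivalent_covers_def equivalent_quotient_maps_def by blast
  have bij: "bij_betw h (cpoints c) (cpoints d)"
    using h(1) by (simp add: uniform_homeomorphism_def)
  have sub: "subgroup (cdeck c) (BijGroup (cpoints c))"
    using c by (simp add: cover_by_continuum_def regular_covering_map_def)
  then have grp: "group (cgroup c)"
    by (rule subgroup.subgroup_is_group) (rule group_BijGroup)
  have gB: "g \<in> Bij (cpoints c)" if "g \<in> cdeck c" for g
    using subgroup.subset[OF sub] that by (auto simp: BijGroup_def)
  let ?k = "inv_into (cpoints c) h" and ?\<eta> = "inv_into (carrier (cgroup c)) \<theta>"
  have \<theta>: "bij_betw \<theta> (carrier (cgroup c)) (carrier (cgroup d))"
    using h(2) by (simp add: iso_def)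
  show ?thesis
    unfolding equivalent_covers_def equivalent_quotient_maps_def
  proof (intro exI conjI ballI)
    show "uniform_homeomorphism (cpoints d) (compact_uniformity (cspace d))
        (cpoints c) (compact_uniformity (cspace c)) ?k"
      using uniform_homeomorphism_inv[OF h(1)] .
    show "?\<eta> \<in> iso (cgroup d) (cgroup c)"
      using group.iso_set_sym[OF grp h(2)] .
    fix y assume y: "y \<in> cpoints d"
    define x where "x = ?k y"
    have x: "x \<in> cpoints c" "h x = y"
      using bij y by (auto simp: x_def bij_betw_def inv_into_into f_inv_into_f)
    show "cmap c (?k y) = cmap d y"
      using h(4) x by (metis x_def)
    fix g assume g: "g \<in> carrier (cgroup d)"
    define g' where "g' = ?\<eta> g"
    have g': "g' \<in> carrier (cgroup c)" "\<theta> g' = g"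
      using \<theta> g by (auto simp: g'_def bij_betw_def inv_into_into f_inv_into_f)
    have "g' x \<in> cpoints c"
      using gB[of g'] g' x by (auto dest!: Bij_imp_funcset)
    moreover have "h (g' x) = g y"
      using h(3) g' x by auto
    ultimately have "?k (g y) = g' x"
      using bij by (metis bij_betw_inv_into_left)
    then show "?k (g y) = ?\<eta> g (?k y)"
      by (simp add: g'_def x_def)
  qed
qed

lemma pointed_cover_system_exists:
  fixes X :: "'a topology"
  assumes "continuum X"
  shows "\<exists>C b. pointed_cover_system X C b"
proof -
  define r where "r d = (SOME c. cover_by_continuum X c \<and> equivalent_covers d c)" for d
  have r: "cover_by_continuum X (r d)" "equivalent_covers d (r d)" if "cover_by_continuum X d" for d
    using someI[of "\<lambda>c. cover_by_continuum X c \<and> equivalent_covers d c" d]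
      that equivalent_covers_refl unfolding r_def by auto
  have req: "r d = r e" if "cover_by_continuum X d" "cover_by_continuum X e" "equivalent_covers d e"
    for d e
  proof -
    have "equivalent_covers d c \<longleftrightarrow> equivalent_covers e c" for c
      using that equivalent_covers_trans equivalent_covers_sym by blast
    then show ?thesis
      by (simp only: r_def)
  qed
  obtain x where x: "x \<in> topspace X"
    using assms unfolding continuum_def by blast
  define C where "C = r ` {d. cover_by_continuum X d}"
  define b where "b c = (SOME y. y \<in> cpoints c \<and> cmap c y = x)" for c :: "'a cover"
  have C: "cover_by_continuum X c" if "c \<in> C" for c
    using that r(1) by (auto simp: C_def)
  have b: "b c \<in> cpoints c \<and> cmap c (b c) = x" if "c \<in> C" for c
  proof -
    have "cmap c ` cpoints c = topspace X"
      using C[OF that]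
      by (simp add: cover_by_continuum_def regular_covering_map_def covering_map_def)
    with x have "x \<in> cmap c ` cpoints c"
      by (simp only:)
    then have "\<exists>y. y \<in> cpoints c \<and> cmap c y = x"
      by blast
    then show ?thesis
      unfolding b_def by (rule someI_ex)
  qed
  have "\<exists>!c. c \<in> C \<and> equivalent_covers d c" if d: "cover_by_continuum X d" for d
  proof (rule ex1I[of _ "r d"])
    show "r d \<in> C \<and> equivalent_covers d (r d)"
      using d r(2) by (auto simp: C_def)
    fix c assume c: "c \<in> C \<and> equivalent_covers d c"
    then obtain e where e: "cover_by_continuum X e" "c = r e"
      by (auto simp: C_def)
    have "r d = r c"
      using req[OF d C, of c] c by (simp only:)
    also have "r c = r e"
      using req[OF e(1) r(1)[OF e(1)] r(2)[OF e(1)]] e(2) by (simp only:)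
    finally show "c = r d"
      using e(2) by (simp only:)
  qed
  moreover have "\<exists>x\<in>topspace X. \<forall>c\<in>C. b c \<in> cpoints c \<and> cmap c (b c) = x"
    using x b by (intro bexI[of _ x] ballI)
  ultimately have "pointed_cover_system X C b"
    unfolding pointed_cover_system_def by (intro conjI allI impI ballI C)
  then show ?thesis
    by blast
qed

end

theory Submission
  imports Defs
begin

text \<open>
  A cover of \<open>X\<close> by a continuum is determined by its projection: by uniqueness of lifts, the group
  consists of all homeomorphisms over \<open>X\<close>. The proof therefore works with \<^emph>\<open>normal covers\<close>, compact
  metrizable spaces with a locally injective map to \<open>X\<close> and enough homeomorphisms over \<open>X\<close> to permute
  every fibre transitively. They may be disconnected, so that pullbacks, fibre products and
  Galois closures stay in the class; covers by continua are recovered as connected clopen pieces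
  (\<open>normal_cover_connected_piece\<close>). A piece of a fibre product shows that the covers are directed,
  and compactness makes the projections of \<open>Xhat\<close>, the inverse limit, surjective, so \<open>Xhat\<close> is
  connected. It is metrizable because there are only countably many covers up to equivalence
  (\<open>countable_inequivalent_covers\<close>): finitely many small sheets over sets of a countable basis, and
  the information which of the sheets meet, determine a cover.

  The same surjectivity identifies \<open>piP\<close> with a fibre of \<open>Xhat\<close> over \<open>X\<close>. Hence a continuum is compactly
  simply connected iff all its covers by continua are injective
  (\<open>compactly_simply_connected_iff\<close>), and maps from such a continuum lift through normal covers
  (\<open>compactly_simply_connected_lift\<close>).

  \<^emph>\<open>Uniqueness.\<close> Let \<open>Y\<close> be compactly simply connected and \<open>f\<close> a generalized regular covering map with
  group \<open>G\<close>. Lifting \<open>f\<close> through all covers gives a continuous map \<open>H\<close> from \<open>Y\<close> onto \<open>Xhat\<close>. It is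
  injective because two points of a fibre are distinguished by some \<open>Y\<close> modulo \<open>N F\<close>, where \<open>N F\<close> is
  the subgroup generated by the elements that move some point by less than an entourage \<open>F\<close>: these
  quotients are covers of \<open>X\<close> (\<open>quotient_by_N\<close>), hence members of the system. So \<open>H\<close> is a
  homeomorphism, and it conjugates \<open>G\<close> to \<open>piP\<close> since both groups act freely and have the fibres as
  orbits.

  \<^emph>\<open>Xhat is compactly simply connected.\<close> A cover \<open>W\<close> of \<open>Xhat\<close> by a continuum is already visible at a
  finite level: there are \<open>c\<close> and a quotient \<open>Z\<close> of \<open>W\<close> that is a normal cover of \<open>cspace c\<close> and pulls
  back to \<open>W\<close>. The Galois closure of the tower from \<open>Z\<close> over \<open>cspace c\<close> to \<open>X\<close> is dominated by the
  system, so the projection of \<open>Xhat\<close> to \<open>cspace c\<close> lifts to \<open>Z\<close> (\<open>Xhat_lifts_through_tower\<close>). By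
  uniqueness of lifts the quotient map from \<open>W\<close> to \<open>Z\<close> then factors through \<open>Xhat\<close>; but it
  distinguishes the points of each fibre of \<open>W\<close> over \<open>Xhat\<close>, so these fibres are single points.
\<close>

section \<open>Compact metrizable spaces\<close>

lemma compact_metrizable_imp_second_countable:
  assumes "compact_space X" "metrizable_space X"
  shows "second_countable X"
proof -
  obtain M d where M: "Metric_space M d" and X: "X = Metric_space.mtopology M d"
    using assms(2) unfolding metrizable_space_def by blast
  interpret Metric_space M d by (rule M)
  have "mtotally_bounded M"
    using assms(1) X compactin_imp_mtotally_bounded by (simp add: compact_space_def)
  then have "\<exists>K. finite K \<and> K \<subseteq> M \<and> M \<subseteq> (\<Union>x\<in>K. mball x (inverse (Suc n)))" for n :: nat
    unfolding mtotally_bounded_def by simp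
  then obtain K where K: "\<And>n. finite (K n)" "\<And>n. K n \<subseteq> M"
      "\<And>n::nat. M \<subseteq> (\<Union>x\<in>K n. mball x (inverse (Suc n)))"
    by metis
  let ?B = "\<Union>n. (\<lambda>x. mball x (inverse (Suc n))) ` K n"
  have "\<exists>V\<in>?B. x \<in> V \<and> V \<subseteq> U" if U: "openin X U" "x \<in> U" for U x
  proof -
    obtain e where e: "e > 0" "mball x e \<subseteq> U"
      using U X openin_mtopology by auto
    have x: "x \<in> M"
      using U X openin_mtopology by auto
    obtain n :: nat where n: "inverse (Suc n) < e / 2"
      using reals_Archimedean[of "e / 2"] e by auto
    obtain y where y: "y \<in> K n" "x \<in> mball y (inverse (Suc n))"
      using K(3)[of n] x by auto
    have "mball y (inverse (Suc n)) \<subseteq> mball x e"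
    proof
      fix z assume z: "z \<in> mball y (inverse (Suc n))"
      have "d x z \<le> d x y + d y z"
        using x y z by (auto intro: triangle)
      then show "z \<in> mball x e"
        using y z x n by (auto simp: commute)
    qed
    then show ?thesis
      using y e by blast
  qed
  moreover have "countable ?B"
    by (rule countable_UN) (simp_all add: countable_finite K(1) del: of_nat_Suc)
  moreover have "\<forall>V\<in>?B. openin X V"
    using openin_mball X by blast
  ultimately show ?thesis
    unfolding second_countable_def by (intro exI[of _ ?B] conjI allI impI) simp_all
qed

lemma metrizable_if_countable_separating_functions:
  fixes g :: "'i \<Rightarrow> 'a \<Rightarrow> real"
  assumes "compact_space Z" "countable I"
    and cont: "\<And>i. i \<in> I \<Longrightarrow> continuous_map Z euclideanreal (g i)"
    and sep: "\<And>x y. \<lbrakk>x \<in> topspace Z; y \<in> topspace Z; x \<noteq> y\<rbrakk> \<Longrightarrow> \<exists>i\<in>I. g i x \<noteq> g i y"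
  shows "metrizable_space Z"
proof -
  let ?P = "product_topology (\<lambda>_. euclideanreal) I"
  let ?e = "\<lambda>x. \<lambda>i\<in>I. g i x"
  have met: "metrizable_space ?P"
    using assms(2) countable_subset[of _ I]
    by (auto simp: metrizable_space_product_topology metrizable_space_euclidean)
  have "continuous_map Z ?P ?e"
    using cont by (auto simp: continuous_map_componentwise)
  moreover have "inj_on ?e (topspace Z)"
    using sep by (intro inj_onI) (metis restrict_apply')
  ultimately have "embedding_map Z ?P ?e"
    using assms(1) met metrizable_imp_Hausdorff_space continuous_imp_embedding_map by blast
  then show ?thesis
    using met embedding_map_imp_homeomorphic_space homeomorphic_metrizable_space
      metrizable_space_subtopology by blast
qed

text \<open>
  Finite unions of basic open sets are cofinal among the neighbourhoods of a (compact) fibre. Their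
  largest saturated parts give countably many open sets that form a basis of the image, and Urysohn
  functions for pairs of them with disjoint closures separate points.
\<close>

lemma metrizable_continuous_image:
  assumes X: "compact_space X" "metrizable_space X"
    and Z: "Hausdorff_space Z" and f: "continuous_map X Z f" "f ` topspace X = topspace Z"
  shows "metrizable_space Z"
proof -
  obtain \<B> where \<B>: "countable \<B>" "\<forall>V\<in>\<B>. openin X V"
      "\<And>U x. openin X U \<Longrightarrow> x \<in> U \<Longrightarrow> \<exists>V\<in>\<B>. x \<in> V \<and> V \<subseteq> U"
    using compact_metrizable_imp_second_countable[OF X] unfolding second_countable_def by metis
  define \<F> where "\<F> = \<Union> ` {F. finite F \<and> F \<subseteq> \<B>}"
  define N where "N A = topspace Z - f ` (topspace X - A)" for A
  define I where "I = {(A, B) \<in> \<F> \<times> \<F>. Z closure_of N A \<inter> Z closure_of N B = {}}"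
  have compZ: "compact_space Z"
    using X(1) f image_compactin unfolding compact_space_def by metis
  have normZ: "normal_space Z" and regZ: "regular_space Z"
    using compZ Z compact_Hausdorff_or_regular_imp_normal_space
      compact_Hausdorff_imp_regular_space by blast+
  have "countable \<F>"
    unfolding \<F>_def using \<B>(1) by (intro countable_image countable_Collect_finite_subset)
  then have "countable (\<F> \<times> \<F>)"
    by simp
  then have "countable I"
    by (rule countable_subset[rotated]) (auto simp: I_def)
  have "\<exists>g. continuous_map Z euclideanreal g \<and> g ` (Z closure_of N A) \<subseteq> {0} \<and>
          g ` (Z closure_of N B) \<subseteq> {1}" if "(A, B) \<in> I" for A B
  proof -
    have "disjnt (Z closure_of N A) (Z closure_of N B)"
      using that by (auto simp: I_def disjnt_def)
    then obtain g where "continuous_map Z (top_of_set {0..1::real}) g"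
        "g ` (Z closure_of N A) \<subseteq> {0}" "g ` (Z closure_of N B) \<subseteq> {1}"
      using Urysohn_lemma[OF normZ closedin_closure_of closedin_closure_of _ zero_le_one] by metis
    then show ?thesis
      using continuous_map_into_fulltopology by (intro exI[of _ g] conjI)
  qed
  then have "\<forall>p\<in>I. \<exists>g. continuous_map Z euclideanreal g \<and> g ` (Z closure_of N (fst p)) \<subseteq> {0} \<and>
          g ` (Z closure_of N (snd p)) \<subseteq> {1}"
    by (metis prod.collapse)
  then obtain g where g: "\<And>p. p \<in> I \<Longrightarrow> continuous_map Z euclideanreal (g p) \<and>
      g p ` (Z closure_of N (fst p)) \<subseteq> {0} \<and> g p ` (Z closure_of N (snd p)) \<subseteq> {1}"
    by metis
  have small: "\<exists>A\<in>\<F>. z \<in> N A \<and> N A \<subseteq> V" if V: "openin Z V" "z \<in> V" for V z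
  proof -
    have pre: "openin X {x \<in> topspace X. f x \<in> V}"
      using f(1) V(1) openin_continuous_map_preimage by blast
    have z: "z \<in> topspace Z"
      using V openin_subset by blast
    have "compactin X {x \<in> topspace X. f x = z}"
      using X(1) f(1) Z z closedin_compact_space closedin_continuous_map_preimage[of X Z f "{z}"]
        closedin_Hausdorff_singleton by fastforce
    moreover have "{x \<in> topspace X. f x = z} \<subseteq> \<Union>{B\<in>\<B>. B \<subseteq> {x \<in> topspace X. f x \<in> V}}"
      using \<B>(3)[OF pre] V by blast
    ultimately obtain F where F: "finite F" "F \<subseteq> {B\<in>\<B>. B \<subseteq> {x \<in> topspace X. f x \<in> V}}"
        "{x \<in> topspace X. f x = z} \<subseteq> \<Union>F"
      unfolding compactin_def using \<B>(2)
      by (metis (no_types, lifting) mem_Collect_eq)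
    then have "\<Union>F \<in> \<F>"
      unfolding \<F>_def by blast
    moreover have "z \<in> N (\<Union>F)"
      using F(3) z by (auto simp: N_def)
    moreover have "N (\<Union>F) \<subseteq> V"
    proof
      fix y assume y: "y \<in> N (\<Union>F)"
      then obtain x where "x \<in> topspace X" "y = f x"
        using f(2) by (auto simp: N_def)
      with y have "x \<in> \<Union>F"
        by (auto simp: N_def)
      with F(2) \<open>y = f x\<close> show "y \<in> V"
        by auto
    qed
    ultimately show ?thesis
      by blast
  qed
  show ?thesis
  proof (rule metrizable_if_countable_separating_functions[OF compZ \<open>countable I\<close>, of g])
    fix x y assume xy: "x \<in> topspace Z" "y \<in> topspace Z" "x \<noteq> y"
    have "\<exists>U V. openin Z U \<and> openin Z V \<and> x \<in> U \<and> y \<in> V \<and> Z closure_of U \<inter> Z closure_of V = {}"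
    proof -
      obtain U V where UV: "openin Z U" "openin Z V" "x \<in> U" "y \<in> V" "disjnt U V"
        using xy Z unfolding Hausdorff_space_def by metis
      have shrink: "\<exists>U'. openin Z U' \<and> x \<in> U' \<and> Z closure_of U' \<subseteq> U"
        if "openin Z U" "x \<in> U" for U x
      proof -
        have "closedin Z (topspace Z - U)" "x \<in> topspace Z - (topspace Z - U)"
          using that openin_subset by auto
        then obtain U' where "openin Z U'" "x \<in> U'" "disjnt (topspace Z - U) (Z closure_of U')"
          using regZ unfolding regular_space[of Z] by metis
        then show ?thesis
          using closure_of_subset_topspace[of Z U'] by (auto simp: disjnt_def)
      qed
      obtain U' where U': "openin Z U'" "x \<in> U'" "Z closure_of U' \<subseteq> U"
        using shrink UV by metis
      obtain V' where V': "openin Z V'" "y \<in> V'" "Z closure_of V' \<subseteq> V"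
        using shrink UV by metis
      have "Z closure_of U' \<inter> Z closure_of V' = {}"
        using U'(3) V'(3) UV(5) unfolding disjnt_def by blast
      then show ?thesis
        using U'(1,2) V'(1,2) by metis
    qed
    then obtain U V where UV: "openin Z U" "openin Z V" "x \<in> U" "y \<in> V"
        "Z closure_of U \<inter> Z closure_of V = {}"
      by blast
    obtain A where A: "A \<in> \<F>" "x \<in> N A" "N A \<subseteq> U"
      using small UV by blast
    obtain B where B: "B \<in> \<F>" "y \<in> N B" "N B \<subseteq> V"
      using small UV by blast
    have p: "(A, B) \<in> I"
      using A B UV(5) closure_of_mono[OF A(3), of Z] closure_of_mono[OF B(3), of Z]
      unfolding I_def by blast
    have "x \<in> Z closure_of N A" "y \<in> Z closure_of N B"
      using A B xy closure_of_subset[of "N A" Z] closure_of_subset[of "N B" Z]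
      by (auto simp: N_def)
    then have "g (A, B) x = 0" "g (A, B) y = 1"
      using g[OF p] by auto
    then show "\<exists>i\<in>I. g i x \<noteq> g i y"
      using p by (metis zero_neq_one)
  qed (use g in blast)
qed

definition quotient_space :: "'a topology \<Rightarrow> ('a \<Rightarrow> 'b) \<Rightarrow> 'b topology" where
  "quotient_space X q = topology (\<lambda>U. U \<subseteq> q ` topspace X \<and> openin X {x \<in> topspace X. q x \<in> U})"

lemma quotient_map_quotient_space: "quotient_map X (quotient_space X q) q"
proof -
  have "istopology (\<lambda>U. U \<subseteq> q ` topspace X \<and> openin X {x \<in> topspace X. q x \<in> U})"
    unfolding istopology_def
  proof (intro conjI allI impI)
    fix S T assume ST: "S \<subseteq> q ` topspace X \<and> openin X {x \<in> topspace X. q x \<in> S}"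
      "T \<subseteq> q ` topspace X \<and> openin X {x \<in> topspace X. q x \<in> T}"
    have "{x \<in> topspace X. q x \<in> S \<inter> T} = {x \<in> topspace X. q x \<in> S} \<inter> {x \<in> topspace X. q x \<in> T}"
      by blast
    then show "openin X {x \<in> topspace X. q x \<in> S \<inter> T}"
      using ST by (simp add: openin_Int)
  next
    fix \<K> assume K: "\<forall>K\<in>\<K>. K \<subseteq> q ` topspace X \<and> openin X {x \<in> topspace X. q x \<in> K}"
    have "{x \<in> topspace X. q x \<in> \<Union>\<K>} = (\<Union>K\<in>\<K>. {x \<in> topspace X. q x \<in> K})"
      by blast
    then show "openin X {x \<in> topspace X. q x \<in> \<Union>\<K>}"
      using K by auto
  qed auto
  then have op: "openin (quotient_space X q) U \<longleftrightarrow>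
      U \<subseteq> q ` topspace X \<and> openin X {x \<in> topspace X. q x \<in> U}" for U
    unfolding quotient_space_def by (simp add: topology_inverse')
  have "{x \<in> topspace X. q x \<in> q ` topspace X} = topspace X"
    by blast
  then have "openin (quotient_space X q) (q ` topspace X)"
    by (simp add: op)
  then have "topspace (quotient_space X q) = q ` topspace X"
    by (meson op openin_subset openin_topspace subset_antisym)
  then show ?thesis
    unfolding quotient_map_def by (auto simp: op)
qed

text \<open>
  The saturation of a closed set is the projection of a closed subset of the compact square, so the
  quotient map is closed, and normality passes to the quotient.
\<close>

lemma quotient_map_compact_metrizable:
  assumes X: "compact_space X" "metrizable_space X" and q: "quotient_map X Z q"
    and ker: "closedin (prod_topology X X) {(x, y) \<in> topspace X \<times> topspace X. q x = q y}"
  shows "compact_space Z \<and> metrizable_space Z"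
proof -
  let ?R = "{(x, y) \<in> topspace X \<times> topspace X. q x = q y}"
  have qc: "continuous_map X Z q" and qs: "q ` topspace X = topspace Z"
    using quotient_imp_continuous_map[OF q] quotient_imp_surjective_map[OF q] by auto
  have Haus: "Hausdorff_space X"
    using X(2) by (rule metrizable_imp_Hausdorff_space)
  have "closedin Z (q ` K)" if K: "closedin X K" for K
  proof -
    have "closedin (prod_topology X X) (topspace X \<times> K)"
      using K by (simp add: closedin_prod_Times_iff)
    then have "closedin (prod_topology X X) (?R \<inter> topspace X \<times> K)"
      using ker by (rule closedin_Int[rotated])
    moreover have "closed_map (prod_topology X X) X fst"
      using X Haus by (intro continuous_imp_closed_map)
        (auto simp: continuous_map_fst compact_space_prod_topology)
    ultimately have "closedin X (fst ` (?R \<inter> topspace X \<times> K))"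
      unfolding closed_map_def by blast
    moreover have "fst ` (?R \<inter> topspace X \<times> K) = {x \<in> topspace X. q x \<in> q ` K}"
      using closedin_subset[OF K] by force
    moreover have "q ` K \<subseteq> topspace Z"
      using closedin_subset[OF K] qs by blast
    moreover have "closedin Z U" if "U \<subseteq> topspace Z" "closedin X {x \<in> topspace X. q x \<in> U}" for U
      using q that unfolding quotient_map_closedin by simp
    ultimately show ?thesis
      by (simp only:)
  qed
  then have "closed_map X Z q"
    unfolding closed_map_def by blast
  then have "Hausdorff_space Z"
    using Hausdorff_normal_space_closed_continuous_map_image[OF metrizable_imp_normal_space[OF X(2)]]
      t1_space_closed_map_image[of X Z q] qc qs metrizable_imp_t1_space[OF X(2)] by blast
  moreover have "compact_space Z"
    using X(1) qc qs image_compactin unfolding compact_space_def by metis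
  ultimately show ?thesis
    using metrizable_continuous_image X qc qs by blast
qed

text \<open>
  Two classes in different fibres of \<open>p\<close> are separated by open sets of \<open>X\<close>, so only classes inside one
  fibre have to be kept apart by hand.
\<close>

lemma closed_kernel_over:
  assumes p: "continuous_map W X p" and X: "Hausdorff_space X"
    and factors: "\<And>x y. \<lbrakk>x \<in> topspace W; y \<in> topspace W; q x = q y\<rbrakk> \<Longrightarrow> p x = p y"
    and isolated: "\<And>x y. \<lbrakk>x \<in> topspace W; y \<in> topspace W; p x = p y; q x \<noteq> q y\<rbrakk> \<Longrightarrow>
      \<exists>U V. openin W U \<and> openin W V \<and> x \<in> U \<and> y \<in> V \<and> (\<forall>u\<in>U. \<forall>v\<in>V. q u \<noteq> q v)"
  shows "closedin (prod_topology W W) {(x, y) \<in> topspace W \<times> topspace W. q x = q y}"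
proof -
  let ?P = "prod_topology W W"
  let ?R = "{(x, y) \<in> topspace W \<times> topspace W. q x = q y}"
  have sep: "\<exists>U V. openin W U \<and> openin W V \<and> x \<in> U \<and> y \<in> V \<and> (\<forall>u\<in>U. \<forall>v\<in>V. q u \<noteq> q v)"
    if xy: "x \<in> topspace W" "y \<in> topspace W" "q x \<noteq> q y" for x y
  proof (cases "p x = p y")
    case True
    then show ?thesis
      using isolated xy by blast
  next
    case False
    have "p x \<in> topspace X" "p y \<in> topspace X"
      using continuous_map_image_subset_topspace[OF p] xy by blast+
    then obtain U V where UV: "openin X U" "openin X V" "p x \<in> U" "p y \<in> V" "disjnt U V"
      using X False unfolding Hausdorff_space_def by metis
    have "q u \<noteq> q v" if "u \<in> {w \<in> topspace W. p w \<in> U}" "v \<in> {w \<in> topspace W. p w \<in> V}" for u v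
      using factors[of u v] that UV(5) by (auto simp: disjnt_iff)
    then show ?thesis
      using xy(1,2) UV openin_continuous_map_preimage[OF p UV(1)] openin_continuous_map_preimage[OF p UV(2)]
      by (intro exI[of _ "{w \<in> topspace W. p w \<in> U}"] exI[of _ "{w \<in> topspace W. p w \<in> V}"]) simp
  qed
  have "openin ?P (topspace ?P - ?R)"
  proof (subst openin_subopen, intro ballI)
    fix s assume s: "s \<in> topspace ?P - ?R"
    obtain x y where xy: "s = (x, y)" "x \<in> topspace W" "y \<in> topspace W" "q x \<noteq> q y"
      using s by (cases s) auto
    obtain U V where UV: "openin W U" "openin W V" "x \<in> U" "y \<in> V" "\<forall>u\<in>U. \<forall>v\<in>V. q u \<noteq> q v"
      using sep[OF xy(2-4)] by blast
    have "openin ?P (U \<times> V)"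
      using UV(1,2) by (simp add: openin_prod_Times_iff)
    moreover have "U \<times> V \<subseteq> topspace ?P - ?R"
      using UV(5) openin_subset[OF UV(1)] openin_subset[OF UV(2)] by auto
    ultimately show "\<exists>T. openin ?P T \<and> s \<in> T \<and> T \<subseteq> topspace ?P - ?R"
      using UV(3,4) xy(1) by (intro exI[of _ "U \<times> V"]) simp
  qed
  then show ?thesis
    unfolding closedin_def by auto
qed

lemma directed_closed_family_meets:
  assumes K: "compact_space K" and C: "C \<noteq> {}"
    and cl: "\<And>c. c \<in> C \<Longrightarrow> closedin K (A c)" and ne: "\<And>c. c \<in> C \<Longrightarrow> A c \<noteq> {}"
    and dir: "\<And>c d. c \<in> C \<Longrightarrow> d \<in> C \<Longrightarrow> \<exists>e\<in>C. A e \<subseteq> A c \<inter> A d"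
  shows "\<exists>x\<in>topspace K. \<forall>c\<in>C. x \<in> A c"
proof -
  have fin: "\<exists>e\<in>C. A e \<subseteq> \<Inter> (A ` D)" if "finite D" "D \<subseteq> C" for D
    using that
  proof (induction D)
    case empty
    then show ?case using C by auto
  next
    case (insert d D)
    then obtain e where "e \<in> C" "A e \<subseteq> \<Inter> (A ` D)"
      by auto
    moreover have "d \<in> C"
      using insert by blast
    ultimately obtain e' where "e' \<in> C" "A e' \<subseteq> A d \<inter> A e"
      using dir by blast
    with \<open>A e \<subseteq> \<Inter> (A ` D)\<close> show ?case
      by (intro bexI[of _ e']) auto
  qed
  have "\<Inter>\<F> \<noteq> {}" if F: "finite \<F>" "\<F> \<subseteq> A ` C" for \<F>
  proof -
    obtain D where "finite D" "D \<subseteq> C" "\<F> = A ` D"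
      using finite_subset_image[OF F] by blast
    then show ?thesis
      using fin ne by fastforce
  qed
  then have "\<Inter> (A ` C) \<noteq> {}"
    using K[unfolded compact_space_fip, rule_format, of "A ` C"] cl by blast
  then obtain x where "x \<in> \<Inter> (A ` C)"
    by blast
  moreover obtain c where "c \<in> C"
    using C by blast
  ultimately show ?thesis
    using closedin_subset[OF cl] by blast
qed

section \<open>Locally injective maps and unique lifts\<close>

definition locally_injective :: "'b topology \<Rightarrow> ('b \<Rightarrow> 'a) \<Rightarrow> bool" where
  "locally_injective Y f \<longleftrightarrow> (\<forall>y\<in>topspace Y. \<exists>U. openin Y U \<and> y \<in> U \<and> inj_on f U)"

text \<open>
  The points where two lifts agree form a closed set, and an open one since the map is locally
  injective.
\<close>

lemma lifts_unique:
  assumes Z: "connected_space Z" and Y: "Hausdorff_space Y" "locally_injective Y f"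
    and h: "continuous_map Z Y h" and k: "continuous_map Z Y k"
    and over: "\<And>z. z \<in> topspace Z \<Longrightarrow> f (h z) = f (k z)"
    and z0: "z0 \<in> topspace Z" "h z0 = k z0" and z: "z \<in> topspace Z"
  shows "h z = k z"
proof -
  let ?A = "{z \<in> topspace Z. h z = k z}"
  have "closedin Z ?A"
    using Y(1) h k by (rule closedin_continuous_maps_eq)
  moreover have "openin Z ?A"
  proof (subst openin_subopen, safe)
    fix z assume z: "z \<in> topspace Z" "h z = k z"
    have "h z \<in> topspace Y"
      using continuous_map_image_subset_topspace[OF h] z by blast
    then obtain U where U: "openin Y U" "h z \<in> U" "inj_on f U"
      using Y(2) unfolding locally_injective_def by blast
    let ?T = "{z \<in> topspace Z. h z \<in> U} \<inter> {z \<in> topspace Z. k z \<in> U}"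
    have "openin Z ?T"
      using h k U(1) by (intro openin_Int openin_continuous_map_preimage)
    moreover have "z \<in> ?T"
      using z U by simp
    moreover have "?T \<subseteq> ?A"
      using over U(3) by (auto dest: inj_onD)
    ultimately show "\<exists>T. openin Z T \<and> z \<in> T \<and> T \<subseteq> ?A"
      by blast
  qed
  ultimately have "?A = topspace Z"
    using Z z0 unfolding connected_space_clopen_in by blast
  then show ?thesis
    using z by blast
qed

text \<open>
  Near a point the lift \<open>h\<close> is \<open>p\<close> followed by a local inverse of \<open>f\<close>. So \<open>h\<close> is open as well as
  closed, and its image is clopen.
\<close>

lemma lift_of_open_map_surjective:
  assumes Z: "compact_space Z" "topspace Z \<noteq> {}"
    and Y: "connected_space Y" "Hausdorff_space Y" "locally_injective Y f" "continuous_map Y X f"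
    and h: "continuous_map Z Y h" and p: "open_map Z X p"
    and over: "\<And>z. z \<in> topspace Z \<Longrightarrow> f (h z) = p z"
  shows "h ` topspace Z = topspace Y"
proof -
  have sub: "h ` topspace Z \<subseteq> topspace Y"
    using h by (auto simp: continuous_map_def)
  have "closedin Y (h ` topspace Z)"
    using continuous_imp_closed_map[OF h Z(1) Y(2)] unfolding closed_map_def by blast
  moreover have "openin Y (h ` topspace Z)"
  proof (subst openin_subopen, safe)
    fix z assume z: "z \<in> topspace Z"
    then obtain U where U: "openin Y U" "h z \<in> U" "inj_on f U"
      using Y(3) sub unfolding locally_injective_def by blast
    let ?W = "{w \<in> topspace Z. h w \<in> U}"
    let ?T = "U \<inter> {y \<in> topspace Y. f y \<in> p ` ?W}"
    have "openin Z ?W"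
      using h U(1) by (rule openin_continuous_map_preimage)
    then have "openin X (p ` ?W)"
      using p unfolding open_map_def by blast
    then have "openin Y ?T"
      using Y(4) U(1) by (intro openin_Int openin_continuous_map_preimage)
    moreover have "h z \<in> ?T"
      using z U(2) over sub by auto
    moreover have "?T \<subseteq> h ` topspace Z"
    proof
      fix y assume y: "y \<in> ?T"
      then obtain w where w: "w \<in> topspace Z" "h w \<in> U" "f y = p w"
        by blast
      then have "y = h w"
        using inj_onD[OF U(3), of y "h w"] over[OF w(1)] y by auto
      then show "y \<in> h ` topspace Z"
        using w by blast
    qed
    ultimately show "\<exists>T. openin Y T \<and> h z \<in> T \<and> T \<subseteq> h ` topspace Z"
      by blast
  qed
  ultimately show ?thesis
    using Y(1) Z(2) unfolding connected_space_clopen_in by blast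
qed

section \<open>Normal covers\<close>

text \<open>
  For connected \<open>Z\<close> and Hausdorff \<open>X\<close> these are the regular coverings with compact metrizable total
  space, stated in terms of \<open>f\<close> alone because the group is determined by it. Disconnected \<open>Z\<close> are
  admitted so that fibre products remain in the class.
\<close>

definition normal_cover :: "'b topology \<Rightarrow> 'a topology \<Rightarrow> ('b \<Rightarrow> 'a) \<Rightarrow> bool" where
  "normal_cover Z X f \<longleftrightarrow>
     compact_space Z \<and> metrizable_space Z \<and>
     continuous_map Z X f \<and> f ` topspace Z = topspace X \<and> locally_injective Z f \<and>
     (\<forall>z\<in>topspace Z. \<forall>z'\<in>topspace Z. f z = f z' \<longrightarrow>
        (\<exists>h. homeomorphic_map Z Z h \<and> (\<forall>u\<in>topspace Z. f (h u) = f u) \<and> h z = z'))"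

lemma normal_coverD:
  assumes "normal_cover Z X f"
  shows "compact_space Z" "metrizable_space Z" "Hausdorff_space Z" "continuous_map Z X f"
    "f ` topspace Z = topspace X" "locally_injective Z f"
  using assms metrizable_imp_Hausdorff_space unfolding normal_cover_def by blast+

lemma normal_cover_translation:
  assumes "normal_cover Z X f" "z \<in> topspace Z" "z' \<in> topspace Z" "f z = f z'"
  obtains h where "homeomorphic_map Z Z h" "\<And>u. u \<in> topspace Z \<Longrightarrow> f (h u) = f u" "h z = z'"
  using assms unfolding normal_cover_def by blast

lemma homeomorphic_map_in_topspace:
  assumes "homeomorphic_map Z Y h" "z \<in> topspace Z"
  shows "h z \<in> topspace Y"
  using homeomorphic_imp_surjective_map[OF assms(1)] assms(2) by blast

text \<open>
  The assumption \<open>isolated\<close> makes the quotient Hausdorff. Then the quotient map is closed, and the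
  classes that lie inside one of the neighbourhoods in \<open>loc\<close> form an open set on which the map to
  \<open>X\<close> is injective. The homeomorphisms in \<open>trans\<close> respect the classes, so they descend.
\<close>

lemma normal_cover_quotient:
  assumes W: "compact_space W" "metrizable_space W"
    and p: "continuous_map W X p" "p ` topspace W = topspace X" and X: "Hausdorff_space X"
    and factors: "\<And>x y. \<lbrakk>x \<in> topspace W; y \<in> topspace W; q x = q y\<rbrakk> \<Longrightarrow> p x = p y"
    and isolated: "\<And>x y. \<lbrakk>x \<in> topspace W; y \<in> topspace W; p x = p y; q x \<noteq> q y\<rbrakk> \<Longrightarrow>
      \<exists>U V. openin W U \<and> openin W V \<and> x \<in> U \<and> y \<in> V \<and> (\<forall>u\<in>U. \<forall>v\<in>V. q u \<noteq> q v)"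
    and loc: "\<And>w. w \<in> topspace W \<Longrightarrow> \<exists>U. openin W U \<and> {v \<in> topspace W. q v = q w} \<subseteq> U \<and>
      (\<forall>u\<in>U. \<forall>v\<in>U. p u = p v \<longrightarrow> q u = q v)"
    and trans: "\<And>w w'. \<lbrakk>w \<in> topspace W; w' \<in> topspace W; p w = p w'\<rbrakk> \<Longrightarrow>
      \<exists>h. homeomorphic_map W W h \<and> (\<forall>u\<in>topspace W. p (h u) = p u) \<and>
        (\<forall>u\<in>topspace W. \<forall>v\<in>topspace W. q (h u) = q (h v) \<longleftrightarrow> q u = q v) \<and> q (h w) = q w'"
  shows "\<exists>r. normal_cover (quotient_space W q) X r \<and> (\<forall>w\<in>topspace W. r (q w) = p w)"
proof -
  let ?S = "topspace W" and ?Z = "quotient_space W q"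
  have quo: "quotient_map W ?Z q"
    by (rule quotient_map_quotient_space)
  have qc: "continuous_map W ?Z q" and qs: "q ` ?S = topspace ?Z"
    using quotient_imp_continuous_map[OF quo] quotient_imp_surjective_map[OF quo] by auto
  have "closedin (prod_topology W W) {(x, y) \<in> ?S \<times> ?S. q x = q y}"
    using factors isolated by (rule closed_kernel_over[OF p(1) X])
  then have Z: "compact_space ?Z" "metrizable_space ?Z"
    using quotient_map_compact_metrizable[OF W quo] by blast+
  have ZHaus: "Hausdorff_space ?Z"
    using Z(2) by (rule metrizable_imp_Hausdorff_space)
  have descend: "\<exists>k. \<forall>u\<in>?S. k (q u) = g u" if g: "\<And>u v. \<lbrakk>u \<in> ?S; v \<in> ?S; q u = q v\<rbrakk> \<Longrightarrow> g u = g v" for g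
  proof (intro exI ballI)
    fix u assume u: "u \<in> ?S"
    have "(SOME v. v \<in> ?S \<and> q v = q u) \<in> ?S \<and> q (SOME v. v \<in> ?S \<and> q v = q u) = q u"
      by (rule someI[of "\<lambda>v. v \<in> ?S \<and> q v = q u" u]) (simp add: u)
    then show "(\<lambda>a. g (SOME v. v \<in> ?S \<and> q v = a)) (q u) = g u"
      using g u by blast
  qed
  have all: "P a" if "a \<in> topspace ?Z" "\<And>u. u \<in> ?S \<Longrightarrow> P (q u)" for P a
    using that qs by (metis imageE)
  obtain r where r: "\<forall>u\<in>?S. r (q u) = p u"
    using descend[of p] factors by blast
  have "continuous_map W X (r \<circ> q)"
    using p(1) by (rule continuous_map_eq) (simp add: r)
  then have rc: "continuous_map ?Z X r"
    using quo continuous_compose_quotient_map by blast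
  have rs: "r ` topspace ?Z = topspace X"
    using r by (simp add: qs[symmetric] p(2)[symmetric] image_image)
  have rloc: "locally_injective ?Z r"
    unfolding locally_injective_def
  proof
    fix z assume "z \<in> topspace ?Z"
    then have "z \<in> q ` ?S"
      using qs by simp
    then obtain w where w: "w \<in> ?S" "z = q w"
      by blast
    obtain B where B: "openin W B" "{v \<in> ?S. q v = q w} \<subseteq> B" "\<forall>u\<in>B. \<forall>v\<in>B. p u = p v \<longrightarrow> q u = q v"
      using loc[OF w(1)] by blast
    \<comment> \<open>the classes that lie in \<open>B\<close>\<close>
    let ?U = "topspace ?Z - q ` (?S - B)"
    have "closedin W (?S - B)"
      using B(1) by blast
    then have "closedin ?Z (q ` (?S - B))"
      using continuous_imp_closed_map[OF qc W(1) ZHaus] unfolding closed_map_def by blast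
    then have "openin ?Z ?U"
      by blast
    moreover have "z \<in> ?U"
    proof -
      have "z \<noteq> q v" if "v \<in> ?S - B" for v
        using B(2) that w(2) by auto
      moreover have "z \<in> topspace ?Z"
        using w qs by blast
      ultimately show ?thesis
        by blast
    qed
    moreover have "inj_on r ?U"
    proof (rule inj_onI)
      fix a a' assume a: "a \<in> ?U" "a' \<in> ?U" "r a = r a'"
      have "a \<in> q ` ?S" "a' \<in> q ` ?S"
        using a(1,2) qs by simp_all
      then obtain u v where uv: "u \<in> ?S" "a = q u" "v \<in> ?S" "a' = q v"
        by blast
      have "u \<in> B" "v \<in> B"
        using a(1,2) uv by blast+
      moreover have "p u = p v"
        using a(3) uv r by simp
      ultimately show "a = a'"
        using B(3) uv(2,4) by blast
    qed
    ultimately show "\<exists>U. openin ?Z U \<and> z \<in> U \<and> inj_on r U"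
      by blast
  qed
  have rtrans: "\<exists>k. homeomorphic_map ?Z ?Z k \<and> (\<forall>u\<in>topspace ?Z. r (k u) = r u) \<and> k z = z'"
    if z: "z \<in> topspace ?Z" "z' \<in> topspace ?Z" "r z = r z'" for z z'
  proof -
    have "z \<in> q ` ?S" "z' \<in> q ` ?S"
      using z qs by simp_all
    then obtain w w' where w: "w \<in> ?S" "z = q w" "w' \<in> ?S" "z' = q w'"
      by blast
    have "p w = p w'"
      using z(3) w r by simp
    then obtain h where h: "homeomorphic_map W W h" "\<forall>u\<in>?S. p (h u) = p u"
        "\<forall>u\<in>?S. \<forall>v\<in>?S. q (h u) = q (h v) \<longleftrightarrow> q u = q v" "q (h w) = q w'"
      using trans[OF w(1,3)] by blast
    obtain k where k: "\<forall>u\<in>?S. k (q u) = q (h u)"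
      using descend[of "\<lambda>u. q (h u)"] h(3) by blast
    have hS: "h u \<in> ?S" if "u \<in> ?S" for u
      using homeomorphic_map_in_topspace[OF h(1) that] .
    have "homeomorphic_map ?Z ?Z k"
    proof (rule continuous_imp_homeomorphic_map[OF _ Z(1) ZHaus])
      have "continuous_map W ?Z (k \<circ> q)"
        using continuous_map_compose[OF homeomorphic_imp_continuous_map[OF h(1)] qc]
        by (rule continuous_map_eq) (simp add: k)
      then show "continuous_map ?Z ?Z k"
        using quo continuous_compose_quotient_map by blast
      have "k ` q ` ?S = q ` h ` ?S"
        unfolding image_image using k by (intro image_cong) auto
      then show "k ` topspace ?Z = topspace ?Z"
        using qs homeomorphic_imp_surjective_map[OF h(1)] by simp
      show "inj_on k (topspace ?Z)"
        unfolding qs[symmetric] using k h(3) by (auto intro!: inj_onI)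
    qed
    moreover have "r (k a) = r a" if "a \<in> topspace ?Z" for a
      using that by (rule all) (use k r h(2) hS in simp)
    moreover have "k z = z'"
      using k w h(4) by simp
    ultimately show ?thesis
      by blast
  qed
  have "normal_cover ?Z X r"
    unfolding normal_cover_def by (intro conjI ballI impI Z rc rs rloc rtrans)
  then show ?thesis
    using r by blast
qed

text \<open>
  The saturation of an open set is the union of its images under the homeomorphisms over \<open>X\<close>.
\<close>

lemma normal_cover_open_map:
  assumes Z: "normal_cover Z X f" and X: "Hausdorff_space X"
  shows "open_map Z X f"
  unfolding open_map_def
proof (intro allI impI)
  fix U assume U: "openin Z U"
  have Usub: "U \<subseteq> topspace Z"
    using U by (rule openin_subset)
  have q: "quotient_map Z X f"
    using normal_coverD[OF Z] X by (simp add: continuous_imp_quotient_map)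
  let ?H = "{h. homeomorphic_map Z Z h \<and> (\<forall>u\<in>topspace Z. f (h u) = f u)}"
  have "{z \<in> topspace Z. f z \<in> f ` U} = (\<Union>h\<in>?H. h ` U)"
  proof (intro equalityI subsetI)
    fix z assume "z \<in> {z \<in> topspace Z. f z \<in> f ` U}"
    then obtain u where u: "z \<in> topspace Z" "u \<in> U" "f u = f z"
      by fastforce
    obtain h where "homeomorphic_map Z Z h" "\<And>u. u \<in> topspace Z \<Longrightarrow> f (h u) = f u" "h u = z"
      using normal_cover_translation[OF Z _ u(1,3)] u(2) Usub by blast
    then show "z \<in> (\<Union>h\<in>?H. h ` U)"
      using u(2) by blast
  next
    fix z assume "z \<in> (\<Union>h\<in>?H. h ` U)"
    then obtain h u where h: "homeomorphic_map Z Z h" "\<forall>u\<in>topspace Z. f (h u) = f u"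
        and u: "u \<in> U" "z = h u"
      by blast
    have "u \<in> topspace Z"
      using u Usub by blast
    then show "z \<in> {z \<in> topspace Z. f z \<in> f ` U}"
      using h u homeomorphic_map_in_topspace[OF h(1)] by auto
  qed
  moreover have "openin Z (h ` U)" if "h \<in> ?H" for h
    using that U homeomorphic_imp_open_map unfolding open_map_def by blast
  ultimately have "openin Z {z \<in> topspace Z. f z \<in> f ` U}"
    by auto
  moreover have "f ` U \<subseteq> topspace X"
    using Usub normal_coverD(5)[OF Z] by blast
  ultimately show "openin X (f ` U)"
    using q unfolding quotient_map_def by blast
qed

text \<open>
  An open set on which \<open>f\<close> is injective contains at most one point of a fibre, and fibres are compact.
\<close>

lemma locally_injective_finite_fibre:
  assumes Z: "compact_space Z" "locally_injective Z f" and f: "continuous_map Z X f"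
    and X: "Hausdorff_space X"
  shows "finite {z \<in> topspace Z. f z = x}"
proof (cases "x \<in> topspace X")
  case True
  let ?F = "{z \<in> topspace Z. f z = x}"
  have "closedin Z {z \<in> topspace Z. f z \<in> {x}}"
    using f closedin_Hausdorff_singleton[OF X True] by (rule closedin_continuous_map_preimage)
  then have cF: "compactin Z ?F"
    using Z(1) closedin_compact_space by fastforce
  obtain U where U: "\<And>z. z \<in> topspace Z \<Longrightarrow> openin Z (U z) \<and> z \<in> U z \<and> inj_on f (U z)"
    using Z(2) unfolding locally_injective_def by metis
  have "openin Z V" if "V \<in> U ` ?F" for V
    using U that by blast
  moreover have "?F \<subseteq> \<Union> (U ` ?F)"
    using U by blast
  ultimately have "\<exists>\<F>. finite \<F> \<and> \<F> \<subseteq> U ` ?F \<and> ?F \<subseteq> \<Union>\<F>"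
    by (rule compactinD[OF cF])
  then obtain \<F> where "finite \<F>" "\<F> \<subseteq> U ` ?F" "?F \<subseteq> \<Union>\<F>"
    by blast
  then obtain D where D: "finite D" "D \<subseteq> ?F" "?F \<subseteq> \<Union> (U ` D)"
    using finite_subset_image[of \<F> U ?F] by blast
  have "z \<in> D" if z: "z \<in> ?F" for z
  proof -
    obtain w where w: "w \<in> D" "z \<in> U w"
      using D z by blast
    then have "w \<in> topspace Z" "f w = f z"
      using D z by auto
    then show ?thesis
      using U[of w] w by (auto dest: inj_onD)
  qed
  then show ?thesis
    using D(1) finite_subset[of ?F D] by blast
next
  case False
  then have "{z \<in> topspace Z. f z = x} = {}"
    using continuous_map_image_subset_topspace[OF f] by blast
  then show ?thesis
    by (simp only: finite.emptyI)
qed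

subsection \<open>Regular covering maps and deck groups\<close>

lemma regular_covering_imp_normal_cover:
  assumes f: "regular_covering_map Y G f X" and Y: "continuum Y"
  shows "normal_cover Y X f"
proof -
  have cov: "covering_map Y X f"
    and hom: "\<And>g. g \<in> G \<Longrightarrow> homeomorphic_map Y Y g"
    and orb: "orbit_map (topspace Y) G f (topspace X)"
    and G: "subgroup G (BijGroup (topspace Y))"
    using f unfolding regular_covering_map_def by blast+
  have "locally_injective Y f"
    unfolding locally_injective_def
  proof
    fix y assume y: "y \<in> topspace Y"
    then have "f y \<in> topspace X"
      using cov unfolding covering_map_def by blast
    from cov[unfolded covering_map_def, THEN conjunct2, THEN conjunct2, rule_format, OF this]
    obtain U \<V> where U: "f y \<in> U" and V: "\<Union>\<V> = {y \<in> topspace Y. f y \<in> U}"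
        "\<forall>V\<in>\<V>. openin Y V"
        "\<forall>V\<in>\<V>. homeomorphic_map (subtopology Y V) (subtopology X U) f"
      by (elim exE conjE) (rule that, simp_all)
    then obtain V where "V \<in> \<V>" "y \<in> V"
      using y by blast
    moreover have "inj_on f V"
      using bspec[OF V(3) \<open>V \<in> \<V>\<close>] openin_subset[OF bspec[OF V(2) \<open>V \<in> \<V>\<close>]]
      by (metis homeomorphic_imp_injective_map topspace_subtopology_subset)
    ultimately show "\<exists>U. openin Y U \<and> y \<in> U \<and> inj_on f U"
      using V(2) by blast
  qed
  moreover have "\<exists>h. homeomorphic_map Y Y h \<and> (\<forall>u\<in>topspace Y. f (h u) = f u) \<and> h z = z'"
    if z: "z \<in> topspace Y" "z' \<in> topspace Y" "f z = f z'" for z z'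
  proof -
    obtain g where g: "g \<in> G" "g z = z'"
      using orb z unfolding orbit_map_def by blast
    have "f (g u) = f u" if "u \<in> topspace Y" for u
      using orb that g(1) homeomorphic_map_in_topspace[OF hom[OF g(1)]]
      unfolding orbit_map_def by metis
    then show ?thesis
      using g hom by blast
  qed
  ultimately show ?thesis
    using Y cov unfolding normal_cover_def continuum_def covering_map_def by blast
qed

definition deck_group :: "'b topology \<Rightarrow> ('b \<Rightarrow> 'a) \<Rightarrow> ('b \<Rightarrow> 'b) set" where
  "deck_group Z f =
     {h \<in> Bij (topspace Z). homeomorphic_map Z Z h \<and> (\<forall>u\<in>topspace Z. f (h u) = f u)}"

lemma subgroup_deck_group: "subgroup (deck_group Z f) (BijGroup (topspace Z))"
proof
  show "deck_group Z f \<subseteq> carrier (BijGroup (topspace Z))"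
    by (auto simp: deck_group_def BijGroup_def)
  have "homeomorphic_map Z Z (\<lambda>x\<in>topspace Z. x)"
    by (rule homeomorphic_map_eq[of _ _ id]) (auto simp: homeomorphic_map_id)
  then show "\<one>\<^bsub>BijGroup (topspace Z)\<^esub> \<in> deck_group Z f"
    by (auto simp: deck_group_def BijGroup_def id_Bij)
next
  fix h k assume hk: "h \<in> deck_group Z f" "k \<in> deck_group Z f"
  then have "homeomorphic_map Z Z (h \<circ> k)"
    unfolding deck_group_def by (blast intro: homeomorphic_map_compose)
  then have "homeomorphic_map Z Z (compose (topspace Z) h k)"
    by (rule homeomorphic_map_eq) (simp add: compose_def)
  then show "h \<otimes>\<^bsub>BijGroup (topspace Z)\<^esub> k \<in> deck_group Z f"
    using hk homeomorphic_map_in_topspace[of Z Z k]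
    by (auto simp: deck_group_def BijGroup_def compose_Bij compose_eq)
next
  fix h assume h: "h \<in> deck_group Z f"
  then have hB: "h \<in> Bij (topspace Z)" and hh: "homeomorphic_map Z Z h"
    and hf: "\<And>u. u \<in> topspace Z \<Longrightarrow> f (h u) = f u"
    by (auto simp: deck_group_def)
  obtain k where k: "homeomorphic_maps Z Z h k"
    using hh homeomorphic_map_maps by blast
  have bij: "bij_betw h (topspace Z) (topspace Z)"
    using hB by (simp add: Bij_def)
  have kinv: "k u = (\<lambda>x\<in>topspace Z. inv_into (topspace Z) h x) u" if "u \<in> topspace Z" for u
  proof -
    have "k u \<in> topspace Z" "h (k u) = u"
      using k that unfolding homeomorphic_maps_def
      by (auto dest: continuous_map_image_subset_topspace)
    then show ?thesis
      using bij that by (metis bij_betw_inv_into_left restrict_apply')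
  qed
  have "homeomorphic_map Z Z k"
    using k homeomorphic_maps_map by blast
  then have "homeomorphic_map Z Z (\<lambda>x\<in>topspace Z. inv_into (topspace Z) h x)"
    using kinv by (rule homeomorphic_map_eq)
  moreover have "f (inv_into (topspace Z) h u) = f u" if "u \<in> topspace Z" for u
    using hf[of "inv_into (topspace Z) h u"] bij that
    by (metis bij_betw_def f_inv_into_f inv_into_into)
  ultimately show "inv\<^bsub>BijGroup (topspace Z)\<^esub> h \<in> deck_group Z f"
    using hB by (auto simp: deck_group_def inv_BijGroup restrict_inv_into_Bij)
qed

lemma homeomorphic_map_imp_deck:
  assumes "homeomorphic_map Z Z h" "\<And>u. u \<in> topspace Z \<Longrightarrow> f (h u) = f u"
  shows "restrict h (topspace Z) \<in> deck_group Z f"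
proof -
  have "bij_betw h (topspace Z) (topspace Z)"
    using assms(1) by (simp add: homeomorphic_eq_everything_map bij_betw_def)
  then have "restrict h (topspace Z) \<in> Bij (topspace Z)"
    by (auto simp: Bij_def bij_betw_restrict_eq)
  moreover have "homeomorphic_map Z Z (restrict h (topspace Z))"
    using assms(1) by (rule homeomorphic_map_eq) simp
  ultimately show ?thesis
    using assms(2) by (auto simp: deck_group_def)
qed

text \<open>
  A homeomorphism over \<open>X\<close> of a connected space is determined by its value at one point. So the
  translates of an open set on which \<open>f\<close> is injective are pairwise equal or disjoint, and they are the
  sheets of an evenly covered neighbourhood.
\<close>

lemma normal_cover_imp_regular_covering:
  assumes Z: "normal_cover Z X f" "connected_space Z" and X: "Hausdorff_space X"
  shows "regular_covering_map Z (deck_group Z f) f X"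
proof -
  let ?G = "deck_group Z f"
  note Z' = normal_coverD[OF Z(1)]
  have op: "open_map Z X f"
    using Z(1) X by (rule normal_cover_open_map)
  have hom: "homeomorphic_map Z Z g" and over: "\<And>u. u \<in> topspace Z \<Longrightarrow> f (g u) = f u"
    and ext: "g \<in> extensional (topspace Z)" if "g \<in> ?G" for g
    using that by (auto simp: deck_group_def Bij_def)
  have agree: "g u = g' u" if g: "g \<in> ?G" "g' \<in> ?G" and z: "z \<in> topspace Z" "g z = g' z"
    and u: "u \<in> topspace Z" for g g' z u
  proof (rule lifts_unique[OF Z(2) Z'(3,6), of g g' z u])
    show "continuous_map Z Z g" "continuous_map Z Z g'"
      using hom g by (simp_all add: homeomorphic_imp_continuous_map)
    show "f (g v) = f (g' v)" if "v \<in> topspace Z" for v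
      using over[OF g(1) that] over[OF g(2) that] by simp
  qed (fact z u)+
  have trans: "\<exists>g\<in>?G. g z = z'" if z: "z \<in> topspace Z" "z' \<in> topspace Z" "f z = f z'" for z z'
  proof -
    obtain h where h: "homeomorphic_map Z Z h" "\<And>u. u \<in> topspace Z \<Longrightarrow> f (h u) = f u" "h z = z'"
      using normal_cover_translation[OF Z(1) z] by blast
    show ?thesis
      using homeomorphic_map_imp_deck[of Z h f, OF h(1)] h(2,3) z(1)
      by (intro bexI[of _ "restrict h (topspace Z)"]) auto
  qed
  have free: "g = \<one>\<^bsub>BijGroup (topspace Z)\<^esub>" if g: "g \<in> ?G" "z \<in> topspace Z" "g z = z" for g z
  proof -
    have one: "\<one>\<^bsub>BijGroup (topspace Z)\<^esub> \<in> ?G"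
      using subgroup_deck_group by (rule subgroup.one_closed)
    then have "g u = \<one>\<^bsub>BijGroup (topspace Z)\<^esub> u" if "u \<in> topspace Z" for u
      using agree[OF g(1) one g(2) _ that] g by (simp add: BijGroup_def)
    then show ?thesis
      using ext g(1) one by (auto intro: extensionalityI)
  qed
  have orb: "orbit_map (topspace Z) ?G f (topspace X)"
    unfolding orbit_map_def using Z'(5) trans over by metis
  have q: "quotient_map Z X f"
    using Z' X by (simp add: continuous_imp_quotient_map)
  have "covering_map Z X f"
    unfolding covering_map_def
  proof (intro conjI ballI)
    fix x assume "x \<in> topspace X"
    then have "x \<in> f ` topspace Z"
      using Z'(5) by simp
    then obtain z where z: "z \<in> topspace Z" "f z = x"
      by (elim imageE) simp
    then obtain U where U: "openin Z U" "z \<in> U" "inj_on f U"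
      using Z'(6) unfolding locally_injective_def by blast
    have Usub: "U \<subseteq> topspace Z"
      using U(1) by (rule openin_subset)
    let ?\<V> = "(\<lambda>g. g ` U) ` ?G"
    have opg: "openin Z (g ` U)" if "g \<in> ?G" for g
      using hom[OF that] U(1) homeomorphic_imp_open_map unfolding open_map_def by blast
    have fg: "f ` g ` U = f ` U" if "g \<in> ?G" for g
      using over[OF that] Usub by (auto simp: image_image subset_iff)
    have "\<Union>?\<V> = {y \<in> topspace Z. f y \<in> f ` U}"
    proof (intro equalityI subsetI)
      fix y assume "y \<in> \<Union>?\<V>"
      then obtain g u where "g \<in> ?G" "u \<in> U" "y = g u"
        by blast
      then show "y \<in> {y \<in> topspace Z. f y \<in> f ` U}"
        using over[of g u] homeomorphic_map_in_topspace[OF hom, of g u] Usub by auto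
    next
      fix y assume "y \<in> {y \<in> topspace Z. f y \<in> f ` U}"
      then obtain u where "y \<in> topspace Z" "u \<in> U" "f u = f y"
        by fastforce
      then show "y \<in> \<Union>?\<V>"
        using trans[of u y] Usub by blast
    qed
    moreover have "pairwise disjnt ?\<V>"
    proof (rule pairwiseI)
      fix V W assume VW: "V \<in> ?\<V>" "W \<in> ?\<V>" "V \<noteq> W"
      then obtain g k where gk: "g \<in> ?G" "k \<in> ?G" "V = g ` U" "W = k ` U"
        by blast
      show "disjnt V W"
      proof (rule ccontr)
        assume "\<not> disjnt V W"
        then obtain u w where uw: "u \<in> U" "w \<in> U" "g u = k w"
          using gk by (auto simp: disjnt_def)
        then have "f u = f w"
          using over[OF gk(1), of u] over[OF gk(2), of w] subsetD[OF Usub] by auto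
        then have "u = w"
          using U(3) uw by (auto dest: inj_onD)
        then have "g v = k v" if "v \<in> U" for v
          using agree[OF gk(1,2), of u v] uw that Usub by auto
        then show False
          using VW(3) gk by auto
      qed
    qed
    moreover have "homeomorphic_map (subtopology Z V) (subtopology X (f ` U)) f" if V: "V \<in> ?\<V>" for V
    proof -
      obtain g where g: "g \<in> ?G" "V = g ` U"
        using V by blast
      have Vop: "openin Z V" and fV: "f ` V = f ` U"
        using opg[OF g(1)] fg[OF g(1)] g(2) by simp_all
      have Vsub: "V \<subseteq> topspace Z"
        using Vop by (rule openin_subset)
      have "inj_on f V"
      proof (rule inj_onI)
        fix v w assume "v \<in> V" "w \<in> V" "f v = f w"
        then obtain a c where "v = g a" "w = g c" "a \<in> U" "c \<in> U"
          using g(2) by blast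
        then show "v = w"
          using \<open>f v = f w\<close> over[OF g(1)] U(3) Usub by (metis inj_onD subsetD)
      qed
      moreover have "continuous_map (subtopology Z V) (subtopology X (f ` U)) f"
        using Z'(4) fV Vsub by (auto simp: continuous_map_in_subtopology continuous_map_from_subtopology)
      moreover have "open_map (subtopology Z V) (subtopology X (f ` U)) f"
        using op Vop fV Vsub
        by (intro open_map_into_subtopology open_map_from_subtopology) auto
      moreover have "f ` topspace (subtopology Z V) = topspace (subtopology X (f ` U))"
        using fV Vsub image_mono[OF Usub, of f] unfolding Z'(5) by (simp add: Int_absorb1)
      moreover have "inj_on f (topspace (subtopology Z V))"
        using \<open>inj_on f V\<close> Vsub by (simp add: Int_absorb1)
      ultimately show ?thesis
        by (intro bijective_open_imp_homeomorphic_map)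
    qed
    moreover have "openin X (f ` U)" "x \<in> f ` U"
      using op U z unfolding open_map_def by auto
    ultimately show "\<exists>U. openin X U \<and> x \<in> U \<and> (\<exists>\<V>. \<Union>\<V> = {y \<in> topspace Z. f y \<in> U} \<and>
             (\<forall>V\<in>\<V>. openin Z V) \<and> pairwise disjnt \<V> \<and>
             (\<forall>V\<in>\<V>. homeomorphic_map (subtopology Z V) (subtopology X U) f))"
      using opg by (intro exI[of _ "f ` U"] conjI exI[of _ ?\<V>]) auto
  qed (use Z' in auto)
  then show ?thesis
    unfolding regular_covering_map_def
    using subgroup_deck_group hom free orb q by blast
qed

subsection \<open>Connected pieces of normal covers\<close>

lemma clopen_piece_surjective:
  assumes Z: "normal_cover Z X f" and X: "connected_space X" "Hausdorff_space X"
    and K: "openin Z K" "closedin Z K" "K \<noteq> {}"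
  shows "f ` K = topspace X"
proof -
  have "openin X (f ` K)"
    using normal_cover_open_map[OF Z X(2)] K(1) unfolding open_map_def by blast
  moreover have "closedin X (f ` K)"
    using continuous_imp_closed_map[OF normal_coverD(4,1)[OF Z] X(2)] K(2)
    unfolding closed_map_def by blast
  ultimately show ?thesis
    using X(1) K(3) unfolding connected_space_clopen_in by blast
qed

text \<open>
  A homeomorphism over \<open>X\<close> that takes a point of \<open>K\<close> into \<open>K\<close> maps \<open>K\<close> onto itself, so it restricts.
\<close>

lemma connected_clopen_piece_normal_cover:
  assumes Z: "normal_cover Z X f" and X: "connected_space X" "Hausdorff_space X"
    and K: "openin Z K" "closedin Z K" "K \<noteq> {}" "connectedin Z K"
  shows "normal_cover (subtopology Z K) X f"
proof -
  note Z' = normal_coverD[OF Z]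
  have Ksub: "K \<subseteq> topspace Z"
    using K(1) by (rule openin_subset)
  then have top: "topspace (subtopology Z K) = K"
    by (rule topspace_subtopology_subset)
  have "locally_injective (subtopology Z K) f"
    unfolding locally_injective_def top
  proof
    fix y assume "y \<in> K"
    then obtain U where U: "openin Z U" "y \<in> U" "inj_on f U"
      using Z'(6) Ksub unfolding locally_injective_def by blast
    have "openin (subtopology Z K) (K \<inter> U)"
      using U(1) by (rule openin_subtopology_Int2)
    then show "\<exists>U. openin (subtopology Z K) U \<and> y \<in> U \<and> inj_on f U"
      using U \<open>y \<in> K\<close> by (intro exI[of _ "K \<inter> U"]) (auto intro: inj_on_subset)
  qed
  moreover have "\<exists>h. homeomorphic_map (subtopology Z K) (subtopology Z K) h \<and>
      (\<forall>u\<in>K. f (h u) = f u) \<and> h z = z'" if z: "z \<in> K" "z' \<in> K" "f z = f z'" for z z'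
  proof -
    obtain h where h: "homeomorphic_map Z Z h" "\<And>u. u \<in> topspace Z \<Longrightarrow> f (h u) = f u" "h z = z'"
      using normal_cover_translation[OF Z, of z z'] z Ksub by blast
    have clopen: "openin Z (h ` K)" "closedin Z (h ` K)"
      using h(1) K homeomorphic_imp_open_map homeomorphic_imp_closed_map
      unfolding open_map_def closed_map_def by blast+
    have con: "connectedin Z (h ` K)"
      using K(4) h(1) connectedin_continuous_map_image homeomorphic_imp_continuous_map by blast
    \<comment> \<open>both \<open>K\<close> and its translate are connected and clopen, and they share the point \<open>z'\<close>\<close>
    have "K \<subseteq> h ` K"
      using connectedin_clopen_cases[OF K(4) clopen(2,1)] z h(3) by (auto simp: disjnt_def)
    moreover have "h ` K \<subseteq> K"
      using connectedin_clopen_cases[OF con K(2,1)] z h(3) by (auto simp: disjnt_def)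
    ultimately have "h ` K = K"
      by blast
    moreover have "inj_on h (topspace Z)"
      using h(1) homeomorphic_imp_injective_map by blast
    ultimately have "homeomorphic_map (subtopology Z K) (subtopology Z K) h"
      using h(1) Ksub by (intro homeomorphic_map_subtopologies) (auto simp: Int_absorb1)
    then show ?thesis
      using h Ksub by blast
  qed
  moreover have "compact_space (subtopology Z K)"
    using Z'(1) K(2) closedin_compact_space compact_space_subtopology by blast
  moreover have "metrizable_space (subtopology Z K)"
    using Z'(2) by (rule metrizable_space_subtopology)
  ultimately show ?thesis
    unfolding normal_cover_def top
    using Z'(4) clopen_piece_surjective[OF Z X K(1-3)] continuous_map_from_subtopology by blast
qed

text \<open>
  Every nonempty clopen set maps onto \<open>X\<close>, hence meets a fixed fibre, which is finite. A clopen set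
  that contains the given point and meets this fibre in as few points as possible is connected: of
  two clopen halves, the one with the given point would meet the fibre in fewer points.
\<close>

lemma normal_cover_connected_piece:
  assumes Z: "normal_cover Z X f" and X: "connected_space X" "Hausdorff_space X"
    and z: "z \<in> topspace Z"
  obtains K where "z \<in> K" "K \<subseteq> topspace Z" "continuum (subtopology Z K)" "normal_cover (subtopology Z K) X f"
proof -
  note Z' = normal_coverD[OF Z]
  define F where "F = {y \<in> topspace Z. f y = f z}"
  have "finite F"
    unfolding F_def using Z' X(2) by (intro locally_injective_finite_fibre)
  define P where "P K \<longleftrightarrow> openin Z K \<and> closedin Z K \<and> z \<in> K" for K
  have "P (topspace Z)"
    using z by (simp add: P_def)
  then obtain K where K: "P K" and min: "\<And>L. P L \<Longrightarrow> card (K \<inter> F) \<le> card (L \<inter> F)"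
    using ex_has_least_nat[of P "topspace Z" "\<lambda>K. card (K \<inter> F)"] by blast
  have meets: "L \<inter> F \<noteq> {}" if "openin Z L" "closedin Z L" "L \<noteq> {}" for L
  proof -
    have "f z \<in> f ` L"
      using clopen_piece_surjective[OF Z X that] Z'(5) z by blast
    then show ?thesis
      using openin_subset[OF that(1)] by (auto simp: F_def)
  qed
  have Ksub: "K \<subseteq> topspace Z"
    using K openin_subset by (auto simp: P_def)
  have "connected_space (subtopology Z K)"
    unfolding connected_space_clopen_in
  proof (intro allI impI, rule ccontr)
    fix T assume T: "openin (subtopology Z K) T \<and> closedin (subtopology Z K) T"
      and ne: "\<not> (T = {} \<or> T = topspace (subtopology Z K))"
    have TK: "T \<subseteq> K"
      using T openin_subset by fastforce
    have T1: "openin Z T" "closedin Z T"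
      using T K openin_open_subtopology[of Z K T] closedin_closed_subtopology[of Z K T]
      by (simp_all add: P_def)
    have T2: "openin Z (K - T)" "closedin Z (K - T)"
      using T1 K by (auto simp: P_def)
    have ne2: "T \<noteq> {}" "K - T \<noteq> {}"
      using ne TK Ksub by (auto simp: topspace_subtopology_subset)
    define L where "L = (if z \<in> T then T else K - T)"
    have L: "P L"
      using T1 T2 K by (auto simp: P_def L_def)
    have "(K - L) \<inter> F \<noteq> {}"
      using meets[OF T1 ne2(1)] meets[OF T2 ne2(2)] TK by (auto simp: L_def)
    moreover have "L \<subseteq> K"
      using TK by (auto simp: L_def)
    ultimately have "L \<inter> F \<subset> K \<inter> F"
      by blast
    then have "card (L \<inter> F) < card (K \<inter> F)"
      using \<open>finite F\<close> by (intro psubset_card_mono) auto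
    then show False
      using min[OF L] by simp
  qed
  then have con: "connectedin Z K"
    using Ksub by (simp add: connectedin_def)
  have nc: "normal_cover (subtopology Z K) X f"
    using connected_clopen_piece_normal_cover[OF Z X _ _ _ con] K by (auto simp: P_def)
  moreover have "continuum (subtopology Z K)"
    unfolding continuum_def
    using normal_coverD[OF nc] con K Ksub by (auto simp: P_def connectedin_def)
  ultimately show ?thesis
    using that K Ksub by (auto simp: P_def)
qed

section \<open>The uniformity of a continuum\<close>

lemma openin_square_cover:
  assumes "\<And>U. U \<in> \<C> \<Longrightarrow> openin X U"
  shows "openin (prod_topology X X) (\<Union>U\<in>\<C>. U \<times> U)"
  using assms by (intro openin_Union) (auto simp: openin_prod_Times_iff)

lemma openin_section:
  assumes "openin (prod_topology X Y) N" "x \<in> topspace X"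
  shows "openin Y {y \<in> topspace Y. (x, y) \<in> N}"
  using assms
  by (intro openin_continuous_map_preimage[where Y = "prod_topology X Y"])
     (auto intro!: continuous_map_pairedI)

text \<open>
  A metric as the uniformity sees it: the sets of pairs at distance less than \<open>e\<close> form a basis of the
  neighbourhoods of the diagonal.
\<close>

definition compatible_distance :: "'a topology \<Rightarrow> ('a \<Rightarrow> 'a \<Rightarrow> real) \<Rightarrow> bool" where
  "compatible_distance X d \<longleftrightarrow>
     (\<forall>x y. 0 \<le> d x y \<and> d x y = d y x) \<and>
     (\<forall>x\<in>topspace X. \<forall>y\<in>topspace X. \<forall>z\<in>topspace X. d x z \<le> d x y + d y z) \<and>
     (\<forall>x\<in>topspace X. d x x = 0) \<and>
     (\<forall>e. openin (prod_topology X X) {(x, y) \<in> topspace X \<times> topspace X. d x y < e}) \<and>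
     (\<forall>N. openin (prod_topology X X) N \<and> (\<forall>x\<in>topspace X. (x, x) \<in> N) \<longrightarrow>
        (\<exists>e>0. \<forall>x\<in>topspace X. \<forall>y\<in>topspace X. d x y < e \<longrightarrow> (x, y) \<in> N))"

lemma compatible_distanceD:
  assumes "compatible_distance X d"
  shows "0 \<le> d x y" "d x y = d y x"
    "x \<in> topspace X \<Longrightarrow> y \<in> topspace X \<Longrightarrow> z \<in> topspace X \<Longrightarrow> d x z \<le> d x y + d y z"
    "x \<in> topspace X \<Longrightarrow> d x x = 0"
    "openin (prod_topology X X) {(x, y) \<in> topspace X \<times> topspace X. d x y < e}"
    "openin (prod_topology X X) N \<Longrightarrow> \<forall>x\<in>topspace X. (x, x) \<in> N \<Longrightarrow>
       \<exists>e>0. \<forall>x\<in>topspace X. \<forall>y\<in>topspace X. d x y < e \<longrightarrow> (x, y) \<in> N"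
proof -
  note A = assms[unfolded compatible_distance_def]
  show "0 \<le> d x y" "d x y = d y x"
    using A[THEN conjunct1] by blast+
  show "x \<in> topspace X \<Longrightarrow> y \<in> topspace X \<Longrightarrow> z \<in> topspace X \<Longrightarrow> d x z \<le> d x y + d y z"
    using A[THEN conjunct2, THEN conjunct1] by blast
  show "x \<in> topspace X \<Longrightarrow> d x x = 0"
    using A[THEN conjunct2, THEN conjunct2, THEN conjunct1] by blast
  show "openin (prod_topology X X) {(x, y) \<in> topspace X \<times> topspace X. d x y < e}"
    using A[THEN conjunct2, THEN conjunct2, THEN conjunct2, THEN conjunct1] by (rule spec)
  show "openin (prod_topology X X) N \<Longrightarrow> \<forall>x\<in>topspace X. (x, x) \<in> N \<Longrightarrow>
       \<exists>e>0. \<forall>x\<in>topspace X. \<forall>y\<in>topspace X. d x y < e \<longrightarrow> (x, y) \<in> N"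
    using A[THEN conjunct2, THEN conjunct2, THEN conjunct2, THEN conjunct2, THEN spec, of N] by (rule mp) (rule conjI)
qed

lemma openin_distance_ball:
  assumes "compatible_distance Y d" "y \<in> topspace Y"
  shows "openin Y {z \<in> topspace Y. d y z < e}"
proof -
  have "{z \<in> topspace Y. d y z < e} =
      {z \<in> topspace Y. (y, z) \<in> {(x, z) \<in> topspace Y \<times> topspace Y. d x z < e}}"
    using assms(2) by auto
  then show ?thesis
    using openin_section[OF compatible_distanceD(5)[OF assms(1), of e] assms(2)] by (simp only:)
qed

text \<open>
  Each metric of the topology will do; a neighbourhood of the diagonal contains all sufficiently close
  pairs by the existence of Lebesgue numbers.
\<close>

lemma compact_metrizable_distance:
  assumes "compact_space X" "metrizable_space X"
  shows "\<exists>d. compatible_distance X d"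
proof -
  obtain M d where M: "Metric_space M d" and X: "X = Metric_space.mtopology M d"
    using assms(2) unfolding metrizable_space_def by blast
  interpret Metric_space M d by (rule M)
  have top: "topspace X = M"
    by (simp add: X)
  have "openin (prod_topology X X) {(x, y) \<in> M \<times> M. d x y < e}" for e
    unfolding openin_prod_topology_alt
  proof (intro allI impI)
    fix x y assume "(x, y) \<in> {(x, y) \<in> M \<times> M. d x y < e}"
    then have xy: "x \<in> M" "y \<in> M" "d x y < e"
      by auto
    define r where "r = (e - d x y) / 2"
    have r: "r > 0"
      using xy by (simp add: r_def)
    have "d a c < e" if "a \<in> M" "c \<in> M" "d x a < r" "d y c < r" for a c
    proof -
      have "d a c \<le> d a x + d x c" "d x c \<le> d x y + d y c"
        using that xy by (auto intro: triangle)
      then show ?thesis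
        using that by (simp add: r_def commute field_simps)
    qed
    then show "\<exists>U V. openin X U \<and> openin X V \<and> x \<in> U \<and> y \<in> V \<and>
        U \<times> V \<subseteq> {(x, y) \<in> M \<times> M. d x y < e}"
      using xy r X by (intro exI[of _ "mball x r"] exI[of _ "mball y r"]) (auto simp: in_mball)
  qed
  moreover have "\<exists>e>0. \<forall>x\<in>M. \<forall>y\<in>M. d x y < e \<longrightarrow> (x, y) \<in> N"
    if N: "openin (prod_topology X X) N" "\<And>x. x \<in> M \<Longrightarrow> (x, x) \<in> N" for N
  proof -
    let ?\<C> = "{U. openin X U \<and> U \<times> U \<subseteq> N}"
    have "x \<in> \<Union>?\<C>" if xM: "x \<in> M" for x
    proof -
      obtain U V where UV: "openin X U" "openin X V" "x \<in> U" "x \<in> V" "U \<times> V \<subseteq> N"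
        using N(1)[unfolded openin_prod_topology_alt, rule_format, OF N(2)[OF xM]] by metis
      have "openin X (U \<inter> V)"
        using UV(1,2) by (rule openin_Int)
      moreover have "(U \<inter> V) \<times> (U \<inter> V) \<subseteq> N"
        using UV(5) by blast
      ultimately show ?thesis
        using UV(3,4) by blast
    qed
    then have "M \<subseteq> \<Union>?\<C>"
      by blast
    moreover have "compactin mtopology M"
      using assms(1) by (simp add: X compact_space_def)
    ultimately obtain e where e: "e > 0" "\<forall>x\<in>M. \<exists>U\<in>?\<C>. mball x e \<subseteq> U"
      using lebesgue_number[of M ?\<C>] X by blast
    have "(x, y) \<in> N" if xy: "x \<in> M" "y \<in> M" "d x y < e" for x y
    proof -
      obtain U where U: "U \<times> U \<subseteq> N" "mball x e \<subseteq> U"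
        using e(2) xy(1) by blast
      have "x \<in> mball x e" "y \<in> mball x e"
        using xy e(1) by auto
      then show ?thesis
        using U by blast
    qed
    then show ?thesis
      using e(1) by blast
  qed
  ultimately have "compatible_distance X d"
    unfolding compatible_distance_def top by (simp add: triangle commute)
  then show ?thesis
    by blast
qed

definition diagonal_neighbourhoods :: "'a topology \<Rightarrow> ('a \<times> 'a) set set" where
  "diagonal_neighbourhoods X =
     {E. E \<subseteq> topspace X \<times> topspace X \<and> sym E \<and>
         (\<exists>N. openin (prod_topology X X) N \<and> (\<forall>x\<in>topspace X. (x, x) \<in> N) \<and> N \<subseteq> E)}"

text \<open>
  This entourage has the given set \<open>U\<close> as its section at \<open>x\<close>, so the neighbourhoods of the diagonal
  induce the topology.
\<close>

lemma diagonal_neighbourhood_isolating: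
  assumes X: "Hausdorff_space X" and U: "openin X U" "x \<in> U"
  shows "U \<times> U \<union> (topspace X - {x}) \<times> (topspace X - {x}) \<in> diagonal_neighbourhoods X" (is "?E \<in> _")
proof -
  have Usub: "U \<subseteq> topspace X"
    using U(1) by (rule openin_subset)
  have "openin X (topspace X - {x})"
    using closedin_Hausdorff_singleton[OF X] U Usub by blast
  then have "openin (prod_topology X X) ?E"
    using U(1) by (intro openin_Un) (simp_all add: openin_prod_Times_iff)
  moreover have "(y, y) \<in> ?E" if "y \<in> topspace X" for y
    using that U(2) by auto
  moreover have "sym ?E" "?E \<subseteq> topspace X \<times> topspace X"
    using Usub by (auto simp: sym_def)
  ultimately show ?thesis
    unfolding diagonal_neighbourhoods_def by blast
qed

lemma compatible_diagonal_neighbourhoods: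
  assumes X: "compact_space X" "metrizable_space X"
  shows "compatible_uniformity X (diagonal_neighbourhoods X)"
  unfolding compatible_uniformity_def uniformity_on_def
proof (intro conjI ballI allI)
  let ?D = "diagonal_neighbourhoods X" and ?S = "topspace X"
  have "?S \<times> ?S \<in> ?D"
    by (auto simp: diagonal_neighbourhoods_def sym_def openin_prod_Times_iff
        intro!: exI[of _ "?S \<times> ?S"])
  then show "?D \<noteq> {}"
    by blast
  show "Id_on ?S \<subseteq> E" "E \<subseteq> ?S \<times> ?S" "sym E" if "E \<in> ?D" for E
    using that by (auto simp: diagonal_neighbourhoods_def)
  show "E \<subseteq> F \<and> F \<subseteq> ?S \<times> ?S \<and> sym F \<longrightarrow> F \<in> ?D" if E: "E \<in> ?D" for E F
  proof (intro impI)
    assume F: "E \<subseteq> F \<and> F \<subseteq> ?S \<times> ?S \<and> sym F"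
    obtain N where "openin (prod_topology X X) N" "\<forall>x\<in>?S. (x, x) \<in> N" "N \<subseteq> E"
      using E unfolding diagonal_neighbourhoods_def by blast
    then show "F \<in> ?D"
      using F unfolding diagonal_neighbourhoods_def by (intro CollectI conjI exI[of _ N]) auto
  qed
  show "E \<inter> F \<in> ?D" if EF: "E \<in> ?D" "F \<in> ?D" for E F
  proof -
    obtain M N where "openin (prod_topology X X) M" "\<forall>x\<in>?S. (x, x) \<in> M" "M \<subseteq> E"
       "openin (prod_topology X X) N" "\<forall>x\<in>?S. (x, x) \<in> N" "N \<subseteq> F"
      using EF unfolding diagonal_neighbourhoods_def by blast
    then have "openin (prod_topology X X) (M \<inter> N)" "\<forall>x\<in>?S. (x, x) \<in> M \<inter> N" "M \<inter> N \<subseteq> E \<inter> F"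
      by (auto intro: openin_Int)
    moreover have "sym (E \<inter> F)" "E \<inter> F \<subseteq> ?S \<times> ?S"
      using EF by (auto simp: diagonal_neighbourhoods_def sym_Int)
    ultimately show ?thesis
      unfolding diagonal_neighbourhoods_def by blast
  qed
  show "\<exists>F\<in>?D. F O F \<subseteq> E" if E: "E \<in> ?D" for E
  proof -
    obtain N where N: "openin (prod_topology X X) N" "\<forall>x\<in>?S. (x, x) \<in> N" "N \<subseteq> E"
      using E unfolding diagonal_neighbourhoods_def by blast
    obtain d where "compatible_distance X d"
      using compact_metrizable_distance[OF X] by blast
    note d = compatible_distanceD[OF this]
    obtain e where e: "e > 0" "\<forall>x\<in>?S. \<forall>y\<in>?S. d x y < e \<longrightarrow> (x, y) \<in> N"
      using d(6)[OF N(1,2)] by blast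
    let ?F = "{(x, y) \<in> ?S \<times> ?S. d x y < e / 2}"
    have "\<forall>x\<in>?S. (x, x) \<in> ?F" "sym ?F" "?F \<subseteq> ?S \<times> ?S"
      using d(2,4) e(1) by (auto simp: sym_def)
    then have "?F \<in> ?D"
      unfolding diagonal_neighbourhoods_def using d(5) by blast
    moreover have "?F O ?F \<subseteq> E"
    proof
      fix p assume "p \<in> ?F O ?F"
      then obtain x y z where p: "p = (x, z)" "x \<in> ?S" "y \<in> ?S" "z \<in> ?S" "d x y < e / 2" "d y z < e / 2"
        by auto
      then have "d x z < e"
        using d(3)[of x y z] by simp
      then show "p \<in> E"
        using p e(2) N(3) by blast
    qed
    ultimately show ?thesis
      by blast
  qed
  show "openin X U \<longleftrightarrow> U \<subseteq> ?S \<and> (\<forall>x\<in>U. \<exists>E\<in>?D. E `` {x} \<subseteq> U)" for U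
  proof (intro iffI conjI ballI)
    assume U: "openin X U"
    then show "U \<subseteq> ?S"
      by (rule openin_subset)
    fix x assume x: "x \<in> U"
    let ?E = "U \<times> U \<union> (?S - {x}) \<times> (?S - {x})"
    have "?E \<in> ?D" "?E `` {x} \<subseteq> U"
      using diagonal_neighbourhood_isolating[OF metrizable_imp_Hausdorff_space[OF X(2)] U x] by auto
    then show "\<exists>E\<in>?D. E `` {x} \<subseteq> U"
      by blast
  next
    assume U: "U \<subseteq> ?S \<and> (\<forall>x\<in>U. \<exists>E\<in>?D. E `` {x} \<subseteq> U)"
    show "openin X U"
    proof (subst openin_subopen, intro ballI)
      fix x assume x: "x \<in> U"
      then obtain E N where "E `` {x} \<subseteq> U" "openin (prod_topology X X) N" "\<forall>x\<in>?S. (x, x) \<in> N" "N \<subseteq> E"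
        using U unfolding diagonal_neighbourhoods_def by blast
      then show "\<exists>T. openin X T \<and> x \<in> T \<and> T \<subseteq> U"
        using openin_section[of X X N x] x U by (intro exI[of _ "{y \<in> ?S. (x, y) \<in> N}"]) auto
    qed
  qed
qed

lemma uniformityD:
  assumes "uniformity_on S \<U>" "E \<in> \<U>"
  shows "x \<in> S \<Longrightarrow> (x, x) \<in> E" "E \<subseteq> S \<times> S" "(x, y) \<in> E \<Longrightarrow> (y, x) \<in> E"
    "E \<subseteq> F \<Longrightarrow> F \<subseteq> S \<times> S \<Longrightarrow> sym F \<Longrightarrow> F \<in> \<U>" "F \<in> \<U> \<Longrightarrow> E \<inter> F \<in> \<U>"
    "\<exists>F\<in>\<U>. F O F \<subseteq> E"
proof -
  have u: "\<forall>E\<in>\<U>. Id_on S \<subseteq> E \<and> E \<subseteq> S \<times> S \<and> sym E"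
    "\<forall>E\<in>\<U>. \<forall>F. E \<subseteq> F \<and> F \<subseteq> S \<times> S \<and> sym F \<longrightarrow> F \<in> \<U>"
    "\<forall>E\<in>\<U>. \<forall>F\<in>\<U>. E \<inter> F \<in> \<U>" "\<forall>E\<in>\<U>. \<exists>F\<in>\<U>. F O F \<subseteq> E"
    using assms(1) unfolding uniformity_on_def by - (elim conjE, assumption)+
  note 0 = bspec[OF u(1) assms(2)]
  note 1 = conjunct1[OF 0] conjunct1[OF conjunct2[OF 0]] conjunct2[OF conjunct2[OF 0]]
    bspec[OF u(2) assms(2)] bspec[OF u(3) assms(2)] bspec[OF u(4) assms(2)]
  show "x \<in> S \<Longrightarrow> (x, x) \<in> E" "E \<subseteq> S \<times> S" "\<exists>F\<in>\<U>. F O F \<subseteq> E"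
    using 1(1,2,6) by (auto simp: subset_iff Id_on_iff)
  show "(x, y) \<in> E \<Longrightarrow> (y, x) \<in> E"
    using 1(3) by (rule symD)
  show "E \<subseteq> F \<Longrightarrow> F \<subseteq> S \<times> S \<Longrightarrow> sym F \<Longrightarrow> F \<in> \<U>" "F \<in> \<U> \<Longrightarrow> E \<inter> F \<in> \<U>"
    using 1(4,5) by simp_all
qed

text \<open>
  The points having some section inside the section of \<open>E\<close> at \<open>x\<close> form an open set.
\<close>

lemma entourage_interior:
  assumes "compatible_uniformity X \<U>" "E \<in> \<U>" "x \<in> topspace X"
  shows "x \<in> X interior_of (E `` {x})"
proof -
  have u: "uniformity_on (topspace X) \<U>"
    and op: "\<And>U. openin X U \<longleftrightarrow> U \<subseteq> topspace X \<and> (\<forall>x\<in>U. \<exists>E\<in>\<U>. E `` {x} \<subseteq> U)"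
    using assms(1) unfolding compatible_uniformity_def by blast+
  let ?W = "{y \<in> topspace X. \<exists>D\<in>\<U>. D `` {y} \<subseteq> E `` {x}}"
  have "\<exists>F\<in>\<U>. F `` {y} \<subseteq> ?W" if y: "y \<in> ?W" for y
  proof -
    obtain D where D: "D \<in> \<U>" "D `` {y} \<subseteq> E `` {x}"
      using y by blast
    obtain F where F: "F \<in> \<U>" "F O F \<subseteq> D"
      using uniformityD(6)[OF u D(1)] by blast
    have "F `` {z} \<subseteq> E `` {x}" "z \<in> topspace X" if "z \<in> F `` {y}" for z
      using F D that uniformityD(2)[OF u F(1)] by blast+
    then show ?thesis
      using F(1) by blast
  qed
  then have "openin X ?W"
    using op by blast
  moreover have "x \<in> ?W"
    using assms(2,3) by blast
  moreover have "?W \<subseteq> E `` {x}"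
    using uniformityD(1)[OF u] by blast
  ultimately show ?thesis
    unfolding interior_of_def by blast
qed

text \<open>
  If \<open>F O F \<subseteq> E\<close>, then \<open>E\<close> contains the squares of all interiors of sections of \<open>F\<close>, which cover the diagonal.
  Conversely, finitely many interiors of sections cover a compact space, and the intersection of the
  corresponding entourages is as small as a given neighbourhood of the diagonal.
\<close>

lemma compatible_uniformity_unique:
  assumes X: "compact_space X" "metrizable_space X" "topspace X \<noteq> {}"
    and comp: "compatible_uniformity X \<U>"
  shows "\<U> = diagonal_neighbourhoods X"
proof (intro equalityI subsetI)
  let ?S = "topspace X"
  have u: "uniformity_on ?S \<U>"
    and op: "\<And>U. openin X U \<longleftrightarrow> U \<subseteq> ?S \<and> (\<forall>x\<in>U. \<exists>E\<in>\<U>. E `` {x} \<subseteq> U)"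
    using comp unfolding compatible_uniformity_def by blast+
  note uD = uniformityD[OF u]
  {
    fix E assume E: "E \<in> \<U>"
    obtain F where F: "F \<in> \<U>" "F O F \<subseteq> E"
      using uD(6)[OF E] by blast
    define N where "N = (\<Union>U\<in>(\<lambda>z. X interior_of (F `` {z})) ` ?S. U \<times> U)"
    have "openin (prod_topology X X) N"
      unfolding N_def by (rule openin_square_cover) auto
    moreover have "(x, x) \<in> N" if "x \<in> ?S" for x
      using entourage_interior[OF comp F(1) that] that by (auto simp: N_def)
    moreover have "N \<subseteq> E"
    proof
      fix p assume "p \<in> N"
      then obtain x y z where "p = (x, y)" "x \<in> X interior_of (F `` {z})" "y \<in> X interior_of (F `` {z})"
        by (auto simp: N_def)
      then have "p = (x, y)" "(z, x) \<in> F" "(z, y) \<in> F"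
        using interior_of_subset[of X "F `` {z}"] by auto
      then show "p \<in> E"
        using F uD(3)[OF F(1)] by blast
    qed
    moreover have "sym E"
      using uD(3)[OF E] by (auto intro: symI)
    ultimately show "E \<in> diagonal_neighbourhoods X"
      using uD(2)[OF E] unfolding diagonal_neighbourhoods_def by blast
  }
  {
    fix E assume E: "E \<in> diagonal_neighbourhoods X"
    then obtain N where N: "openin (prod_topology X X) N" "\<forall>x\<in>?S. (x, x) \<in> N" "N \<subseteq> E"
        and E': "E \<subseteq> ?S \<times> ?S" "sym E"
      unfolding diagonal_neighbourhoods_def by blast
    have "\<exists>D. D \<in> \<U> \<and> (\<forall>y z. (x, y) \<in> D \<and> (y, z) \<in> D \<longrightarrow> (y, z) \<in> E)" if x: "x \<in> ?S" for x
    proof -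
      obtain U V where UV: "openin X U" "openin X V" "x \<in> U" "x \<in> V" "U \<times> V \<subseteq> N"
        using N(1,2) x unfolding openin_prod_topology_alt by metis
      have "openin X (U \<inter> V)" "x \<in> U \<inter> V"
        using UV by auto
      then obtain D where D: "D \<in> \<U>" "D `` {x} \<subseteq> U \<inter> V"
        using op by blast
      obtain D' where D': "D' \<in> \<U>" "D' O D' \<subseteq> D"
        using uD(6)[OF D(1)] by blast
      have "(y, z) \<in> E" if "(x, y) \<in> D'" "(y, z) \<in> D'" for y z
      proof -
        have "(x, y) \<in> D"
          using that(1) D'(2) uD(1)[OF D'(1)] uD(2)[OF D'(1)] by blast
        moreover have "(x, z) \<in> D"
          using that D'(2) by blast
        ultimately show ?thesis
          using D(2) UV(5) N(3) by blast
      qed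
      then show ?thesis
        using D'(1) by blast
    qed
    then obtain D where D: "\<And>x. x \<in> ?S \<Longrightarrow> D x \<in> \<U>"
        "\<And>x y z. \<lbrakk>x \<in> ?S; (x, y) \<in> D x; (y, z) \<in> D x\<rbrakk> \<Longrightarrow> (y, z) \<in> E"
      by metis
    let ?I = "\<lambda>x. X interior_of (D x `` {x})"
    have "?S \<subseteq> \<Union> (?I ` ?S)"
      using entourage_interior[OF comp D(1)] by blast
    then have "\<exists>\<F>. finite \<F> \<and> \<F> \<subseteq> ?I ` ?S \<and> ?S \<subseteq> \<Union>\<F>"
      using X(1) unfolding compact_space_def by (intro compactinD) auto
    then obtain \<F> where F: "finite \<F>" "\<F> \<subseteq> ?I ` ?S" "?S \<subseteq> \<Union>\<F>"
      by blast
    obtain T where T: "finite T" "T \<subseteq> ?S" "\<F> = ?I ` T"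
      using finite_subset_image[OF F(1,2)] by blast
    have "T \<noteq> {}"
      using T(3) F(3) X(3) by auto
    have "\<Inter> (D ` T) \<in> \<U>"
      using T(1) \<open>T \<noteq> {}\<close> T(2)
    proof (induction T rule: finite_ne_induct)
      case (singleton x)
      then show ?case using D(1) by simp
    next
      case (insert x T)
      then show ?case
        using uD(5)[OF D(1)[of x], of "\<Inter> (D ` T)"] by simp
    qed
    moreover have "\<Inter> (D ` T) \<subseteq> E"
    proof
      fix p assume p: "p \<in> \<Inter> (D ` T)"
      obtain y z where yz: "p = (y, z)"
        by (cases p)
      have "y \<in> ?S"
        using p yz \<open>T \<noteq> {}\<close> T(2) D(1) uD(2) by blast
      then obtain x where x: "x \<in> T" "y \<in> ?I x"
        using F(3) T(3) by blast
      then have "(x, y) \<in> D x"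
        using interior_of_subset[of X "D x `` {x}"] by blast
      then show "p \<in> E"
        using D(2)[of x y z] x(1) T(2) p yz by blast
    qed
    ultimately show "E \<in> \<U>"
      using uD(4) E' by blast
  }
qed

lemma compact_uniformity_eq:
  assumes "continuum X"
  shows "compact_uniformity X = diagonal_neighbourhoods X"
  unfolding compact_uniformity_def
  using assms compatible_diagonal_neighbourhoods compatible_uniformity_unique
  unfolding continuum_def by (intro the_equality) blast+

lemma compatible_compact_uniformity:
  assumes "continuum X"
  shows "compatible_uniformity X (compact_uniformity X)"
  using assms compatible_diagonal_neighbourhoods[of X]
  unfolding compact_uniformity_eq[OF assms] continuum_def by blast

lemma continuous_imp_uniformly_continuous:
  assumes X: "continuum X" and Y: "continuum Y" and h: "continuous_map X Y h"
  shows "uniformly_continuous_between (topspace X) (compact_uniformity X) (compact_uniformity Y) h"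
  unfolding uniformly_continuous_between_def
proof
  fix F assume "F \<in> compact_uniformity Y"
  then obtain N where N: "openin (prod_topology Y Y) N" "\<forall>y\<in>topspace Y. (y, y) \<in> N" "N \<subseteq> F"
      and F: "sym F"
    unfolding compact_uniformity_eq[OF Y] diagonal_neighbourhoods_def by blast
  let ?S = "topspace X"
  let ?E = "{(x, y) \<in> ?S \<times> ?S. (h x, h y) \<in> F}"
  let ?N = "{p \<in> topspace (prod_topology X X). (h (fst p), h (snd p)) \<in> N}"
  have "continuous_map (prod_topology X X) (prod_topology Y Y) (\<lambda>p. (h (fst p), h (snd p)))"
    using h by (intro continuous_map_pairedI)
      (auto intro: continuous_map_compose[unfolded o_def] continuous_map_fst continuous_map_snd)
  then have "openin (prod_topology X X) ?N"
    using N(1) by (rule openin_continuous_map_preimage)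
  moreover have "\<forall>x\<in>?S. (x, x) \<in> ?N"
    using N(2) continuous_map_image_subset_topspace[OF h] by auto
  moreover have "?N \<subseteq> ?E"
    using N(3) by auto
  moreover have "sym ?E"
    using F by (auto simp: sym_def)
  ultimately have "?E \<in> compact_uniformity X"
    unfolding compact_uniformity_eq[OF X] diagonal_neighbourhoods_def by blast
  then show "\<exists>E\<in>compact_uniformity X. \<forall>x\<in>?S. \<forall>y\<in>?S. (x, y) \<in> E \<longrightarrow> (h x, h y) \<in> F"
    by (rule bexI[rotated]) simp
qed

lemma uniformly_continuous_imp_continuous:
  assumes X: "continuum X" and Y: "continuum Y" and im: "h ` topspace X \<subseteq> topspace Y"
    and u: "uniformly_continuous_between (topspace X) (compact_uniformity X) (compact_uniformity Y) h"
  shows "continuous_map X Y h"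
  unfolding continuous_map_def
proof (intro conjI allI impI)
  show "h \<in> topspace X \<rightarrow> topspace Y"
    using im by blast
  fix U assume U: "openin Y U"
  have haus: "Hausdorff_space Y"
    using Y metrizable_imp_Hausdorff_space by (auto simp: continuum_def)
  show "openin X {x \<in> topspace X. h x \<in> U}"
  proof (subst openin_subopen, intro ballI)
    fix x assume x: "x \<in> {x \<in> topspace X. h x \<in> U}"
    let ?F = "U \<times> U \<union> (topspace Y - {h x}) \<times> (topspace Y - {h x})"
    have "?F \<in> compact_uniformity Y"
      unfolding compact_uniformity_eq[OF Y] using diagonal_neighbourhood_isolating[OF haus U] x by blast
    then obtain E where E: "E \<in> compact_uniformity X"
        "\<forall>x\<in>topspace X. \<forall>y\<in>topspace X. (x, y) \<in> E \<longrightarrow> (h x, h y) \<in> ?F"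
      using u unfolding uniformly_continuous_between_def by blast
    have xS: "x \<in> topspace X"
      using x by blast
    show "\<exists>T. openin X T \<and> x \<in> T \<and> T \<subseteq> {x \<in> topspace X. h x \<in> U}"
    proof (intro exI conjI)
      show "x \<in> X interior_of (E `` {x})"
        using entourage_interior[OF compatible_compact_uniformity[OF X] E(1) xS] .
      show "X interior_of (E `` {x}) \<subseteq> {x \<in> topspace X. h x \<in> U}"
        using interior_of_subset[of X "E `` {x}"] interior_of_subset_topspace[of X "E `` {x}"] E(2) xS
        by blast
    qed simp
  qed
qed

lemma uniform_homeomorphism_iff:
  assumes X: "continuum X" and Y: "continuum Y"
  shows "uniform_homeomorphism (topspace X) (compact_uniformity X) (topspace Y) (compact_uniformity Y) h
    \<longleftrightarrow> homeomorphic_map X Y h"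
proof
  assume h: "uniform_homeomorphism (topspace X) (compact_uniformity X) (topspace Y) (compact_uniformity Y) h"
  then have bij: "bij_betw h (topspace X) (topspace Y)"
    by (simp add: uniform_homeomorphism_def)
  then have "continuous_map X Y h"
    using uniformly_continuous_imp_continuous[OF X Y] h
    by (simp add: uniform_homeomorphism_def bij_betw_def)
  then show "homeomorphic_map X Y h"
    using bij X Y metrizable_imp_Hausdorff_space
    by (intro continuous_imp_homeomorphic_map) (auto simp: bij_betw_def continuum_def)
next
  assume h: "homeomorphic_map X Y h"
  have bij: "bij_betw h (topspace X) (topspace Y)"
    using h by (simp add: homeomorphic_eq_everything_map bij_betw_def)
  obtain k where k: "homeomorphic_maps X Y h k"
    using h homeomorphic_map_maps by blast
  then have "k y = inv_into (topspace X) h y" if "y \<in> topspace Y" for y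
    using bij that continuous_map_image_subset_topspace[of Y X k]
    unfolding homeomorphic_maps_def by (metis bij_betw_inv_into_left image_subset_iff)
  moreover have "continuous_map Y X k"
    using k by (simp add: homeomorphic_maps_def)
  ultimately have "continuous_map Y X (inv_into (topspace X) h)"
    using continuous_map_eq by blast
  then show "uniform_homeomorphism (topspace X) (compact_uniformity X) (topspace Y) (compact_uniformity Y) h"
    unfolding uniform_homeomorphism_def
    by (intro conjI bij continuous_imp_uniformly_continuous X Y homeomorphic_imp_continuous_map[OF h])
qed

section \<open>Deck transformations and equivalence of covers\<close>

lemma continuumD:
  assumes "continuum X"
  shows "compact_space X" "connected_space X" "metrizable_space X" "Hausdorff_space X"
    "topspace X \<noteq> {}"
  using assms metrizable_imp_Hausdorff_space unfolding continuum_def by blast+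

lemma regular_coveringD:
  assumes f: "regular_covering_map Y G f X" and Y: "continuum Y"
  shows "g \<in> G \<Longrightarrow> homeomorphic_map Y Y g" "g \<in> G \<Longrightarrow> g \<in> extensional (topspace Y)"
    "g \<in> G \<Longrightarrow> y \<in> topspace Y \<Longrightarrow> g y \<in> topspace Y"
    "g \<in> G \<Longrightarrow> y \<in> topspace Y \<Longrightarrow> f (g y) = f y"
    "y \<in> topspace Y \<Longrightarrow> y' \<in> topspace Y \<Longrightarrow> f y = f y' \<Longrightarrow> \<exists>g\<in>G. g y = y'"
    "g \<in> G \<Longrightarrow> g' \<in> G \<Longrightarrow> y \<in> topspace Y \<Longrightarrow> g y = g' y \<Longrightarrow> g = g'"
    "g \<in> G \<Longrightarrow> g \<in> Bij (topspace Y)"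
proof -
  have homG: "\<forall>g\<in>G. homeomorphic_map Y Y g"
    and orb: "orbit_map (topspace Y) G f (topspace X)"
    and sub: "subgroup G (BijGroup (topspace Y))"
    using f unfolding regular_covering_map_def by blast+
  note hom = bspec[OF homG]
  have Bij: "g \<in> G \<Longrightarrow> g \<in> Bij (topspace Y)" for g
    using subgroup.subset[OF sub] by (auto simp: BijGroup_def)
  have ext: "g \<in> G \<Longrightarrow> g \<in> extensional (topspace Y)" for g
    using Bij[of g] by (auto simp: Bij_def)
  have in_top: "g \<in> G \<Longrightarrow> y \<in> topspace Y \<Longrightarrow> g y \<in> topspace Y" for g y
    using homeomorphic_map_in_topspace[OF hom] by blast
  have over: "f (g y) = f y" if g: "g \<in> G" "y \<in> topspace Y" for g y
  proof -
    have "f y = f (g y)"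
      using orb[unfolded orbit_map_def, THEN conjunct2, rule_format, OF g(2) in_top[OF g]] g(1) by blast
    then show ?thesis by simp
  qed
  show "g \<in> G \<Longrightarrow> homeomorphic_map Y Y g" "g \<in> G \<Longrightarrow> g \<in> extensional (topspace Y)"
    "g \<in> G \<Longrightarrow> y \<in> topspace Y \<Longrightarrow> g y \<in> topspace Y"
    "g \<in> G \<Longrightarrow> y \<in> topspace Y \<Longrightarrow> f (g y) = f y" "g \<in> G \<Longrightarrow> g \<in> Bij (topspace Y)"
    using hom ext in_top over Bij by blast+
  show "y \<in> topspace Y \<Longrightarrow> y' \<in> topspace Y \<Longrightarrow> f y = f y' \<Longrightarrow> \<exists>g\<in>G. g y = y'"
    using orb unfolding orbit_map_def by blast
  assume g: "g \<in> G" "g' \<in> G" and y: "y \<in> topspace Y" "g y = g' y"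
  note nc = normal_coverD[OF regular_covering_imp_normal_cover[OF f Y]]
  have "g u = g' u" if u: "u \<in> topspace Y" for u
  proof (rule lifts_unique[of Y Y f g g' y u])
    show "f (g v) = f (g' v)" if "v \<in> topspace Y" for v
      using over g that by simp
  qed (use nc y u continuumD[OF Y] hom g homeomorphic_imp_continuous_map in blast)+
  then show "g = g'"
    using ext[OF g(1)] ext[OF g(2)] by (rule extensionalityI[rotated 2])
qed

lemma bij_subgroup_apply:
  assumes G: "subgroup G (BijGroup S)"
  shows "\<one>\<^bsub>bij_subgroup S G\<^esub> \<in> G" "y \<in> S \<Longrightarrow> \<one>\<^bsub>bij_subgroup S G\<^esub> y = y"
    "g \<in> G \<Longrightarrow> k \<in> G \<Longrightarrow> g \<otimes>\<^bsub>bij_subgroup S G\<^esub> k \<in> G"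
    "g \<in> G \<Longrightarrow> k \<in> G \<Longrightarrow> y \<in> S \<Longrightarrow> (g \<otimes>\<^bsub>bij_subgroup S G\<^esub> k) y = g (k y)"
    "g \<in> G \<Longrightarrow> inv\<^bsub>bij_subgroup S G\<^esub> g \<in> G"
    "g \<in> G \<Longrightarrow> k \<in> G \<Longrightarrow>
      (g \<otimes>\<^bsub>bij_subgroup S G\<^esub> k) \<otimes>\<^bsub>bij_subgroup S G\<^esub> inv\<^bsub>bij_subgroup S G\<^esub> k = g"
    "g \<in> G \<Longrightarrow> k \<in> G \<Longrightarrow>
      (g \<otimes>\<^bsub>bij_subgroup S G\<^esub> inv\<^bsub>bij_subgroup S G\<^esub> k) \<otimes>\<^bsub>bij_subgroup S G\<^esub> k = g"
    "g \<in> G \<Longrightarrow> y \<in> S \<Longrightarrow> (inv\<^bsub>bij_subgroup S G\<^esub> g) (g y) = y"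
    "g \<in> G \<Longrightarrow> y \<in> S \<Longrightarrow> g ((inv\<^bsub>bij_subgroup S G\<^esub> g) y) = y"
proof -
  let ?B = "bij_subgroup S G"
  interpret grp: group ?B
    using G group_BijGroup by (rule subgroup.subgroup_is_group)
  have car: "carrier ?B = G"
    by simp
  have Bij: "g \<in> Bij S" if "g \<in> G" for g
    using subgroup.subset[OF G] that by (auto simp: BijGroup_def)
  show "\<one>\<^bsub>?B\<^esub> \<in> G"
    using grp.one_closed unfolding car .
  show one: "y \<in> S \<Longrightarrow> \<one>\<^bsub>?B\<^esub> y = y" for y
    by (simp add: BijGroup_def)
  show "g \<in> G \<Longrightarrow> k \<in> G \<Longrightarrow> g \<otimes>\<^bsub>?B\<^esub> k \<in> G"
    using grp.m_closed unfolding car .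
  show app: "g \<in> G \<Longrightarrow> k \<in> G \<Longrightarrow> y \<in> S \<Longrightarrow> (g \<otimes>\<^bsub>?B\<^esub> k) y = g (k y)" for g k y
    using Bij by (simp add: BijGroup_def compose_eq)
  show i: "g \<in> G \<Longrightarrow> inv\<^bsub>?B\<^esub> g \<in> G" for g
    using grp.inv_closed unfolding car .
  note rules = grp.m_assoc[unfolded car] grp.r_inv[unfolded car] grp.l_inv[unfolded car]
    grp.r_one[unfolded car]
  show "g \<in> G \<Longrightarrow> k \<in> G \<Longrightarrow> (g \<otimes>\<^bsub>?B\<^esub> k) \<otimes>\<^bsub>?B\<^esub> inv\<^bsub>?B\<^esub> k = g"
    using rules(1)[of g k "inv\<^bsub>?B\<^esub> k"] rules(2)[of k] rules(4)[of g] i[of k] by (simp only:)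
  show "g \<in> G \<Longrightarrow> k \<in> G \<Longrightarrow> (g \<otimes>\<^bsub>?B\<^esub> inv\<^bsub>?B\<^esub> k) \<otimes>\<^bsub>?B\<^esub> k = g"
    using rules(1)[of g "inv\<^bsub>?B\<^esub> k" k] rules(3)[of k] rules(4)[of g] i[of k] by (simp only:)
  show "g \<in> G \<Longrightarrow> y \<in> S \<Longrightarrow> (inv\<^bsub>?B\<^esub> g) (g y) = y"
    using app[OF i[of g], of g y] rules(3)[of g] one[of y] by (simp only:)
  show "g \<in> G \<Longrightarrow> y \<in> S \<Longrightarrow> g ((inv\<^bsub>?B\<^esub> g) y) = y"
    using app[OF _ i[of g], of g y] rules(2)[of g] one[of y] by (simp only:)
qed

lemma regular_covering_subgroup:
  assumes "regular_covering_map Y G f X"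
  shows "subgroup G (BijGroup (topspace Y))"
  using assms by (simp add: regular_covering_map_def)

lemma regular_covering_finite_group:
  assumes f: "regular_covering_map Y G f X" and Y: "continuum Y" and X: "Hausdorff_space X"
  shows "finite G"
proof -
  note fD = regular_coveringD[OF f Y] and nc = normal_coverD[OF regular_covering_imp_normal_cover[OF f Y]]
  obtain y where y: "y \<in> topspace Y"
    using continuumD(5)[OF Y] by blast
  have "finite {z \<in> topspace Y. f z = f y}"
    using nc X by (intro locally_injective_finite_fibre)
  moreover have "(\<lambda>g. g y) ` G \<subseteq> {z \<in> topspace Y. f z = f y}"
    using fD(3,4) y by blast
  moreover have "inj_on (\<lambda>g. g y) G"
    using fD(6) y by (intro inj_onI) blast
  ultimately show ?thesis
    using inj_on_finite by blast
qed

text \<open>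
  Choose the deck transformation at one point and use uniqueness of lifts.
\<close>

lemma lifts_differ_by_deck:
  assumes f: "regular_covering_map Y G f X" and Y: "continuum Y"
    and Z: "connected_space Z" "z0 \<in> topspace Z"
    and h: "continuous_map Z Y h" and h': "continuous_map Z Y h'"
    and over: "\<And>z. z \<in> topspace Z \<Longrightarrow> f (h z) = f (h' z)"
  shows "\<exists>!k. k \<in> G \<and> (\<forall>z\<in>topspace Z. k (h z) = h' z)"
proof -
  note fD = regular_coveringD[OF f Y]
  have hY: "h z \<in> topspace Y" "h' z \<in> topspace Y" if "z \<in> topspace Z" for z
    using continuous_map_image_subset_topspace[OF h] continuous_map_image_subset_topspace[OF h'] that
    by blast+
  obtain k where k: "k \<in> G" "k (h z0) = h' z0"
    using fD(5)[OF hY[OF Z(2)] over[OF Z(2)]] by blast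
  note nc = normal_coverD[OF regular_covering_imp_normal_cover[OF f Y]]
  have "(k \<circ> h) z = h' z" if z: "z \<in> topspace Z" for z
  proof (rule lifts_unique[OF Z(1) nc(3,6), of "k \<circ> h" h' z0 z])
    show "continuous_map Z Y (k \<circ> h)"
      using h homeomorphic_imp_continuous_map[OF fD(1)[OF k(1)]] by (rule continuous_map_compose)
    show "f ((k \<circ> h) w) = f (h' w)" if "w \<in> topspace Z" for w
      using fD(4)[OF k(1) hY(1)[OF that]] over[OF that] by simp
  qed (use k Z h' z in auto)
  then have "k \<in> G \<and> (\<forall>z\<in>topspace Z. k (h z) = h' z)"
    using k by simp
  then show ?thesis
  proof (rule ex1I[of _ k])
    fix l assume l: "l \<in> G \<and> (\<forall>z\<in>topspace Z. l (h z) = h' z)"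
    show "l = k"
      using fD(6)[of l k "h z0"] l k hY Z(2) by simp
  qed
qed

lemma bij_subgroup_mult:
  assumes "g \<in> Bij S" "g' \<in> Bij S"
  shows "g \<otimes>\<^bsub>bij_subgroup S G\<^esub> g' = compose S g g'"
  using assms by (simp add: BijGroup_def)

lemma regular_covering_compose:
  assumes "regular_covering_map Y G f X" "g \<in> G" "g' \<in> G"
  shows "compose (topspace Y) g g' \<in> G"
proof -
  have G: "subgroup G (BijGroup (topspace Y))"
    using assms(1) by (simp add: regular_covering_map_def)
  have "g \<in> Bij (topspace Y)" "g' \<in> Bij (topspace Y)"
    using subgroup.subset[OF G] assms(2,3) by (auto simp: BijGroup_def)
  then show ?thesis
    using subgroup.m_closed[OF G assms(2,3)] by (simp add: BijGroup_def)
qed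

lemma cover_by_continuumD:
  assumes "cover_by_continuum X c"
  shows "regular_covering_map (cspace c) (cdeck c) (cmap c) X" "continuum (cspace c)"
    "normal_cover (cspace c) X (cmap c)"
  using assms regular_covering_imp_normal_cover unfolding cover_by_continuum_def by blast+

text \<open>
  A homeomorphism over the base conjugates deck transformations to lifts of the projection, and these
  are deck transformations again. So the isomorphism of the groups comes for free.
\<close>

lemma equivalent_covers_iff_homeomorphic:
  assumes c: "cover_by_continuum X c" and d: "cover_by_continuum X d"
  shows "equivalent_covers c d \<longleftrightarrow>
    (\<exists>h. homeomorphic_map (cspace c) (cspace d) h \<and> (\<forall>y\<in>cpoints c. cmap d (h y) = cmap c y))"
proof
  assume "equivalent_covers c d"
  then obtain h where
      "uniform_homeomorphism (cpoints c) (compact_uniformity (cspace c))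
         (cpoints d) (compact_uniformity (cspace d)) h"
      "\<forall>y\<in>cpoints c. cmap d (h y) = cmap c y"
    unfolding equivalent_covers_def equivalent_quotient_maps_def by blast
  then show "\<exists>h. homeomorphic_map (cspace c) (cspace d) h \<and> (\<forall>y\<in>cpoints c. cmap d (h y) = cmap c y)"
    using uniform_homeomorphism_iff[OF cover_by_continuumD(2)[OF c] cover_by_continuumD(2)[OF d]] by blast
next
  assume "\<exists>h. homeomorphic_map (cspace c) (cspace d) h \<and> (\<forall>y\<in>cpoints c. cmap d (h y) = cmap c y)"
  then obtain h where h: "homeomorphic_map (cspace c) (cspace d) h"
      and over: "\<And>y. y \<in> cpoints c \<Longrightarrow> cmap d (h y) = cmap c y"
    by blast
  note C = cover_by_continuumD[OF c] and D = cover_by_continuumD[OF d]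
  note cD = regular_coveringD[OF C(1,2)] and dD = regular_coveringD[OF D(1,2)]
  have hd: "h y \<in> cpoints d" if "y \<in> cpoints c" for y
    using homeomorphic_map_in_topspace[OF h that] .
  have hinj: "y = y'" if "h y = h y'" "y \<in> cpoints c" "y' \<in> cpoints c" for y y'
    using homeomorphic_imp_injective_map[OF h] that by (auto dest: inj_onD)
  obtain y0 where y0: "y0 \<in> cpoints c"
    using continuumD(5)[OF C(2)] by blast
  have ex1: "\<exists>!k. k \<in> cdeck d \<and> (\<forall>y\<in>cpoints c. k (h y) = h (g y))" if g: "g \<in> cdeck c" for g
  proof -
    have hg: "continuous_map (cspace c) (cspace d) (h \<circ> g)"
      using homeomorphic_imp_continuous_map[OF cD(1)[OF g]] homeomorphic_imp_continuous_map[OF h]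
      by (rule continuous_map_compose)
    have ov: "cmap d (h y) = cmap d ((h \<circ> g) y)" if "y \<in> cpoints c" for y
      using over[OF that] over[OF cD(3)[OF g that]] cD(4)[OF g that] by simp
    show ?thesis
      using lifts_differ_by_deck[OF D(1,2) continuumD(2)[OF C(2)] y0
          homeomorphic_imp_continuous_map[OF h] hg ov] by simp
  qed
  define \<theta> where "\<theta> g = (THE k. k \<in> cdeck d \<and> (\<forall>y\<in>cpoints c. k (h y) = h (g y)))" for g
  have \<theta>: "\<theta> g \<in> cdeck d" "\<And>y. y \<in> cpoints c \<Longrightarrow> \<theta> g (h y) = h (g y)" if "g \<in> cdeck c" for g
    using theI'[OF ex1[OF that]] unfolding \<theta>_def by blast+
  have "\<theta> \<in> hom (cgroup c) (cgroup d)"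
  proof (rule homI)
    show "\<theta> g \<in> carrier (cgroup d)" if "g \<in> carrier (cgroup c)" for g
      using \<theta>(1) that by simp
    fix g g' assume "g \<in> carrier (cgroup c)" "g' \<in> carrier (cgroup c)"
    then have g: "g \<in> cdeck c" "g' \<in> cdeck c"
      by simp_all
    have gg: "compose (cpoints c) g g' \<in> cdeck c"
      using regular_covering_compose[OF C(1) g] .
    have tt: "compose (cpoints d) (\<theta> g) (\<theta> g') \<in> cdeck d"
      using regular_covering_compose[OF D(1) \<theta>(1)[OF g(1)] \<theta>(1)[OF g(2)]] .
    have "\<theta> (compose (cpoints c) g g') (h y0) = compose (cpoints d) (\<theta> g) (\<theta> g') (h y0)"
      using \<theta>(2)[OF gg y0] \<theta>(2)[OF g(1) cD(3)[OF g(2) y0]] \<theta>(2)[OF g(2) y0] y0 hd[OF y0]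
      by (simp add: compose_eq)
    then have "\<theta> (compose (cpoints c) g g') = compose (cpoints d) (\<theta> g) (\<theta> g')"
      using dD(6)[OF \<theta>(1)[OF gg] tt hd[OF y0]] by blast
    then show "\<theta> (g \<otimes>\<^bsub>cgroup c\<^esub> g') = \<theta> g \<otimes>\<^bsub>cgroup d\<^esub> \<theta> g'"
      using bij_subgroup_mult[OF cD(7)[OF g(1)] cD(7)[OF g(2)]]
        bij_subgroup_mult[OF dD(7)[OF \<theta>(1)[OF g(1)]] dD(7)[OF \<theta>(1)[OF g(2)]]] by simp
  qed
  moreover have "inj_on \<theta> (cdeck c)"
  proof (rule inj_onI)
    fix g g' assume g: "g \<in> cdeck c" "g' \<in> cdeck c" "\<theta> g = \<theta> g'"
    then have "h (g y0) = h (g' y0)"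
      using \<theta>(2)[OF g(1) y0] \<theta>(2)[OF g(2) y0] by simp
    then have "g y0 = g' y0"
      using hinj cD(3) g y0 by blast
    then show "g = g'"
      using cD(6) g y0 by blast
  qed
  moreover have "k \<in> \<theta> ` cdeck c" if k: "k \<in> cdeck d" for k
  proof -
    have "k (h y0) \<in> h ` cpoints c"
      using dD(3)[OF k hd[OF y0]] homeomorphic_imp_surjective_map[OF h] by simp
    then obtain y1 where y1: "y1 \<in> cpoints c" "h y1 = k (h y0)"
      by (elim imageE) simp
    have "cmap c y0 = cmap c y1"
      using over[OF y0] over[OF y1(1)] dD(4)[OF k hd[OF y0]] y1(2) by simp
    then obtain g where g: "g \<in> cdeck c" "g y0 = y1"
      using cD(5) y0 y1 by blast
    have "\<theta> g (h y0) = k (h y0)"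
      using \<theta>(2)[OF g(1) y0] g(2) y1(2) by simp
    then have "\<theta> g = k"
      using dD(6)[OF \<theta>(1)[OF g(1)] k hd[OF y0]] by blast
    then show ?thesis
      using g(1) by blast
  qed
  ultimately have "\<theta> \<in> iso (cgroup c) (cgroup d)"
    using \<theta>(1) by (auto simp: iso_def bij_betw_def)
  moreover have "uniform_homeomorphism (cpoints c) (compact_uniformity (cspace c))
         (cpoints d) (compact_uniformity (cspace d)) h"
    using h uniform_homeomorphism_iff[OF C(2) D(2)] by blast
  ultimately show "equivalent_covers c d"
    unfolding equivalent_covers_def equivalent_quotient_maps_def
    using \<theta>(2) over by (intro exI[of _ h] exI[of _ \<theta>]) simp
qed

subsection \<open>Copies of covers on sets of real numbers\<close>

lemma homeomorphic_normal_cover: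
  assumes Z: "normal_cover Z X f" and h: "homeomorphic_map Z Z' h"
    and over: "\<And>z. z \<in> topspace Z \<Longrightarrow> f' (h z) = f z"
  shows "normal_cover Z' X f'"
proof -
  note Z' = normal_coverD[OF Z]
  obtain k where k: "homeomorphic_maps Z Z' h k"
    using h homeomorphic_map_maps by blast
  then have kc: "continuous_map Z' Z k" and hk: "\<And>z. z \<in> topspace Z' \<Longrightarrow> h (k z) = z"
    unfolding homeomorphic_maps_def by blast+
  have k': "homeomorphic_map Z' Z k"
    using k homeomorphic_maps_map by blast
  have kZ: "k z \<in> topspace Z" if "z \<in> topspace Z'" for z
    using homeomorphic_map_in_topspace[OF k' that] .

  have f': "f' z = f (k z)" if "z \<in> topspace Z'" for z
    using over[OF kZ[OF that]] hk[OF that] by simp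
  have "Z homeomorphic_space Z'"
    using h homeomorphic_map_imp_homeomorphic_space by blast
  then have "compact_space Z'" "metrizable_space Z'"
    using Z'(1,2) homeomorphic_compact_space homeomorphic_metrizable_space by blast+
  moreover have "continuous_map Z' X f'"
    using continuous_map_compose[OF kc Z'(4)] by (rule continuous_map_eq) (simp add: f')
  moreover have "f' ` topspace Z' = topspace X"
  proof -
    have "f' ` topspace Z' = f ` k ` topspace Z'"
      using f' by (auto simp: image_image)
    then show ?thesis
      using homeomorphic_imp_surjective_map[OF k'] Z'(5) by simp
  qed
  moreover have "locally_injective Z' f'"
    unfolding locally_injective_def
  proof
    fix z assume z: "z \<in> topspace Z'"
    then obtain U where U: "openin Z U" "k z \<in> U" "inj_on f U"
      using Z'(6) kZ unfolding locally_injective_def by blast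
    have "inj_on f' {z \<in> topspace Z'. k z \<in> U}"
    proof (rule inj_onI)
      fix v w assume vw: "v \<in> {z \<in> topspace Z'. k z \<in> U}" "w \<in> {z \<in> topspace Z'. k z \<in> U}" "f' v = f' w"
      then have "k v = k w"
        using U(3) f' by (auto dest: inj_onD)
      then have "h (k v) = h (k w)"
        by simp
      then show "v = w"
        using hk vw by simp
    qed
    moreover have "openin Z' {z \<in> topspace Z'. k z \<in> U}"
      using kc U(1) by (rule openin_continuous_map_preimage)
    ultimately show "\<exists>U. openin Z' U \<and> z \<in> U \<and> inj_on f' U"
      using z U(2) by (intro exI[of _ "{z \<in> topspace Z'. k z \<in> U}"]) simp
  qed
  moreover have "\<exists>g. homeomorphic_map Z' Z' g \<and> (\<forall>u\<in>topspace Z'. f' (g u) = f' u) \<and> g z = z'"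
    if z: "z \<in> topspace Z'" "z' \<in> topspace Z'" "f' z = f' z'" for z z'
  proof -
    obtain g where g: "homeomorphic_map Z Z g" "\<And>u. u \<in> topspace Z \<Longrightarrow> f (g u) = f u" "g (k z) = k z'"
      using normal_cover_translation[OF Z kZ[OF z(1)] kZ[OF z(2)]] f' z by metis
    have "homeomorphic_map Z' Z' (h \<circ> g \<circ> k)"
      using homeomorphic_map_compose[OF k' homeomorphic_map_compose[OF g(1) h]] by (simp add: comp_assoc)
    moreover have "f' ((h \<circ> g \<circ> k) u) = f' u" if "u \<in> topspace Z'" for u
      using over[OF homeomorphic_map_in_topspace[OF g(1) kZ[OF that]]] g(2)[OF kZ[OF that]] f'[OF that]
      by simp
    moreover have "(h \<circ> g \<circ> k) z = z'"
      using g(3) hk z by simp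
    ultimately show ?thesis
      by blast
  qed
  ultimately show ?thesis
    unfolding normal_cover_def by blast
qed

lemma homeomorphic_continuum:
  assumes "continuum Z" "homeomorphic_map Z Z' h"
  shows "continuum Z'"
proof -
  have "Z homeomorphic_space Z'"
    using assms(2) homeomorphic_map_imp_homeomorphic_space by blast
  then show ?thesis
    using assms homeomorphic_compact_space homeomorphic_metrizable_space homeomorphic_connected_space
      homeomorphic_imp_surjective_map[OF assms(2)]
    unfolding continuum_def by blast
qed

lemma compact_metrizable_inject_real:
  assumes "compact_space Z" "metrizable_space Z"
  shows "\<exists>j :: 'a \<Rightarrow> real. inj_on j (topspace (Z :: 'a topology))"
proof -
  obtain \<B> where B: "countable \<B>" "\<forall>V\<in>\<B>. openin Z V"
      "\<forall>U x. openin Z U \<and> x \<in> U \<longrightarrow> (\<exists>V\<in>\<B>. x \<in> V \<and> V \<subseteq> U)"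
    using compact_metrizable_imp_second_countable[OF assms] unfolding second_countable_def by blast
  obtain \<phi> :: "nat set \<Rightarrow> real" where \<phi>: "bij_betw \<phi> UNIV UNIV"
    using nat_sets_eqpoll_reals unfolding eqpoll_def by blast
  let ?s = "\<lambda>x. {n. x \<in> from_nat_into \<B> n}"
  have sep: "?s x \<noteq> ?s y" if xy: "x \<in> topspace Z" "y \<in> topspace Z" "x \<noteq> y" for x y
  proof -
    obtain U V where U: "openin Z U" "x \<in> U" "y \<notin> U"
      using metrizable_imp_t1_space[OF assms(2)] xy unfolding t1_space_def by blast
    then obtain V where V: "V \<in> \<B>" "x \<in> V" "y \<notin> V"
      using B(3) by blast
    obtain n where "from_nat_into \<B> n = V"
      using from_nat_into_surj[OF B(1) V(1)] by blast
    then show ?thesis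
      using V by auto
  qed
  have "inj_on (\<lambda>x. \<phi> (?s x)) (topspace Z)"
  proof (rule inj_onI)
    fix x y assume xy: "x \<in> topspace Z" "y \<in> topspace Z" "\<phi> (?s x) = \<phi> (?s y)"
    have "inj \<phi>"
      using \<phi> by (rule bij_betw_imp_inj_on)
    then have "?s x = ?s y"
      using xy(3) by (rule injD)
    then show "x = y"
      using sep[OF xy(1,2)] by blast
  qed
  then show ?thesis
    by blast
qed

text \<open>
  The members of a cover system live on the real numbers. Fibre products, quotients and towers live
  on other types and are compared with the system through this lemma.
\<close>

lemma real_copy_of_cover:
  assumes Z: "normal_cover Z X f" "continuum Z" and X: "Hausdorff_space X"
  shows "\<exists>c h. cover_by_continuum X c \<and> homeomorphic_map Z (cspace c) h \<and>
    (\<forall>z\<in>topspace Z. cmap c (h z) = f z)"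
proof -
  obtain j :: "_ \<Rightarrow> real" where j: "inj_on j (topspace Z)"
    using compact_metrizable_inject_real continuumD(1,3)[OF Z(2)] by blast
  define T where "T = quotient_space Z j"
  define f' where "f' = f \<circ> inv_into (topspace Z) j"
  have h: "homeomorphic_map Z T j"
    unfolding homeomorphic_map_def T_def using quotient_map_quotient_space j by blast
  have over: "f' (j z) = f z" if "z \<in> topspace Z" for z
    using j that by (simp add: f'_def)
  have T: "normal_cover T X f'" "continuum T"
    using homeomorphic_normal_cover[OF Z(1) h over] homeomorphic_continuum[OF Z(2) h] by blast+
  have "regular_covering_map T (deck_group T f') f' X"
    using normal_cover_imp_regular_covering[OF T(1) continuumD(2)[OF T(2)] X] .
  then have "cover_by_continuum X (Cover T (deck_group T f') f')"
    using T(2) by (simp add: cover_by_continuum_def)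
  then show ?thesis
    using h over by (intro exI[of _ "Cover T (deck_group T f') f'"] exI[of _ j]) simp
qed

section \<open>Countability of the family of covers\<close>

lemma locally_injective_separation:
  assumes d: "compatible_distance Y d" and f: "locally_injective Y f"
  shows "\<exists>e>0. \<forall>x\<in>topspace Y. \<forall>y\<in>topspace Y. d x y < e \<longrightarrow> f x = f y \<longrightarrow> x = y"
proof -
  let ?\<C> = "{U. openin Y U \<and> inj_on f U}"
  have 1: "openin (prod_topology Y Y) (\<Union>U\<in>?\<C>. U \<times> U)"
    by (rule openin_square_cover) simp
  have 2: "\<forall>y\<in>topspace Y. (y, y) \<in> (\<Union>U\<in>?\<C>. U \<times> U)"
    using f unfolding locally_injective_def by auto
  obtain e where e: "e > 0"
      "\<forall>x\<in>topspace Y. \<forall>y\<in>topspace Y. d x y < e \<longrightarrow> (x, y) \<in> (\<Union>U\<in>?\<C>. U \<times> U)"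
    using compatible_distanceD(6)[OF d 1 2] by blast
  have "x = y" if xy: "x \<in> topspace Y" "y \<in> topspace Y" "d x y < e" "f x = f y" for x y
  proof -
    obtain U where "inj_on f U" "x \<in> U" "y \<in> U"
      using e(2) xy(1-3) by blast
    then show ?thesis
      using xy(4) by (auto dest: inj_onD)
  qed
  then show ?thesis
    using e(1) by blast
qed

text \<open>
  The sets \<open>V k\<close> are sheets of the cover over the members \<open>ns ! k\<close> of a fixed basis \<open>B\<close>, so small that \<open>f\<close>
  is injective on the union of two that meet. The list \<open>R\<close> records which ones meet. Only \<open>ns\<close> and \<open>R\<close>,
  which range over a countable set, will be used to tell covers apart.
\<close>

definition nerve_data ::
    "'b topology \<Rightarrow> ('b \<Rightarrow> 'a) \<Rightarrow> (nat \<Rightarrow> 'a set) \<Rightarrow> nat list \<Rightarrow> (nat \<times> nat) list \<Rightarrow>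
     (nat \<Rightarrow> 'b set) \<Rightarrow> bool" where
  "nerve_data Y f B ns R V \<longleftrightarrow>
     topspace Y = (\<Union>k<length ns. V k) \<and>
     (\<forall>k<length ns. openin Y (V k) \<and> f ` V k = B (ns ! k)) \<and>
     (\<forall>k<length ns. \<forall>l<length ns. (k, l) \<in> set R \<longleftrightarrow> V k \<inter> V l \<noteq> {}) \<and>
     (\<forall>k<length ns. \<forall>l<length ns. V k \<inter> V l \<noteq> {} \<longrightarrow> inj_on f (V k \<union> V l))"

lemma nerve_dataD:
  assumes "nerve_data Y f B ns R V"
  shows "topspace Y = (\<Union>k<length ns. V k)"
    "k < length ns \<Longrightarrow> openin Y (V k)" "k < length ns \<Longrightarrow> f ` V k = B (ns ! k)"
    "k < length ns \<Longrightarrow> l < length ns \<Longrightarrow> (k, l) \<in> set R \<longleftrightarrow> V k \<inter> V l \<noteq> {}"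
    "k < length ns \<Longrightarrow> l < length ns \<Longrightarrow> V k \<inter> V l \<noteq> {} \<Longrightarrow> inj_on f (V k \<union> V l)"
proof -
  note A = assms[unfolded nerve_data_def]
  show "topspace Y = (\<Union>k<length ns. V k)"
    using A by (rule conjunct1)
  show "k < length ns \<Longrightarrow> openin Y (V k)" "k < length ns \<Longrightarrow> f ` V k = B (ns ! k)"
    using A[THEN conjunct2, THEN conjunct1] by simp_all
  show "k < length ns \<Longrightarrow> l < length ns \<Longrightarrow> (k, l) \<in> set R \<longleftrightarrow> V k \<inter> V l \<noteq> {}"
    using A[THEN conjunct2, THEN conjunct2, THEN conjunct1] by simp
  show "k < length ns \<Longrightarrow> l < length ns \<Longrightarrow> V k \<inter> V l \<noteq> {} \<Longrightarrow> inj_on f (V k \<union> V l)"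
    using A[THEN conjunct2, THEN conjunct2, THEN conjunct2] by simp
qed

text \<open>
  Shrink balls so that their images become members of the basis, which is possible as \<open>f\<close> is open.
\<close>

lemma nerve_data_exists:
  assumes Y: "normal_cover Y X f" and X: "Hausdorff_space X"
    and B: "\<And>n. openin X (B n)" "\<And>U x. openin X U \<Longrightarrow> x \<in> U \<Longrightarrow> \<exists>n. x \<in> B n \<and> B n \<subseteq> U"
  shows "\<exists>ns R V. nerve_data Y f B ns R V"
proof -
  note Y' = normal_coverD[OF Y]
  obtain d where cd: "compatible_distance Y d"
    using compact_metrizable_distance[OF Y'(1,2)] by blast
  note d = compatible_distanceD[OF cd]
  obtain e where e: "e > 0"
      and sep: "\<And>x y. \<lbrakk>x \<in> topspace Y; y \<in> topspace Y; d x y < e; f x = f y\<rbrakk> \<Longrightarrow> x = y"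
    using locally_injective_separation[OF cd Y'(6)] by blast
  have op: "open_map Y X f"
    using Y X by (rule normal_cover_open_map)
  \<comment> \<open>radius \<open>e / 4\<close>, since the union of two meeting sheets must have diameter less than \<open>e\<close>\<close>
  let ?b = "\<lambda>y. {z \<in> topspace Y. d y z < e / 4}"
  have b: "openin Y (?b y)" "y \<in> ?b y" if "y \<in> topspace Y" for y
  proof -
    show "openin Y (?b y)"
      using cd that by (rule openin_distance_ball)
    show "y \<in> ?b y"
      using that d(4) e(1) by simp
  qed
  have "\<exists>n. f y \<in> B n \<and> B n \<subseteq> f ` ?b y" if y: "y \<in> topspace Y" for y
  proof (rule B(2))
    show "openin X (f ` ?b y)"
      using op b(1)[OF y] unfolding open_map_def by blast
    show "f y \<in> f ` ?b y"
      using b(2)[OF y] by (rule imageI)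
  qed
  then obtain n where n: "\<And>y. y \<in> topspace Y \<Longrightarrow> f y \<in> B (n y) \<and> B (n y) \<subseteq> f ` ?b y"
    by metis
  define W where "W y = ?b y \<inter> {z \<in> topspace Y. f z \<in> B (n y)}" for y
  have W: "openin Y (W y)" "y \<in> W y" "f ` W y = B (n y)" if y: "y \<in> topspace Y" for y
  proof -
    show "openin Y (W y)"
      unfolding W_def using b(1)[OF y] Y'(4) B(1) by (intro openin_Int openin_continuous_map_preimage)
    show "y \<in> W y"
      using b(2)[OF y] n[OF y] y by (simp add: W_def)
    show "f ` W y = B (n y)"
    proof (intro equalityI subsetI)
      fix x assume x: "x \<in> B (n y)"
      then obtain z where "z \<in> ?b y" "x = f z"
        using n[OF y] by blast
      then show "x \<in> f ` W y"
        using x by (intro image_eqI[of _ _ z]) (auto simp: W_def)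
    qed (auto simp: W_def)
  qed
  have inj: "inj_on f (W x \<union> W y)" if xy: "x \<in> topspace Y" "y \<in> topspace Y" "W x \<inter> W y \<noteq> {}" for x y
  proof -
    obtain w where w: "w \<in> W x" "w \<in> W y"
      using xy(3) by blast
    have near: "d w u < e / 2" if u: "u \<in> W x \<union> W y" for u
    proof -
      have *: "d w u < e / 2" if "u \<in> W z" "w \<in> W z" "z \<in> topspace Y" for z
        using that d(3)[of w z u] d(2)[of z w] by (auto simp: W_def)
      show ?thesis
        using u *[OF _ w(1) xy(1)] *[OF _ w(2) xy(2)] by blast
    qed
    show ?thesis
    proof (rule inj_onI)
      fix u v assume uv: "u \<in> W x \<union> W y" "v \<in> W x \<union> W y" "f u = f v"
      have top: "u \<in> topspace Y" "v \<in> topspace Y" "w \<in> topspace Y"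
        using uv w by (auto simp: W_def)
      have "d u v < e"
        using d(3)[OF top(1,3,2)] d(2)[of u w] near[OF uv(1)] near[OF uv(2)] by simp
      then show "u = v"
        using sep[OF top(1,2)] uv(3) by blast
    qed
  qed
  have "topspace Y \<subseteq> \<Union> (W ` topspace Y)"
    using W(2) by blast
  then have "\<exists>\<F>. finite \<F> \<and> \<F> \<subseteq> W ` topspace Y \<and> topspace Y \<subseteq> \<Union>\<F>"
    using Y'(1) W(1) unfolding compact_space_def by (intro compactinD) auto
  then obtain \<F> where F: "finite \<F>" "\<F> \<subseteq> W ` topspace Y" "topspace Y \<subseteq> \<Union>\<F>"
    by blast
  obtain T where T: "finite T" "T \<subseteq> topspace Y" "\<F> = W ` T"
    using finite_subset_image[OF F(1,2)] by blast
  obtain ys where ys: "set ys = T"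
    using finite_list[OF T(1)] by blast
  have ysY: "ys ! k \<in> topspace Y" if "k < length ys" for k
    using that T(2) ys nth_mem by blast
  define V where "V k = W (ys ! k)" for k
  have "finite {(k, l). k < length ys \<and> l < length ys \<and> V k \<inter> V l \<noteq> {}}"
    by (rule finite_subset[of _ "{..<length ys} \<times> {..<length ys}"]) auto
  from finite_list[OF this]
  obtain R where R: "set R = {(k, l). k < length ys \<and> l < length ys \<and> V k \<inter> V l \<noteq> {}}"
    by (elim exE)
  have "topspace Y = (\<Union>k<length ys. V k)"
  proof (intro equalityI subsetI)
    fix y assume "y \<in> topspace Y"
    then obtain x where "x \<in> T" "y \<in> W x"
      using F(3) T(3) by blast
    then obtain k where "k < length ys" "y \<in> V k"
      using ys by (auto simp: V_def in_set_conv_nth)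
    then show "y \<in> (\<Union>k<length ys. V k)"
      by blast
  next
    fix y assume "y \<in> (\<Union>k<length ys. V k)"
    then show "y \<in> topspace Y"
      by (auto simp: V_def W_def)
  qed
  moreover have "openin Y (V k) \<and> f ` V k = B (map n ys ! k)" if "k < length ys" for k
    using W(1,3)[OF ysY[OF that]] that by (simp add: V_def)
  moreover have "inj_on f (V k \<union> V l)" if "k < length ys" "l < length ys" "V k \<inter> V l \<noteq> {}" for k l
    using inj[OF ysY ysY] that by (simp add: V_def)
  ultimately have "nerve_data Y f B (map n ys) R V"
    unfolding nerve_data_def using R by simp
  then show ?thesis
    by blast
qed

text \<open>
  The map sends a point of \<open>V k\<close> to the point of \<open>V' k\<close> in the same fibre. If the point also lies in
  \<open>V l\<close>, then \<open>V k\<close> meets \<open>V l\<close>, so \<open>V' k\<close> meets \<open>V' l\<close>, and injectivity of \<open>f'\<close> on their union makes the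
  two prescriptions agree.
\<close>

lemma nerve_data_continuous_map:
  assumes Y: "nerve_data Y f B ns R V" "continuous_map Y X f"
    and Y': "nerve_data Y' f' B ns R V'" "open_map Y' X f'"
  shows "\<exists>h. continuous_map Y Y' h \<and>
    (\<forall>k<length ns. \<forall>y\<in>V k. h y \<in> V' k \<and> f' (h y) = f y)"
proof -
  note D = nerve_dataD[OF Y(1)] and D' = nerve_dataD[OF Y'(1)]
  have "\<exists>k<length ns. \<exists>y'. y \<in> V k \<and> y' \<in> V' k \<and> f' y' = f y" if y: "y \<in> topspace Y" for y
  proof -
    obtain k where k: "k < length ns" "y \<in> V k"
      using D(1) y by blast
    then have "f y \<in> f' ` V' k"
      using D(3)[OF k(1)] D'(3)[OF k(1)] by blast
    then obtain y' where "y' \<in> V' k" "f' y' = f y"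
      by (elim imageE) simp
    then show ?thesis
      using k by blast
  qed
  then obtain h k where hk: "\<And>y. y \<in> topspace Y \<Longrightarrow>
      k y < length ns \<and> y \<in> V (k y) \<and> h y \<in> V' (k y) \<and> f' (h y) = f y"
    by metis
  have VY: "y \<in> topspace Y" if "k < length ns" "y \<in> V k" for k y
    using D(1) that by blast
  have uniq: "h y = y'" if y: "l < length ns" "y \<in> V l" "y' \<in> V' l" "f' y' = f y" for l y y'
  proof -
    have yY: "y \<in> topspace Y"
      using VY y by blast
    note h = hk[OF yY]
    have "V (k y) \<inter> V l \<noteq> {}"
      using h y(2) by blast
    then have "V' (k y) \<inter> V' l \<noteq> {}"
      using D(4)[of "k y" l] D'(4)[of "k y" l] h y(1) by blast
    then have "inj_on f' (V' (k y) \<union> V' l)"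
      using D'(5)[of "k y" l] h y(1) by blast
    then show ?thesis
      using h y(3,4) inj_onD[of f' "V' (k y) \<union> V' l" "h y" y'] by simp
  qed
  have loc: "h y \<in> V' l \<and> f' (h y) = f y" if l: "l < length ns" "y \<in> V l" for l y
  proof -
    have "f y \<in> f' ` V' l"
      using D(3)[OF l(1)] D'(3)[OF l(1)] l(2) by blast
    then obtain y' where "y' \<in> V' l" "f' y' = f y"
      by (elim imageE) simp
    then show ?thesis
      using uniq[OF l] by blast
  qed
  have "continuous_map Y Y' h"
    unfolding continuous_map_def
  proof (intro conjI allI impI)
    show "h \<in> topspace Y \<rightarrow> topspace Y'"
      using hk D'(1) by blast
    fix U assume U: "openin Y' U"
    show "openin Y {y \<in> topspace Y. h y \<in> U}"
    proof (subst openin_subopen, intro ballI)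
      fix y assume y: "y \<in> {y \<in> topspace Y. h y \<in> U}"
      then have k: "k y < length ns" "y \<in> V (k y)" "h y \<in> V' (k y)" "f' (h y) = f y"
        using hk by blast+
      let ?T = "V (k y) \<inter> {z \<in> topspace Y. f z \<in> f' ` (U \<inter> V' (k y))}"
      have "openin X (f' ` (U \<inter> V' (k y)))"
        using Y'(2) openin_Int[OF U D'(2)[OF k(1)]] unfolding open_map_def by blast
      then have "openin Y ?T"
        using Y(2) D(2)[OF k(1)] by (intro openin_Int openin_continuous_map_preimage)
      moreover have "f y \<in> f' ` (U \<inter> V' (k y))"
        using k y by (intro image_eqI[of _ _ "h y"]) auto
      then have "y \<in> ?T"
        using y k(2) by blast
      moreover have "?T \<subseteq> {y \<in> topspace Y. h y \<in> U}"
      proof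
        fix z assume z: "z \<in> ?T"
        then obtain u where u: "u \<in> U" "u \<in> V' (k y)" "f z = f' u"
          by blast
        then have "h z = u"
          using uniq[of "k y" z u] k(1) z by simp
        then show "z \<in> {y \<in> topspace Y. h y \<in> U}"
          using u z by blast
      qed
      ultimately show "\<exists>T. openin Y T \<and> y \<in> T \<and> T \<subseteq> {y \<in> topspace Y. h y \<in> U}"
        by blast
    qed
  qed
  then show ?thesis
    using loc by blast
qed

lemma nerve_data_determines_cover:
  assumes Y: "nerve_data Y f B ns R V" "continuous_map Y X f" "open_map Y X f"
    and Y': "nerve_data Y' f' B ns R V'" "continuous_map Y' X f'" "open_map Y' X f'"
  shows "\<exists>h. homeomorphic_map Y Y' h \<and> (\<forall>y\<in>topspace Y. f' (h y) = f y)"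
proof -
  note D = nerve_dataD[OF Y(1)] and D' = nerve_dataD[OF Y'(1)]
  obtain h where h: "continuous_map Y Y' h"
      "\<forall>k<length ns. \<forall>y\<in>V k. h y \<in> V' k \<and> f' (h y) = f y"
    using nerve_data_continuous_map[OF Y(1,2) Y'(1,3)] by blast
  obtain h' where h': "continuous_map Y' Y h'"
      "\<forall>k<length ns. \<forall>y\<in>V' k. h' y \<in> V k \<and> f (h' y) = f' y"
    using nerve_data_continuous_map[OF Y'(1,2) Y(1,3)] by blast
  have inj: "inj_on f (V k)" "inj_on f' (V' k)" if "k < length ns" for k
    using D(5)[OF that that] D'(5)[OF that that] by (cases "V k = {}"; cases "V' k = {}"; simp)+
  have "h' (h y) = y" if y: "y \<in> topspace Y" for y
  proof -
    obtain k where k: "k < length ns" "y \<in> V k"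
      using D(1) y by blast
    then have "h' (h y) \<in> V k" "f (h' (h y)) = f y"
      using h(2) h'(2) by simp_all
    then show ?thesis
      using inj(1)[OF k(1)] k(2) by (auto dest: inj_onD)
  qed
  moreover have "h (h' y) = y" if y: "y \<in> topspace Y'" for y
  proof -
    obtain k where k: "k < length ns" "y \<in> V' k"
      using D'(1) y by blast
    then have "h (h' y) \<in> V' k" "f' (h (h' y)) = f' y"
      using h(2) h'(2) by simp_all
    then show ?thesis
      using inj(2)[OF k(1)] k(2) by (auto dest: inj_onD)
  qed
  ultimately have "homeomorphic_maps Y Y' h h'"
    using h(1) h'(1) unfolding homeomorphic_maps_def by blast
  then have "homeomorphic_map Y Y' h"
    by (rule homeomorphic_maps_imp_map)
  moreover have "f' (h y) = f y" if "y \<in> topspace Y" for y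
    using D(1) h(2) that by blast
  ultimately show ?thesis
    by blast
qed

text \<open>
  Assigning to a cover the finite lists of some nerve data is injective up to equivalence.
\<close>

lemma countable_inequivalent_covers:
  assumes X: "continuum X" and C: "\<And>c. c \<in> C \<Longrightarrow> cover_by_continuum X c"
    and ineq: "\<And>c d. \<lbrakk>c \<in> C; d \<in> C; equivalent_covers c d\<rbrakk> \<Longrightarrow> c = d"
  shows "countable C"
proof -
  note X' = continuumD[OF X]
  obtain \<B> where B: "countable \<B>" "\<forall>V\<in>\<B>. openin X V"
      "\<forall>U x. openin X U \<and> x \<in> U \<longrightarrow> (\<exists>V\<in>\<B>. x \<in> V \<and> V \<subseteq> U)"
    using compact_metrizable_imp_second_countable[OF X'(1,3)] unfolding second_countable_def by blast
  have "\<B> \<noteq> {}"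
    using B(3) X'(5) openin_topspace by blast
  define b where "b = from_nat_into \<B>"
  have b: "openin X (b n)" for n
    using B(2) from_nat_into[OF \<open>\<B> \<noteq> {}\<close>] by (simp add: b_def)
  have b': "\<exists>n. x \<in> b n \<and> b n \<subseteq> U" if Ux: "openin X U" "x \<in> U" for U x
  proof -
    obtain V where V: "V \<in> \<B>" "x \<in> V" "V \<subseteq> U"
      using B(3) Ux by blast
    obtain n where "from_nat_into \<B> n = V"
      using from_nat_into_surj[OF B(1) V(1)] by blast
    then show ?thesis
      using V unfolding b_def by blast
  qed
  have "\<forall>c\<in>C. \<exists>p V. nerve_data (cspace c) (cmap c) b (fst p) (snd p) V"
  proof
    fix c assume c: "c \<in> C"
    have "\<exists>ns R V. nerve_data (cspace c) (cmap c) b ns R V"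
      using nerve_data_exists[OF cover_by_continuumD(3)[OF C[OF c]] X'(4) b b'] by blast
    then show "\<exists>p V. nerve_data (cspace c) (cmap c) b (fst p) (snd p) V"
      by (metis fst_conv snd_conv)
  qed
  then obtain e :: "_ \<Rightarrow> nat list \<times> (nat \<times> nat) list" and V where
      e: "\<forall>c\<in>C. nerve_data (cspace c) (cmap c) b (fst (e c)) (snd (e c)) (V c)"
    by metis
  have "inj_on e C"
  proof (rule inj_onI)
    fix c d assume cd: "c \<in> C" "d \<in> C" "e c = e d"
    note c = cover_by_continuumD(3)[OF C[OF cd(1)]] and d = cover_by_continuumD(3)[OF C[OF cd(2)]]
    have 1: "nerve_data (cspace c) (cmap c) b (fst (e c)) (snd (e c)) (V c)"
      using e cd(1) by blast
    have 2: "nerve_data (cspace d) (cmap d) b (fst (e c)) (snd (e c)) (V d)"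
      using e cd(2,3) by simp
    have "\<exists>h. homeomorphic_map (cspace c) (cspace d) h \<and> (\<forall>y\<in>cpoints c. cmap d (h y) = cmap c y)"
      by (rule nerve_data_determines_cover[OF 1 normal_coverD(4)[OF c] normal_cover_open_map[OF c X'(4)]
            2 normal_coverD(4)[OF d] normal_cover_open_map[OF d X'(4)]])
    then have "equivalent_covers c d"
      using equivalent_covers_iff_homeomorphic[OF C[OF cd(1)] C[OF cd(2)]] by blast
    then show "c = d"
      using ineq cd by blast
  qed
  then show ?thesis
    by (rule countable_image_inj_on[rotated]) (rule countableI_type)
qed

section \<open>Fibre products of normal covers\<close>

definition fibre_product ::
    "'b topology \<Rightarrow> ('b \<Rightarrow> 'a) \<Rightarrow> 'c topology \<Rightarrow> ('c \<Rightarrow> 'a) \<Rightarrow> ('b \<times> 'c) topology" where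
  "fibre_product W f Z q = subtopology (prod_topology W Z) {(w, z). f w = q z}"

lemma topspace_fibre_product:
  "topspace (fibre_product W f Z q) = {(w, z) \<in> topspace W \<times> topspace Z. f w = q z}"
  by (auto simp: fibre_product_def)

lemma continuous_map_fibre_product_fst: "continuous_map (fibre_product W f Z q) W fst"
  and continuous_map_fibre_product_snd: "continuous_map (fibre_product W f Z q) Z snd"
  unfolding fibre_product_def
  by (auto intro: continuous_map_from_subtopology continuous_map_fst continuous_map_snd)

lemma compact_metrizable_fibre_product:
  assumes W: "compact_space W" "metrizable_space W" "continuous_map W X f"
    and Z: "compact_space Z" "metrizable_space Z" "continuous_map Z X q"
    and X: "Hausdorff_space X"
  shows "compact_space (fibre_product W f Z q)" "metrizable_space (fibre_product W f Z q)"
proof -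
  let ?P = "prod_topology W Z"
  have "continuous_map ?P X (f \<circ> fst)" "continuous_map ?P X (q \<circ> snd)"
    using continuous_map_compose[OF continuous_map_fst W(3)] continuous_map_compose[OF continuous_map_snd Z(3)]
    by blast+
  then have "closedin ?P {p \<in> topspace ?P. (f \<circ> fst) p = (q \<circ> snd) p}"
    using X closedin_continuous_maps_eq by blast
  then have "compactin ?P {p \<in> topspace ?P. (f \<circ> fst) p = (q \<circ> snd) p}"
    using W(1) Z(1) by (intro closedin_compact_space) (auto simp: compact_space_prod_topology)
  moreover have "{p \<in> topspace ?P. (f \<circ> fst) p = (q \<circ> snd) p} = topspace ?P \<inter> {(w, z). f w = q z}"
    by auto
  then have "fibre_product W f Z q = subtopology ?P {p \<in> topspace ?P. (f \<circ> fst) p = (q \<circ> snd) p}"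
    unfolding fibre_product_def by (simp only: subtopology_restrict)
  ultimately show "compact_space (fibre_product W f Z q)"
    by (simp add: compact_space_subtopology)
  show "metrizable_space (fibre_product W f Z q)"
    unfolding fibre_product_def using W(2) Z(2)
    by (intro metrizable_space_subtopology) (simp add: metrizable_space_prod_topology)
qed

lemma homeomorphic_map_fibre_product:
  assumes h: "homeomorphic_map W W h" "\<And>w. w \<in> topspace W \<Longrightarrow> f (h w) = f w"
    and k: "homeomorphic_map Z Z k" "\<And>z. z \<in> topspace Z \<Longrightarrow> q (k z) = q z"
  shows "homeomorphic_map (fibre_product W f Z q) (fibre_product W f Z q) (\<lambda>p. (h (fst p), k (snd p)))"
proof -
  let ?F = "fibre_product W f Z q"
  have *: "continuous_map ?F ?F (\<lambda>p. (h (fst p), k (snd p)))"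
    if h: "continuous_map W W h" "\<And>w. w \<in> topspace W \<Longrightarrow> f (h w) = f w"
      and k: "continuous_map Z Z k" "\<And>z. z \<in> topspace Z \<Longrightarrow> q (k z) = q z" for h k
  proof -
    have "continuous_map ?F (prod_topology W Z) (\<lambda>p. ((h \<circ> fst) p, (k \<circ> snd) p))"
      by (intro continuous_map_pairedI continuous_map_compose[OF continuous_map_fibre_product_fst h(1)]
          continuous_map_compose[OF continuous_map_fibre_product_snd k(1)])
    then show ?thesis
      using h(2) k(2) unfolding fibre_product_def
      by (auto simp: continuous_map_in_subtopology)
  qed
  obtain h' where h': "homeomorphic_maps W W h h'"
    using h(1) homeomorphic_map_maps by blast
  obtain k' where k': "homeomorphic_maps Z Z k k'"
    using k(1) homeomorphic_map_maps by blast
  note H = h'[unfolded homeomorphic_maps_def] and K = k'[unfolded homeomorphic_maps_def]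
  have h'W: "h' w \<in> topspace W" if "w \<in> topspace W" for w
    using H continuous_map_image_subset_topspace that by blast
  have k'Z: "k' z \<in> topspace Z" if "z \<in> topspace Z" for z
    using K continuous_map_image_subset_topspace that by blast
  have fh': "f (h' w) = f w" if "w \<in> topspace W" for w
    using h(2)[OF h'W[OF that]] H that by simp
  have qk': "q (k' z) = q z" if "z \<in> topspace Z" for z
    using k(2)[OF k'Z[OF that]] K that by simp
  have "homeomorphic_maps ?F ?F (\<lambda>p. (h (fst p), k (snd p))) (\<lambda>p. (h' (fst p), k' (snd p)))"
    unfolding homeomorphic_maps_def
    using *[of h k] *[of h' k'] H K h(2) k(2) fh' qk' by (auto simp: topspace_fibre_product)
  then show ?thesis
    by (rule homeomorphic_maps_imp_map)
qed

lemma locally_injective_compose: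
  assumes r: "continuous_map Z Y r" "locally_injective Z r" and f: "locally_injective Y f"
  shows "locally_injective Z (f \<circ> r)"
  unfolding locally_injective_def
proof
  fix z assume z: "z \<in> topspace Z"
  have "r z \<in> topspace Y"
    using continuous_map_image_subset_topspace[OF r(1)] z by blast
  then obtain V where V: "openin Y V" "r z \<in> V" "inj_on f V"
    using f unfolding locally_injective_def by blast
  obtain U where U: "openin Z U" "z \<in> U" "inj_on r U"
    using r(2) z unfolding locally_injective_def by blast
  let ?T = "U \<inter> {z \<in> topspace Z. r z \<in> V}"
  have "openin Z ?T"
    using U(1) openin_continuous_map_preimage[OF r(1) V(1)] by (rule openin_Int)
  moreover have "inj_on (f \<circ> r) ?T"
    using U(3) V(3) by (auto simp: inj_on_def)
  ultimately show "\<exists>U. openin Z U \<and> z \<in> U \<and> inj_on (f \<circ> r) U"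
    using U(2) V(2) z by (intro exI[of _ ?T]) simp
qed

lemma normal_cover_pullback:
  assumes W: "compact_space W" "metrizable_space W" "continuous_map W X f"
    and Z: "normal_cover Z X q" and X: "Hausdorff_space X"
  shows "normal_cover (fibre_product W f Z q) W fst"
proof -
  let ?F = "fibre_product W f Z q"
  note Z' = normal_coverD[OF Z]
  have "locally_injective ?F fst"
    unfolding locally_injective_def
  proof
    fix p assume p: "p \<in> topspace ?F"
    then have sp: "snd p \<in> topspace Z"
      by (auto simp: topspace_fibre_product)
    then obtain U where U: "openin Z U" "snd p \<in> U" "inj_on q U"
      using Z'(6) unfolding locally_injective_def by blast
    let ?T = "{p \<in> topspace ?F. snd p \<in> U}"
    have "openin ?F ?T"
      using continuous_map_fibre_product_snd U(1) by (rule openin_continuous_map_preimage)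
    moreover have "inj_on fst ?T"
      using U(3) by (auto simp: inj_on_def topspace_fibre_product)
    ultimately show "\<exists>U. openin ?F U \<and> p \<in> U \<and> inj_on fst U"
      using p U(2) by blast
  qed
  moreover have "fst ` topspace ?F = topspace W"
  proof (intro equalityI subsetI)
    fix w assume w: "w \<in> topspace W"
    then have "f w \<in> q ` topspace Z"
      using Z'(5) continuous_map_image_subset_topspace[OF W(3)] by auto
    then obtain z where "z \<in> topspace Z" "f w = q z"
      by (elim imageE)
    then show "w \<in> fst ` topspace ?F"
      using w by (intro image_eqI[of _ _ "(w, z)"]) (auto simp: topspace_fibre_product)
  qed (auto simp: topspace_fibre_product)
  moreover have "\<exists>h. homeomorphic_map ?F ?F h \<and> (\<forall>u\<in>topspace ?F. fst (h u) = fst u) \<and> h p = p'"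
    if p: "p \<in> topspace ?F" "p' \<in> topspace ?F" "fst p = fst p'" for p p'
  proof -
    have "snd p \<in> topspace Z" "snd p' \<in> topspace Z" "q (snd p) = q (snd p')"
      using p by (auto simp: topspace_fibre_product)
    then obtain k where k: "homeomorphic_map Z Z k" "\<And>u. u \<in> topspace Z \<Longrightarrow> q (k u) = q u"
        "k (snd p) = snd p'"
      using normal_cover_translation[OF Z] by metis
    have "homeomorphic_map ?F ?F (\<lambda>p. (id (fst p), k (snd p)))"
      using k homeomorphic_map_id[of W W] by (intro homeomorphic_map_fibre_product) (auto simp: id_def)
    then show ?thesis
      using k(3) p(3) by (intro exI[of _ "\<lambda>p. (id (fst p), k (snd p))"]) (auto simp: prod_eq_iff)
  qed
  ultimately show ?thesis
    unfolding normal_cover_def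
    using compact_metrizable_fibre_product[OF W Z'(1,2,4) X] continuous_map_fibre_product_fst by blast
qed

lemma normal_cover_fibre_product:
  assumes W: "normal_cover W X f" and Z: "normal_cover Z X q" and X: "Hausdorff_space X"
  shows "normal_cover (fibre_product W f Z q) X (f \<circ> fst)"
proof -
  let ?F = "fibre_product W f Z q"
  note W' = normal_coverD[OF W]
  note pb = normal_coverD[OF normal_cover_pullback[OF W'(1,2,4) Z X]]
  have "\<exists>h. homeomorphic_map ?F ?F h \<and> (\<forall>u\<in>topspace ?F. (f \<circ> fst) (h u) = (f \<circ> fst) u) \<and> h p = p'"
    if p: "p \<in> topspace ?F" "p' \<in> topspace ?F" "(f \<circ> fst) p = (f \<circ> fst) p'" for p p'
  proof -
    have p': "fst p \<in> topspace W" "fst p' \<in> topspace W" "f (fst p) = f (fst p')"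
        "snd p \<in> topspace Z" "snd p' \<in> topspace Z" "q (snd p) = q (snd p')"
      using p by (auto simp: topspace_fibre_product)
    obtain h where h: "homeomorphic_map W W h" "\<And>u. u \<in> topspace W \<Longrightarrow> f (h u) = f u"
        "h (fst p) = fst p'"
      using normal_cover_translation[OF W p'(1-3)] by metis
    obtain k where k: "homeomorphic_map Z Z k" "\<And>u. u \<in> topspace Z \<Longrightarrow> q (k u) = q u"
        "k (snd p) = snd p'"
      using normal_cover_translation[OF Z p'(4-6)] by metis
    have "homeomorphic_map ?F ?F (\<lambda>p. (h (fst p), k (snd p)))"
      using h k by (intro homeomorphic_map_fibre_product)
    then show ?thesis
      using h(2,3) k(3)
      by (intro exI[of _ "\<lambda>p. (h (fst p), k (snd p))"]) (auto simp: prod_eq_iff topspace_fibre_product)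
  qed
  moreover have "(f \<circ> fst) ` topspace ?F = topspace X"
    using pb(5) W'(5) by (simp only: image_comp[symmetric])
  ultimately show ?thesis
    unfolding normal_cover_def
    using pb(1,2) continuous_map_compose[OF pb(4) W'(4)] locally_injective_compose[OF pb(4,6) W'(6)]
    by blast
qed

section \<open>The inverse system of covers\<close>

locale cover_system =
  fixes X :: "'a topology" and C :: "'a cover set" and b :: "'a cover \<Rightarrow> real"
  assumes X: "continuum X" and system: "pointed_cover_system X C b"
begin

lemmas X_facts = continuumD[OF X]

lemma cover: "c \<in> C \<Longrightarrow> cover_by_continuum X c"
  using system unfolding pointed_cover_system_def by blast

lemmas regular = cover_by_continuumD(1)[OF cover] and continuum_cspace = cover_by_continuumD(2)[OF cover]
  and normal = cover_by_continuumD(3)[OF cover]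

lemma deck:
  assumes c: "c \<in> C"
  shows "g \<in> cdeck c \<Longrightarrow> homeomorphic_map (cspace c) (cspace c) g"
    "g \<in> cdeck c \<Longrightarrow> g \<in> extensional (cpoints c)"
    "g \<in> cdeck c \<Longrightarrow> y \<in> cpoints c \<Longrightarrow> g y \<in> cpoints c"
    "g \<in> cdeck c \<Longrightarrow> y \<in> cpoints c \<Longrightarrow> cmap c (g y) = cmap c y"
    "y \<in> cpoints c \<Longrightarrow> y' \<in> cpoints c \<Longrightarrow> cmap c y = cmap c y' \<Longrightarrow> \<exists>g\<in>cdeck c. g y = y'"
    "g \<in> cdeck c \<Longrightarrow> g' \<in> cdeck c \<Longrightarrow> y \<in> cpoints c \<Longrightarrow> g y = g' y \<Longrightarrow> g = g'"
    "g \<in> cdeck c \<Longrightarrow> g \<in> Bij (cpoints c)"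
  by (fact regular_coveringD[OF regular[OF c] continuum_cspace[OF c]])+
lemmas cspace_facts = continuumD[OF continuum_cspace]
lemmas cmap_facts = normal_coverD[OF normal]

lemma ex1_representative: "cover_by_continuum X d \<Longrightarrow> \<exists>!c. c \<in> C \<and> equivalent_covers d c"
  using system unfolding pointed_cover_system_def by blast

lemma basepoint: "c \<in> C \<Longrightarrow> b c \<in> cpoints c"
  and cmap_basepoint: "c \<in> C \<Longrightarrow> d \<in> C \<Longrightarrow> cmap c (b c) = cmap d (b d)"
proof -
  obtain x where x: "\<forall>c\<in>C. b c \<in> cpoints c \<and> cmap c (b c) = x"
    using system unfolding pointed_cover_system_def by blast
  then show "c \<in> C \<Longrightarrow> b c \<in> cpoints c" "c \<in> C \<Longrightarrow> d \<in> C \<Longrightarrow> cmap c (b c) = cmap d (b d)"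
    by simp_all
qed

lemma countable_C: "countable C"
proof (rule countable_inequivalent_covers[OF X cover])
  fix c d assume "c \<in> C" "d \<in> C" "equivalent_covers c d"
  then show "c = d"
    using ex1_representative[OF cover] equivalent_covers_refl by metis
qed

lemma representative:
  assumes Z: "normal_cover Z X f" "continuum Z"
  shows "\<exists>c\<in>C. \<exists>h. homeomorphic_map Z (cspace c) h \<and> (\<forall>z\<in>topspace Z. cmap c (h z) = f z)"
proof -
  obtain d h where d: "cover_by_continuum X d" "homeomorphic_map Z (cspace d) h"
      "\<forall>z\<in>topspace Z. cmap d (h z) = f z"
    using real_copy_of_cover[OF Z X_facts(4)] by blast
  obtain c where c: "c \<in> C" "equivalent_covers d c"
    using ex1_representative[OF d(1)] by blast
  obtain k where k: "homeomorphic_map (cspace d) (cspace c) k" "\<forall>y\<in>cpoints d. cmap c (k y) = cmap d y"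
    using c equivalent_covers_iff_homeomorphic[OF d(1) cover[OF c(1)]] by blast
  have "homeomorphic_map Z (cspace c) (k \<circ> h)"
    using d(2) k(1) by (rule homeomorphic_map_compose)
  moreover have "cmap c ((k \<circ> h) z) = f z" if "z \<in> topspace Z" for z
    using k(2) d(3) homeomorphic_map_in_topspace[OF d(2) that] that by simp
  ultimately show ?thesis
    using c(1) by blast
qed

lemma C_nonempty: "C \<noteq> {}"
proof -
  have "normal_cover X X id"
    unfolding normal_cover_def locally_injective_def
    using X_facts by (auto intro!: exI[of _ "topspace X"] exI[of _ id])
  then show ?thesis
    using representative X by blast
qed

lemma cover_morphismI:
  assumes c: "c \<in> C" and d: "d \<in> C" and h: "continuous_map (cspace d) (cspace c) h"
    and over: "\<And>y. y \<in> cpoints d \<Longrightarrow> cmap c (h y) = cmap d y"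
  shows "cover_morphism c d h"
proof -
  have "h ` cpoints d = cpoints c"
    using lift_of_open_map_surjective[OF cspace_facts(1,5)[OF d] cspace_facts(2,4)[OF c] cmap_facts(6,4)[OF c]
        h normal_cover_open_map[OF normal[OF d] X_facts(4)] over] .
  then show ?thesis
    using h over by (simp add: cover_morphism_def)
qed

lemma ex1_bonding_map:
  assumes c: "c \<in> C" and d: "d \<in> C" and le: "cover_le c d"
  shows "\<exists>!h. h \<in> extensional (cpoints d) \<and> cover_morphism c d h \<and> h (b d) = b c"
proof -
  obtain h where h: "cover_morphism c d h"
    using le by (auto simp: cover_le_def)
  then have hc: "continuous_map (cspace d) (cspace c) h"
    and ho: "\<And>y. y \<in> cpoints d \<Longrightarrow> cmap d y = cmap c (h y)"
    by (auto simp: cover_morphism_def)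
  have hb: "h (b d) \<in> cpoints c"
    using continuous_map_image_subset_topspace[OF hc] basepoint[OF d] by blast
  have "cmap c (h (b d)) = cmap c (b c)"
    using ho[OF basepoint[OF d]] cmap_basepoint[OF c d] by simp
  then obtain k where k: "k \<in> cdeck c" "k (h (b d)) = b c"
    using deck(5)[OF c hb basepoint[OF c]] by blast
  let ?h = "restrict (k \<circ> h) (cpoints d)"
  have "continuous_map (cspace d) (cspace c) (k \<circ> h)"
    using hc homeomorphic_imp_continuous_map[OF deck(1)[OF c k(1)]] by (rule continuous_map_compose)
  then have "continuous_map (cspace d) (cspace c) ?h"
    by (rule continuous_map_eq) simp
  moreover have "cmap c (?h y) = cmap d y" if "y \<in> cpoints d" for y
    using deck(4)[OF c k(1), of "h y"] continuous_map_image_subset_topspace[OF hc] that ho[OF that]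
    by (auto simp: image_subset_iff)
  ultimately have "cover_morphism c d ?h"
    by (rule cover_morphismI[OF c d])
  then have "?h \<in> extensional (cpoints d) \<and> cover_morphism c d ?h \<and> ?h (b d) = b c"
    using k(2) basepoint[OF d] by simp
  then show ?thesis
  proof (rule ex1I[of _ ?h])
    fix l assume l: "l \<in> extensional (cpoints d) \<and> cover_morphism c d l \<and> l (b d) = b c"
    have "l y = ?h y" if y: "y \<in> cpoints d" for y
    proof (rule lifts_unique[OF cspace_facts(2)[OF d] cspace_facts(4)[OF c] cmap_facts(6)[OF c],
          of l ?h "b d" y])
      show "continuous_map (cspace d) (cspace c) l" "continuous_map (cspace d) (cspace c) ?h"
        using l \<open>cover_morphism c d ?h\<close> by (simp_all only: cover_morphism_def)
      show "cmap c (l y) = cmap c (?h y)" if "y \<in> cpoints d" for y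
        using l \<open>cover_morphism c d ?h\<close> that unfolding cover_morphism_def by metis
      show "l (b d) = ?h (b d)"
        using l k(2) basepoint[OF d] by simp
    qed (use basepoint[OF d] y in auto)
    then show "l = ?h"
      using l by (intro extensionalityI[of l "cpoints d"]) auto
  qed
qed

lemma bonding:
  assumes c: "c \<in> C" and d: "d \<in> C" and le: "cover_le c d"
  shows "continuous_map (cspace d) (cspace c) (bonding_map b c d)"
    "bonding_map b c d ` cpoints d = cpoints c"
    "y \<in> cpoints d \<Longrightarrow> cmap c (bonding_map b c d y) = cmap d y"
    "bonding_map b c d (b d) = b c" "y \<in> cpoints d \<Longrightarrow> bonding_map b c d y \<in> cpoints c"
proof -
  have "cover_morphism c d (bonding_map b c d) \<and> bonding_map b c d (b d) = b c"
    using theI'[OF ex1_bonding_map[OF assms]] unfolding bonding_map_def by blast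
  then have *: "continuous_map (cspace d) (cspace c) (bonding_map b c d)"
    "bonding_map b c d ` cpoints d = cpoints c"
    "\<forall>y\<in>cpoints d. cmap d y = cmap c (bonding_map b c d y)"
    "bonding_map b c d (b d) = b c"
    unfolding cover_morphism_def by blast+
  then show "continuous_map (cspace d) (cspace c) (bonding_map b c d)"
    "bonding_map b c d ` cpoints d = cpoints c"
    "y \<in> cpoints d \<Longrightarrow> cmap c (bonding_map b c d y) = cmap d y"
    "bonding_map b c d (b d) = b c" "y \<in> cpoints d \<Longrightarrow> bonding_map b c d y \<in> cpoints c"
    by auto
qed

lemma bonding_eqI:
  assumes c: "c \<in> C" and d: "d \<in> C" and h: "continuous_map (cspace d) (cspace c) h"
    and over: "\<And>y. y \<in> cpoints d \<Longrightarrow> cmap c (h y) = cmap d y" and base: "h (b d) = b c"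
  shows "cover_le c d" "y \<in> cpoints d \<Longrightarrow> bonding_map b c d y = h y"
proof -
  show le: "cover_le c d"
    using cover_morphismI[OF c d h over] unfolding cover_le_def by blast
  note B = bonding[OF c d le]
  assume y: "y \<in> cpoints d"
  show "bonding_map b c d y = h y"
    by (rule lifts_unique[OF cspace_facts(2)[OF d] cspace_facts(4)[OF c] cmap_facts(6)[OF c] B(1) h])
      (use B(3,4) over base basepoint[OF d] y in auto)
qed

lemma cover_le_refl: "c \<in> C \<Longrightarrow> cover_le c c"
  using bonding_eqI(1)[of c c id] by simp

lemma cover_le_trans:
  assumes c: "c \<in> C" and d: "d \<in> C" and e: "e \<in> C" and le: "cover_le c d" "cover_le d e"
  shows "cover_le c e" "y \<in> cpoints e \<Longrightarrow> bonding_map b c d (bonding_map b d e y) = bonding_map b c e y"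
proof -
  note B = bonding[OF c d le(1)] and B' = bonding[OF d e le(2)]
  let ?h = "bonding_map b c d \<circ> bonding_map b d e"
  have h: "continuous_map (cspace e) (cspace c) ?h"
    using B'(1) B(1) by (rule continuous_map_compose)
  have over: "cmap c (?h y) = cmap e y" if "y \<in> cpoints e" for y
    using B(3)[OF B'(5)[OF that]] B'(3)[OF that] by simp
  have base: "?h (b e) = b c"
    using B(4) B'(4) by simp
  show "cover_le c e" "y \<in> cpoints e \<Longrightarrow> bonding_map b c d (bonding_map b d e y) = bonding_map b c e y"
    using bonding_eqI[OF c e h over base] by simp_all
qed

text \<open>
  A connected piece of the fibre product dominates both covers.
\<close>

lemma directed:
  assumes c: "c \<in> C" and d: "d \<in> C"
  shows "\<exists>e\<in>C. cover_le c e \<and> cover_le d e"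
proof -
  let ?F = "fibre_product (cspace c) (cmap c) (cspace d) (cmap d)"
  have F: "normal_cover ?F X (cmap c \<circ> fst)"
    using normal_cover_fibre_product[OF normal[OF c] normal[OF d] X_facts(4)] .
  have "(b c, b d) \<in> topspace ?F"
    using basepoint[OF c] basepoint[OF d] cmap_basepoint[OF c d] by (simp add: topspace_fibre_product)
  then obtain K where K: "K \<subseteq> topspace ?F" "continuum (subtopology ?F K)"
      "normal_cover (subtopology ?F K) X (cmap c \<circ> fst)"
    using normal_cover_connected_piece[OF F X_facts(2,4)] by metis
  obtain e h where e: "e \<in> C" "homeomorphic_map (subtopology ?F K) (cspace e) h"
      "\<forall>z\<in>topspace (subtopology ?F K). cmap e (h z) = (cmap c \<circ> fst) z"
    using representative[OF K(3,2)] by blast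
  obtain k where k: "homeomorphic_maps (subtopology ?F K) (cspace e) h k"
    using e(2) homeomorphic_map_maps by blast
  have kc: "continuous_map (cspace e) ?F k"
    using k by (auto simp: homeomorphic_maps_def continuous_map_in_subtopology)
  have kK: "k y \<in> topspace (subtopology ?F K)" "h (k y) = y" if "y \<in> cpoints e" for y
    using k that continuous_map_image_subset_topspace[of "cspace e" "subtopology ?F K" k]
    unfolding homeomorphic_maps_def by blast+
  have over1: "cmap c ((fst \<circ> k) y) = cmap e y" if "y \<in> cpoints e" for y
    using e(3) kK[OF that] by force
  have over2: "cmap d ((snd \<circ> k) y) = cmap e y" if "y \<in> cpoints e" for y
    using over1[OF that] kK(1)[OF that] by (auto simp: topspace_fibre_product)
  have "cover_morphism c e (fst \<circ> k)"
    using continuous_map_compose[OF kc continuous_map_fibre_product_fst] over1 by (rule cover_morphismI[OF c e(1)])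
  moreover have "cover_morphism d e (snd \<circ> k)"
    using continuous_map_compose[OF kc continuous_map_fibre_product_snd] over2 by (rule cover_morphismI[OF d e(1)])
  ultimately show ?thesis
    using e(1) unfolding cover_le_def by blast
qed

lemma ex1_bonding_hom:
  assumes c: "c \<in> C" and d: "d \<in> C" and le: "cover_le c d" and g: "g \<in> cdeck d"
  shows "\<exists>!k. k \<in> cdeck c \<and> (\<forall>y\<in>cpoints d. k (bonding_map b c d y) = bonding_map b c d (g y))"
proof -
  note B = bonding[OF c d le]
  have 1: "continuous_map (cspace d) (cspace c) (bonding_map b c d \<circ> g)"
    using homeomorphic_imp_continuous_map[OF deck(1)[OF d g]] B(1) by (rule continuous_map_compose)
  have 2: "cmap c (bonding_map b c d y) = cmap c ((bonding_map b c d \<circ> g) y)" if "y \<in> cpoints d" for y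
    using B(3)[OF that] B(3)[OF deck(3)[OF d g that]] deck(4)[OF d g that] by simp
  show ?thesis
    using lifts_differ_by_deck[OF regular[OF c] continuum_cspace[OF c] cspace_facts(2)[OF d]
        basepoint[OF d] B(1) 1 2] by simp
qed

lemma bonding_hom:
  assumes "c \<in> C" "d \<in> C" "cover_le c d" "g \<in> cdeck d"
  shows "bonding_hom b c d g \<in> cdeck c"
    "y \<in> cpoints d \<Longrightarrow> bonding_hom b c d g (bonding_map b c d y) = bonding_map b c d (g y)"
  using theI'[OF ex1_bonding_hom[OF assms]] unfolding bonding_hom_def by blast+

lemma bonding_hom_eqI:
  assumes c: "c \<in> C" and d: "d \<in> C" and le: "cover_le c d" and g: "g \<in> cdeck d" and k: "k \<in> cdeck c"
    and y: "y \<in> cpoints d" "k (bonding_map b c d y) = bonding_map b c d (g y)"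
  shows "bonding_hom b c d g = k"
  using deck(6)[OF c bonding_hom(1)[OF c d le g] k bonding(5)[OF c d le y(1)]]
    bonding_hom(2)[OF c d le g y(1)] y(2) by simp

section \<open>The compact universal cover\<close>

abbreviation Xhat :: "('a cover \<Rightarrow> real) topology" where
  "Xhat \<equiv> compact_universal_cover C b"

abbreviation cover_product :: "('a cover \<Rightarrow> real) topology" where
  "cover_product \<equiv> product_topology cspace C"

lemma topspace_Xhat:
  "x \<in> topspace Xhat \<longleftrightarrow> x \<in> PiE C cpoints \<and>
     (\<forall>c\<in>C. \<forall>d\<in>C. cover_le c d \<longrightarrow> bonding_map b c d (x d) = x c)"
  unfolding compact_universal_cover_def by auto

lemma XhatD:
  assumes "x \<in> topspace Xhat"
  shows "c \<in> C \<Longrightarrow> x c \<in> cpoints c" "x \<in> extensional C"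
    "c \<in> C \<Longrightarrow> d \<in> C \<Longrightarrow> cover_le c d \<Longrightarrow> bonding_map b c d (x d) = x c"
  using assms unfolding topspace_Xhat by (auto simp: PiE_iff)

lemma compact_cover_product: "compact_space cover_product"
  and metrizable_cover_product: "metrizable_space cover_product"
proof -
  show "compact_space cover_product"
    using cspace_facts(1) by (simp add: compact_space_product_topology)
  show "metrizable_space cover_product"
    using cspace_facts(3) countable_C countable_subset[of _ C]
    by (auto simp: metrizable_space_product_topology)
qed

lemma continuous_map_coordinate: "c \<in> C \<Longrightarrow> continuous_map cover_product (cspace c) (\<lambda>x. x c)"
  by (rule continuous_map_product_projection)

lemma closedin_bonding:
  assumes "c \<in> C" "d \<in> C" "cover_le c d"
  shows "closedin cover_product {x \<in> topspace cover_product. bonding_map b c d (x d) = x c}"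
proof (rule closedin_continuous_maps_eq[OF cspace_facts(4)[OF assms(1)]])
  show "continuous_map cover_product (cspace c) (\<lambda>x. bonding_map b c d (x d))"
    using continuous_map_compose[OF continuous_map_coordinate[OF assms(2)] bonding(1)[OF assms]]
    by (simp add: o_def)
qed (rule continuous_map_coordinate[OF assms(1)])

lemma compact_Xhat: "compact_space Xhat" and metrizable_Xhat: "metrizable_space Xhat"
proof -
  let ?F = "\<lambda>(c, d). {x \<in> topspace cover_product. bonding_map b c d (x d) = x c}"
  let ?I = "{(c, d). c \<in> C \<and> d \<in> C \<and> cover_le c d}"
  obtain c where c: "c \<in> C"
    using C_nonempty by blast
  have "(c, c) \<in> ?I"
    using c cover_le_refl by simp
  then have "closedin cover_product (\<Inter>p\<in>?I. ?F p)"
    using closedin_bonding by (intro closedin_Inter) auto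
  then have "compactin cover_product (\<Inter>p\<in>?I. ?F p)"
    using compact_cover_product closedin_compact_space by blast
  moreover have "(\<Inter>p\<in>?I. ?F p) = topspace cover_product \<inter>
      {x. \<forall>c\<in>C. \<forall>d\<in>C. cover_le c d \<longrightarrow> bonding_map b c d (x d) = x c}"
    using c cover_le_refl by auto
  ultimately have "compact_space (subtopology cover_product (topspace cover_product \<inter>
      {x. \<forall>c\<in>C. \<forall>d\<in>C. cover_le c d \<longrightarrow> bonding_map b c d (x d) = x c}))"
    by (simp only: compact_space_subtopology)
  then show "compact_space Xhat"
    unfolding compact_universal_cover_def by (simp only: subtopology_restrict)
  show "metrizable_space Xhat"
    unfolding compact_universal_cover_def using metrizable_cover_product by (rule metrizable_space_subtopology)
qed

lemma continuous_map_Xhat_coordinate: "c \<in> C \<Longrightarrow> continuous_map Xhat (cspace c) (\<lambda>x. x c)"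
  unfolding compact_universal_cover_def
  by (intro continuous_map_from_subtopology continuous_map_coordinate)

lemma continuous_map_into_Xhat:
  assumes h: "\<And>c. c \<in> C \<Longrightarrow> continuous_map Y (cspace c) (h c)"
    and comp: "\<And>c d y. \<lbrakk>c \<in> C; d \<in> C; cover_le c d; y \<in> topspace Y\<rbrakk> \<Longrightarrow> bonding_map b c d (h d y) = h c y"
  shows "continuous_map Y Xhat (\<lambda>y. \<lambda>c\<in>C. h c y)"
proof -
  have "continuous_map Y cover_product (\<lambda>y. \<lambda>c\<in>C. h c y)"
    using h by (auto simp: continuous_map_componentwise)
  then show ?thesis
    unfolding compact_universal_cover_def continuous_map_in_subtopology using comp by auto
qed

text \<open>
  For \<open>d\<close> above \<open>c\<close> consider the points of the product that have \<open>c\<close>-th coordinate \<open>z\<close> and are compatible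
  below \<open>d\<close>. These sets are closed, nonempty and decreasing in \<open>d\<close>; their common points lie in \<open>Xhat\<close>.
\<close>

lemma Xhat_coordinate_surjective:
  assumes c: "c \<in> C" and z: "z \<in> cpoints c"
  shows "\<exists>x\<in>topspace Xhat. x c = z"
proof -
  let ?I = "{d \<in> C. cover_le c d}"
  define P where "P d = {(c', d'). c' \<in> C \<and> d' \<in> C \<and> cover_le d' d \<and> cover_le c' d'}" for d
  define A where "A d = {x \<in> topspace cover_product. x c = z} \<inter>
      (\<Inter>(c', d')\<in>P d. {x \<in> topspace cover_product. bonding_map b c' d' (x d') = x c'})" for d
  have cI: "c \<in> ?I"
    using c cover_le_refl by simp
  have "\<exists>x\<in>topspace cover_product. \<forall>d\<in>?I. x \<in> A d"
  proof (rule directed_closed_family_meets[OF compact_cover_product])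
    show "?I \<noteq> {}"
      using cI by blast
    fix d assume d: "d \<in> ?I"
    have dC: "d \<in> C" and le: "cover_le c d"
      using d by simp_all
    have Pd: "(d, d) \<in> P d"
      using d cover_le_refl by (simp add: P_def)
    have "closedin cover_product {x \<in> topspace cover_product. x c \<in> {z}}"
      using continuous_map_coordinate[OF c] closedin_Hausdorff_singleton[OF cspace_facts(4)[OF c] z]
      by (rule closedin_continuous_map_preimage)
    moreover have "closedin cover_product
        (\<Inter>(c', d')\<in>P d. {x \<in> topspace cover_product. bonding_map b c' d' (x d') = x c'})"
      using Pd closedin_bonding by (intro closedin_Inter) (auto simp: P_def)
    ultimately show "closedin cover_product (A d)"
      unfolding A_def by (simp add: closedin_Int)
    have "z \<in> bonding_map b c d ` cpoints d"
      using bonding(2)[OF c dC le] z by simp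
    then obtain w where w: "w \<in> cpoints d" "z = bonding_map b c d w"
      by (elim imageE)
    let ?x = "\<lambda>e\<in>C. if cover_le e d then bonding_map b e d w else b e"
    have "?x \<in> topspace cover_product"
      using bonding(5) dC w(1) basepoint by auto
    moreover have "?x c = z"
      using c le w(2) by simp
    moreover have "bonding_map b c' d' (?x d') = ?x c'" if "(c', d') \<in> P d" for c' d'
    proof -
      have cd: "c' \<in> C" "d' \<in> C" "cover_le d' d" "cover_le c' d'"
        using that by (simp_all add: P_def)
      show ?thesis
        using cover_le_trans[OF cd(1,2) dC cd(4,3)] cd w(1) by simp
    qed
    ultimately have "?x \<in> A d"
      unfolding A_def by blast
    then show "A d \<noteq> {}"
      by blast
  next
    fix d e assume de: "d \<in> ?I" "e \<in> ?I"
    then obtain m where m: "m \<in> C" "cover_le d m" "cover_le e m"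
      using directed by blast
    have "cover_le c m"
      using cover_le_trans(1)[OF c _ m(1) _ m(2)] de by blast
    moreover have "P d \<subseteq> P m" "P e \<subseteq> P m"
      using cover_le_trans(1)[of _ _ m] m de by (auto simp: P_def)
    then have "A m \<subseteq> A d \<inter> A e"
      unfolding A_def by blast
    ultimately show "\<exists>m\<in>?I. A m \<subseteq> A d \<inter> A e"
      using m(1) by blast
  qed
  then obtain x where x: "x \<in> topspace cover_product" "\<And>d. d \<in> ?I \<Longrightarrow> x \<in> A d"
    by blast
  have "bonding_map b c' d' (x d') = x c'" if cd: "c' \<in> C" "d' \<in> C" "cover_le c' d'" for c' d'
  proof -
    obtain m where m: "m \<in> C" "cover_le c m" "cover_le d' m"
      using directed[OF c cd(2)] by blast
    have "(c', d') \<in> P m"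
      using cd m by (simp add: P_def)
    moreover have "x \<in> A m"
      using x(2) m by simp
    ultimately show ?thesis
      unfolding A_def by blast
  qed
  then have "x \<in> topspace Xhat"
    using x(1) unfolding topspace_Xhat by simp
  moreover have "x c = z"
    using x(2)[OF cI] by (simp add: A_def)
  ultimately show ?thesis
    by blast
qed

text \<open>
  The pairs outside a neighbourhood of the diagonal with equal \<open>c\<close>-th coordinates form closed sets
  that decrease with \<open>c\<close> and have no common point, so one of them is empty.
\<close>

lemma Xhat_level:
  assumes N: "openin (prod_topology Xhat Xhat) N" "\<And>x. x \<in> topspace Xhat \<Longrightarrow> (x, x) \<in> N"
  shows "\<exists>c\<in>C. \<forall>x\<in>topspace Xhat. \<forall>y\<in>topspace Xhat. x c = y c \<longrightarrow> (x, y) \<in> N"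
proof (rule ccontr)
  assume neg: "\<not> ?thesis"
  let ?K = "prod_topology Xhat Xhat"
  define A where "A c = (topspace ?K - N) \<inter> {p \<in> topspace ?K. fst p c = snd p c}" for c
  have "\<exists>p\<in>topspace ?K. \<forall>c\<in>C. p \<in> A c"
  proof (rule directed_closed_family_meets)
    show "compact_space ?K"
      using compact_Xhat by (simp add: compact_space_prod_topology)
    show "C \<noteq> {}"
      by (rule C_nonempty)
    fix c assume c: "c \<in> C"
    have "closedin ?K {p \<in> topspace ?K. ((\<lambda>x. x c) \<circ> fst) p = ((\<lambda>x. x c) \<circ> snd) p}"
      by (intro closedin_continuous_maps_eq[OF cspace_facts(4)[OF c]]
          continuous_map_compose[OF continuous_map_fst continuous_map_Xhat_coordinate[OF c]]
          continuous_map_compose[OF continuous_map_snd continuous_map_Xhat_coordinate[OF c]])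
    then show "closedin ?K (A c)"
      unfolding A_def using N(1) by (intro closedin_Int closedin_diff closedin_topspace) simp_all
    obtain x y where "x \<in> topspace Xhat" "y \<in> topspace Xhat" "x c = y c" "(x, y) \<notin> N"
      using neg c by blast
    then have "(x, y) \<in> A c"
      by (simp add: A_def)
    then show "A c \<noteq> {}"
      by blast
  next
    fix c d assume cd: "c \<in> C" "d \<in> C"
    then obtain e where e: "e \<in> C" "cover_le c e" "cover_le d e"
      using directed by blast
    have "x c = y c" "x d = y d" if "x \<in> topspace Xhat" "y \<in> topspace Xhat" "x e = y e" for x y
      using XhatD(3)[OF that(1)] XhatD(3)[OF that(2)] that(3) cd e by metis+
    then have "A e \<subseteq> A c \<inter> A d"
      by (auto simp: A_def)
    then show "\<exists>e\<in>C. A e \<subseteq> A c \<inter> A d"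
      using e(1) by blast
  qed
  then obtain x y where xy: "x \<in> topspace Xhat" "y \<in> topspace Xhat" "\<And>c. c \<in> C \<Longrightarrow> (x, y) \<in> A c"
    by auto
  have "x c = y c" if "c \<in> C" for c
    using xy(3)[OF that] by (simp add: A_def)
  then have "x = y"
    using XhatD(2)[OF xy(1)] XhatD(2)[OF xy(2)] by (rule extensionalityI[rotated 2])
  then show False
    using N(2)[OF xy(1)] xy(3) C_nonempty by (auto simp: A_def)
qed

text \<open>
  A clopen set of \<open>Xhat\<close> is a union of fibres of a single coordinate, so it gives a clopen set of
  \<open>cspace c\<close> for some \<open>c\<close>.
\<close>

lemma continuum_Xhat: "continuum Xhat"
proof -
  have "connected_space Xhat"
    unfolding connected_space_clopen_in
  proof (intro allI impI)
    fix T assume T: "openin Xhat T \<and> closedin Xhat T"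
    let ?T' = "topspace Xhat - T"
    let ?N = "T \<times> T \<union> ?T' \<times> ?T'"
    have T': "openin Xhat ?T'" "closedin Xhat ?T'"
      using T by (auto intro: openin_diff closedin_diff)
    have "openin (prod_topology Xhat Xhat) ?N"
      using T T' by (intro openin_Un) (simp_all add: openin_prod_Times_iff)
    moreover have "(x, x) \<in> ?N" if "x \<in> topspace Xhat" for x
      using that by blast
    ultimately obtain c where c: "c \<in> C"
        "\<forall>x\<in>topspace Xhat. \<forall>y\<in>topspace Xhat. x c = y c \<longrightarrow> (x, y) \<in> ?N"
      using Xhat_level by meson
    let ?p = "\<lambda>x :: 'a cover \<Rightarrow> real. x c"
    have "closed_map Xhat (cspace c) ?p"
      using continuous_map_Xhat_coordinate[OF c(1)] compact_Xhat cspace_facts(4)[OF c(1)]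
      by (rule continuous_imp_closed_map)
    then have cl: "closedin (cspace c) (?p ` T)" "closedin (cspace c) (?p ` ?T')"
      using T T' unfolding closed_map_def by blast+
    have Tsub: "T \<subseteq> topspace Xhat"
      using T openin_subset by blast
    have "cpoints c \<subseteq> ?p ` T \<union> ?p ` ?T'"
    proof
      fix z assume "z \<in> cpoints c"
      then obtain x where "x \<in> topspace Xhat" "x c = z"
        using Xhat_coordinate_surjective[OF c(1)] by blast
      then show "z \<in> ?p ` T \<union> ?p ` ?T'"
        by blast
    qed
    then have cov: "?p ` T \<union> ?p ` ?T' = cpoints c"
      using XhatD(1)[OF _ c(1)] Tsub by auto
    have disj: "?p ` T \<inter> ?p ` ?T' = {}"
    proof (rule ccontr)
      assume "?p ` T \<inter> ?p ` ?T' \<noteq> {}"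
      then obtain x y where xy: "x \<in> T" "y \<in> ?T'" "x c = y c"
        by auto
      then have "(x, y) \<in> ?N"
        using c(2) Tsub by blast
      then show False
        using xy by blast
    qed
    have "?p ` T = {} \<or> ?p ` ?T' = {}"
      using cspace_facts(2)[OF c(1)] cl cov disj unfolding connected_space_closedin_eq by blast
    then show "T = {} \<or> T = topspace Xhat"
      using Tsub by blast
  qed
  moreover have "topspace Xhat \<noteq> {}"
    using C_nonempty basepoint Xhat_coordinate_surjective by blast
  ultimately show ?thesis
    unfolding continuum_def using compact_Xhat metrizable_Xhat by blast
qed

lemma universal_projection:
  assumes x: "x \<in> topspace Xhat" and c: "c \<in> C"
  shows "universal_projection C x = cmap c (x c)"
proof -
  have eq: "cmap d (x d) = cmap c (x c)" if d: "d \<in> C" for d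
  proof -
    obtain e where e: "e \<in> C" "cover_le c e" "cover_le d e"
      using directed[OF c d] by blast
    show ?thesis
      using bonding(3)[OF c e(1,2) XhatD(1)[OF x e(1)]] bonding(3)[OF d e(1,3) XhatD(1)[OF x e(1)]]
        XhatD(3)[OF x c e(1,2)] XhatD(3)[OF x d e(1,3)] by simp
  qed
  show ?thesis
    unfolding universal_projection_def
  proof (rule the_equality)
    show "\<forall>d\<in>C. cmap d (x d) = cmap c (x c)"
      using eq by blast
    show "p = cmap c (x c)" if "\<forall>d\<in>C. cmap d (x d) = p" for p
      using that c by simp
  qed
qed

section \<open>The profinite fundamental group\<close>

abbreviation piP :: "('a cover \<Rightarrow> real \<Rightarrow> real) monoid" where
  "piP \<equiv> profinite_fundamental_group C b"

lemma carrier_piP: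
  "\<gamma> \<in> carrier piP \<longleftrightarrow> \<gamma> \<in> PiE C cdeck \<and>
     (\<forall>c\<in>C. \<forall>d\<in>C. cover_le c d \<longrightarrow> bonding_hom b c d (\<gamma> d) = \<gamma> c)"
  unfolding profinite_fundamental_group_def by (auto simp: carrier_product_group)

lemma piPD:
  assumes "\<gamma> \<in> carrier piP"
  shows "c \<in> C \<Longrightarrow> \<gamma> c \<in> cdeck c" "\<gamma> \<in> extensional C"
    "c \<in> C \<Longrightarrow> d \<in> C \<Longrightarrow> cover_le c d \<Longrightarrow> bonding_hom b c d (\<gamma> d) = \<gamma> c"
  using assms unfolding carrier_piP by (auto simp: PiE_iff)

lemma mult_piP: "\<gamma> \<otimes>\<^bsub>piP\<^esub> \<delta> = (\<lambda>c\<in>C. \<gamma> c \<otimes>\<^bsub>cgroup c\<^esub> \<delta> c)"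
  unfolding profinite_fundamental_group_def product_group_def by simp

lemma one_piP: "\<one>\<^bsub>piP\<^esub> = (\<lambda>c\<in>C. \<one>\<^bsub>BijGroup (cpoints c)\<^esub>)"
  unfolding profinite_fundamental_group_def product_group_def by simp

lemma action_in_Xhat:
  assumes g: "\<gamma> \<in> carrier piP" and x: "x \<in> topspace Xhat"
  shows "coordinatewise_action C \<gamma> x \<in> topspace Xhat"
proof -
  have "\<gamma> c (x c) \<in> cpoints c" if "c \<in> C" for c
    using deck(3)[OF that piPD(1)[OF g that] XhatD(1)[OF x that]] .
  moreover have "bonding_map b c d (\<gamma> d (x d)) = \<gamma> c (x c)" if cd: "c \<in> C" "d \<in> C" "cover_le c d" for c d
    using bonding_hom(2)[OF cd piPD(1)[OF g cd(2)] XhatD(1)[OF x cd(2)]]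
      piPD(3)[OF g cd] XhatD(3)[OF x cd] by simp
  ultimately show ?thesis
    unfolding topspace_Xhat coordinatewise_action_def by simp
qed

lemma piP_eqI:
  assumes g: "\<gamma> \<in> carrier piP" "\<delta> \<in> carrier piP" and x: "\<And>c. c \<in> C \<Longrightarrow> x c \<in> cpoints c"
    and eq: "\<And>c. c \<in> C \<Longrightarrow> \<gamma> c (x c) = \<delta> c (x c)"
  shows "\<gamma> = \<delta>"
proof (rule extensionalityI[OF piPD(2)[OF g(1)] piPD(2)[OF g(2)]])
  fix c assume c: "c \<in> C"
  show "\<gamma> c = \<delta> c"
    using deck(6)[OF c piPD(1)[OF g(1) c] piPD(1)[OF g(2) c] x[OF c] eq[OF c]] .
qed

text \<open>
  The coordinates of the two points are joined by unique deck transformations, and uniqueness makes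
  them compatible with the bonding homomorphisms.
\<close>

lemma piP_transitive:
  assumes x: "x \<in> topspace Xhat" and y: "y \<in> topspace Xhat"
    and eq: "universal_projection C x = universal_projection C y"
  shows "\<exists>\<gamma>\<in>carrier piP. \<forall>c\<in>C. \<gamma> c (x c) = y c"
proof -
  have "\<forall>c\<in>C. \<exists>g\<in>cdeck c. g (x c) = y c"
  proof
    fix c assume c: "c \<in> C"
    show "\<exists>g\<in>cdeck c. g (x c) = y c"
      using deck(5)[OF c XhatD(1)[OF x c] XhatD(1)[OF y c]] eq
      unfolding universal_projection[OF x c] universal_projection[OF y c] by blast
  qed
  then obtain g where g: "\<And>c. c \<in> C \<Longrightarrow> g c \<in> cdeck c" "\<And>c. c \<in> C \<Longrightarrow> g c (x c) = y c"
    by metis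
  have "bonding_hom b c d (g d) = g c" if cd: "c \<in> C" "d \<in> C" "cover_le c d" for c d
  proof (rule bonding_hom_eqI[OF cd g(1)[OF cd(2)] g(1)[OF cd(1)] XhatD(1)[OF x cd(2)]])
    show "g c (bonding_map b c d (x d)) = bonding_map b c d (g d (x d))"
      using g(2) XhatD(3)[OF x cd] XhatD(3)[OF y cd] cd by simp
  qed
  then have "restrict g C \<in> carrier piP"
    unfolding carrier_piP using g(1) by simp
  then show ?thesis
    using g(2) by (intro bexI[of _ "restrict g C"]) simp_all
qed

text \<open>
  Two points of a fibre of \<open>cmap c\<close> are coordinates of points of \<open>Xhat\<close> in the same fibre over \<open>X\<close>, and
  these are joined by an element of \<open>piP\<close>.
\<close>

lemma trivial_piP_imp_inj:
  assumes triv: "carrier piP = {\<one>\<^bsub>piP\<^esub>}" and c: "c \<in> C"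
  shows "inj_on (cmap c) (cpoints c)"
proof (rule inj_onI)
  fix z z' assume z: "z \<in> cpoints c" "z' \<in> cpoints c" "cmap c z = cmap c z'"
  obtain x where x: "x \<in> topspace Xhat" "x c = z"
    using Xhat_coordinate_surjective[OF c z(1)] by blast
  obtain y where y: "y \<in> topspace Xhat" "y c = z'"
    using Xhat_coordinate_surjective[OF c z(2)] by blast
  have "universal_projection C x = universal_projection C y"
    using universal_projection[OF x(1) c] universal_projection[OF y(1) c] x(2) y(2) z(3) by simp
  then obtain \<gamma> where g: "\<gamma> \<in> carrier piP" "\<gamma> c z = z'"
    using piP_transitive[OF x(1) y(1)] c x(2) y(2) by blast
  then have "\<gamma> = \<one>\<^bsub>piP\<^esub>"
    using triv by blast
  then have "\<gamma> c = \<one>\<^bsub>BijGroup (cpoints c)\<^esub>"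
    using c by (simp add: one_piP)
  then show "z = z'"
    using g(2) z(1) by (simp add: BijGroup_def)
qed

lemma inj_imp_trivial_piP:
  assumes inj: "\<And>c. c \<in> C \<Longrightarrow> inj_on (cmap c) (cpoints c)"
  shows "carrier piP = {\<one>\<^bsub>piP\<^esub>}"
proof -
  have one: "\<one>\<^bsub>BijGroup (cpoints c)\<^esub> \<in> cdeck c" if "c \<in> C" for c
    using regular[OF that] unfolding regular_covering_map_def by (blast intro: subgroup.one_closed)
  have triv: "g = \<one>\<^bsub>BijGroup (cpoints c)\<^esub>" if c: "c \<in> C" and g: "g \<in> cdeck c" for c g
  proof (rule deck(6)[OF c g one[OF c] basepoint[OF c]])
    have "g (b c) = b c"
      using inj_onD[OF inj[OF c] deck(4)[OF c g basepoint[OF c]] deck(3)[OF c g basepoint[OF c]] basepoint[OF c]] .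
    then show "g (b c) = \<one>\<^bsub>BijGroup (cpoints c)\<^esub> (b c)"
      using basepoint[OF c] by (simp add: BijGroup_def)
  qed
  have "bonding_hom b c d \<one>\<^bsub>BijGroup (cpoints d)\<^esub> = \<one>\<^bsub>BijGroup (cpoints c)\<^esub>"
    if "c \<in> C" "d \<in> C" "cover_le c d" for c d
    using triv[OF that(1) bonding_hom(1)[OF that one[OF that(2)]]] .
  then have "\<one>\<^bsub>piP\<^esub> \<in> carrier piP"
    unfolding carrier_piP one_piP using one by simp
  moreover have "\<gamma> = \<one>\<^bsub>piP\<^esub>" if g: "\<gamma> \<in> carrier piP" for \<gamma>
  proof (rule extensionalityI[OF piPD(2)[OF g]])
    show "\<one>\<^bsub>piP\<^esub> \<in> extensional C"
      by (simp add: one_piP)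
    show "\<gamma> c = \<one>\<^bsub>piP\<^esub> c" if "c \<in> C" for c
      using triv[OF that piPD(1)[OF g that]] that by (simp add: one_piP)
  qed
  ultimately show ?thesis
    by blast
qed

end

section \<open>Compactly simply connected continua\<close>

lemma compactly_simply_connected_iff:
  assumes Z: "continuum Z"
  shows "compactly_simply_connected Z \<longleftrightarrow>
    (\<forall>c. cover_by_continuum Z c \<longrightarrow> inj_on (cmap c) (cpoints c))"
proof
  assume csc: "compactly_simply_connected Z"
  obtain C b where Cb: "pointed_cover_system Z C b"
    using pointed_cover_system_exists[OF Z] by blast
  then interpret cover_system Z C b
    using Z by unfold_locales
  have triv: "carrier piP = {\<one>\<^bsub>piP\<^esub>}"
    using csc Cb unfolding compactly_simply_connected_def by blast
  show "\<forall>c. cover_by_continuum Z c \<longrightarrow> inj_on (cmap c) (cpoints c)"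
  proof (intro allI impI)
    fix d assume d: "cover_by_continuum Z d"
    obtain c where c: "c \<in> C" "equivalent_covers d c"
      using ex1_representative[OF d] by blast
    obtain h where h: "homeomorphic_map (cspace d) (cspace c) h" "\<forall>y\<in>cpoints d. cmap c (h y) = cmap d y"
      using c equivalent_covers_iff_homeomorphic[OF d cover[OF c(1)]] by blast
    show "inj_on (cmap d) (cpoints d)"
    proof (rule inj_onI)
      fix y z assume yz: "y \<in> cpoints d" "z \<in> cpoints d" "cmap d y = cmap d z"
      then have "h y = h z"
        using inj_onD[OF trivial_piP_imp_inj[OF triv c(1)], of "h y" "h z"] h
          homeomorphic_map_in_topspace[OF h(1)] by simp
      then show "y = z"
        using homeomorphic_imp_injective_map[OF h(1)] yz by (auto dest: inj_onD)
    qed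
  qed
next
  assume inj: "\<forall>c. cover_by_continuum Z c \<longrightarrow> inj_on (cmap c) (cpoints c)"
  show "compactly_simply_connected Z"
    unfolding compactly_simply_connected_def
  proof (intro conjI allI impI Z)
    fix C b assume "pointed_cover_system Z C b"
    then interpret cover_system Z C b
      using Z by unfold_locales
    show "carrier (profinite_fundamental_group C b) = {\<one>\<^bsub>profinite_fundamental_group C b\<^esub>}"
      using inj cover by (intro inj_imp_trivial_piP) blast
  qed
qed

lemma compactly_simply_connected_normal_cover_inj:
  assumes Y: "compactly_simply_connected Y" and K: "normal_cover K Y p" "continuum K"
  shows "inj_on p (topspace K)"
proof (rule inj_onI)
  have cY: "continuum Y"
    using Y by (simp add: compactly_simply_connected_def)
  obtain c h where c: "cover_by_continuum Y c" "homeomorphic_map K (cspace c) h"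
      "\<forall>z\<in>topspace K. cmap c (h z) = p z"
    using real_copy_of_cover[OF K continuumD(4)[OF cY]] by blast
  have inj: "inj_on (cmap c) (cpoints c)"
    using compactly_simply_connected_iff[OF cY] Y c(1) by blast
  fix y z assume yz: "y \<in> topspace K" "z \<in> topspace K" "p y = p z"
  then have "h y = h z"
    using inj_onD[OF inj, of "h y" "h z"] c(3) homeomorphic_map_in_topspace[OF c(2)] by simp
  then show "y = z"
    using homeomorphic_imp_injective_map[OF c(2)] yz by (auto dest: inj_onD)
qed

text \<open>
  The pullback of the normal cover along \<open>f\<close> has a connected clopen piece through any given point. As
  \<open>Y\<close> has only trivial covers by continua, this piece is the graph of a lift.
\<close>

lemma compactly_simply_connected_lift:
  assumes Y: "compactly_simply_connected Y" and f: "continuous_map Y X f" and X: "Hausdorff_space X"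
    and Z: "normal_cover Z X q" and y0: "y0 \<in> topspace Y" and z0: "z0 \<in> topspace Z" "f y0 = q z0"
  shows "\<exists>h. continuous_map Y Z h \<and> h y0 = z0 \<and> (\<forall>y\<in>topspace Y. q (h y) = f y)"
proof -
  have cY: "continuum Y"
    using Y by (simp add: compactly_simply_connected_def)
  note Y' = continuumD[OF cY]
  let ?F = "fibre_product Y f Z q"
  have F: "normal_cover ?F Y fst"
    using normal_cover_pullback[OF Y'(1,3) f Z X] .
  have "(y0, z0) \<in> topspace ?F"
    using y0 z0 by (simp add: topspace_fibre_product)
  then obtain K where K: "(y0, z0) \<in> K" "K \<subseteq> topspace ?F" "continuum (subtopology ?F K)"
      "normal_cover (subtopology ?F K) Y fst"
    using normal_cover_connected_piece[OF F Y'(2,4)] by metis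
  have top: "topspace (subtopology ?F K) = K"
    using K(2) by (rule topspace_subtopology_subset)
  have "homeomorphic_map (subtopology ?F K) Y fst"
    using normal_coverD[OF K(4)] Y'(4) compactly_simply_connected_normal_cover_inj[OF Y K(4,3)]
    by (intro continuous_imp_homeomorphic_map)
  then obtain s where s: "homeomorphic_maps (subtopology ?F K) Y fst s"
    using homeomorphic_map_maps by blast
  have sc: "continuous_map Y ?F s" and fs: "\<And>y. y \<in> topspace Y \<Longrightarrow> fst (s y) = y"
    and sf: "\<And>p. p \<in> K \<Longrightarrow> s (fst p) = p"
    using s top by (auto simp: homeomorphic_maps_def continuous_map_in_subtopology)
  have "q (snd (s y)) = f y" if "y \<in> topspace Y" for y
    using continuous_map_image_subset_topspace[OF sc] that fs[OF that]
    by (force simp: topspace_fibre_product)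
  moreover have "snd (s y0) = z0"
    using sf[OF K(1)] by simp
  moreover have "continuous_map Y Z (snd \<circ> s)"
    using sc continuous_map_fibre_product_snd by (rule continuous_map_compose)
  ultimately show ?thesis
    by (intro exI[of _ "snd \<circ> s"]) simp
qed

section \<open>Prodiscrete actions on continua\<close>

locale prodiscrete_action =
  fixes Y :: "'b topology" and G :: "('b \<Rightarrow> 'b) set" and f :: "'b \<Rightarrow> 'a" and X :: "'a topology"
  assumes Y: "continuum Y" and X: "continuum X"
    and gen: "generalized_regular_covering_map
      (topspace Y) (compact_uniformity Y) G f (topspace X) (compact_uniformity X)"
begin

abbreviation GG :: "('b \<Rightarrow> 'b) monoid" where
  "GG \<equiv> bij_subgroup (topspace Y) G"

lemmas Y_facts = continuumD[OF Y] and X_facts = continuumD[OF X]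

lemma compatible: "compatible_uniformity Y (compact_uniformity Y)"
  using Y by (rule compatible_compact_uniformity)

lemma uniformity: "uniformity_on (topspace Y) (compact_uniformity Y)"
  using compatible by (simp add: compatible_uniformity_def)

lemmas entourage = uniformityD[OF uniformity]

lemma subgroup_G: "subgroup G (BijGroup (topspace Y))"
  and isomorphic: "acts_isomorphically (compact_uniformity Y) G"
  and prodiscrete: "acts_prodiscretely (topspace Y) (compact_uniformity Y) G"
  and orbit: "orbit_map (topspace Y) G f (topspace X)"
  and quotient_uniformity: "compact_uniformity X = (\<lambda>E. map_prod f f ` E) ` compact_uniformity Y"
  using gen unfolding generalized_regular_covering_map_def by - (elim conjE, assumption)+

lemma group_GG: "group GG"
  using subgroup_G group_BijGroup by (rule subgroup.subgroup_is_group)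

lemma G_Bij: "g \<in> G \<Longrightarrow> g \<in> Bij (topspace Y)"
  using subgroup.subset[OF subgroup_G] by (auto simp: BijGroup_def)

lemma G_closed: "g \<in> G \<Longrightarrow> y \<in> topspace Y \<Longrightarrow> g y \<in> topspace Y"
  using Bij_imp_funcset[OF G_Bij] by blast

lemmas one_G = bij_subgroup_apply(1)[OF subgroup_G]
  and one_apply = bij_subgroup_apply(2)[OF subgroup_G]
  and mult_G = bij_subgroup_apply(3)[OF subgroup_G]
  and mult_apply = bij_subgroup_apply(4)[OF subgroup_G]
  and inv_G = bij_subgroup_apply(5)[OF subgroup_G]
  and inv_apply = bij_subgroup_apply(8,9)[OF subgroup_G]

lemma orbit_eq: "y \<in> topspace Y \<Longrightarrow> y' \<in> topspace Y \<Longrightarrow> f y = f y' \<longleftrightarrow> (\<exists>g\<in>G. g y = y')"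
  using orbit unfolding orbit_map_def by blast

lemma f_surj: "f ` topspace Y = topspace X"
  using orbit unfolding orbit_map_def by blast

lemma f_invariant: "g \<in> G \<Longrightarrow> y \<in> topspace Y \<Longrightarrow> f (g y) = f y"
  using orbit_eq[of y "g y"] G_closed by metis

definition invariant :: "('b \<times> 'b) set \<Rightarrow> bool" where
  "invariant F \<longleftrightarrow> F \<in> compact_uniformity Y \<and> (\<forall>g\<in>G. \<forall>x y. (x, y) \<in> F \<longrightarrow> (g x, g y) \<in> F)"

lemma invariant_basis:
  assumes "E \<in> compact_uniformity Y"
  shows "\<exists>F. invariant F \<and> F \<subseteq> E"
proof -
  obtain F where F: "F \<in> compact_uniformity Y" "F \<subseteq> E" "\<forall>g\<in>G. map_prod g g ` F = F"
    using isomorphic assms unfolding acts_isomorphically_def by blast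
  have "(g x, g y) \<in> F" if "g \<in> G" "(x, y) \<in> F" for g x y
    using F(3) that by force
  then show ?thesis
    using F(1,2) unfolding invariant_def by blast
qed

lemma homeomorphic_G:
  assumes g: "g \<in> G"
  shows "homeomorphic_map Y Y g"
proof (rule continuous_imp_homeomorphic_map)
  have bij: "bij_betw g (topspace Y) (topspace Y)"
    using G_Bij[OF g] by (simp add: Bij_def)
  then show "g ` topspace Y = topspace Y" "inj_on g (topspace Y)"
    by (simp_all add: bij_betw_def)
  have "uniformly_continuous_between (topspace Y) (compact_uniformity Y) (compact_uniformity Y) g"
    unfolding uniformly_continuous_between_def
  proof
    fix E assume "E \<in> compact_uniformity Y"
    then obtain F where "invariant F" "F \<subseteq> E"
      using invariant_basis by blast
    then show "\<exists>F\<in>compact_uniformity Y. \<forall>x\<in>topspace Y. \<forall>y\<in>topspace Y. (x, y) \<in> F \<longrightarrow> (g x, g y) \<in> E"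
      using g unfolding invariant_def by blast
  qed
  then show "continuous_map Y Y g"
    using uniformly_continuous_imp_continuous[OF Y Y] \<open>g ` topspace Y = topspace Y\<close> by blast
qed (use Y_facts in auto)

lemma continuous_f: "continuous_map Y X f"
proof (rule uniformly_continuous_imp_continuous[OF Y X])
  show "uniformly_continuous_between (topspace Y) (compact_uniformity Y) (compact_uniformity X) f"
    unfolding uniformly_continuous_between_def
  proof
    fix D assume "D \<in> compact_uniformity X"
    then obtain E where E: "E \<in> compact_uniformity Y" "D = map_prod f f ` E"
      unfolding quotient_uniformity by blast
    then have "(f x, f y) \<in> D" if "(x, y) \<in> E" for x y
      using that by force
    then show "\<exists>E\<in>compact_uniformity Y. \<forall>x\<in>topspace Y. \<forall>y\<in>topspace Y. (x, y) \<in> E \<longrightarrow> (f x, f y) \<in> D"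
      using E(1) by blast
  qed
qed (simp add: f_surj)

lemma openin_translates:
  assumes "openin Y U" "H \<subseteq> G"
  shows "openin Y (\<Union>g\<in>H. g ` U)"
  using assms homeomorphic_imp_open_map[OF homeomorphic_G] unfolding open_map_def
  by (intro openin_Union) auto

lemma open_f: "open_map Y X f"
  unfolding open_map_def
proof (intro allI impI)
  fix U assume U: "openin Y U"
  have Usub: "U \<subseteq> topspace Y"
    using U by (rule openin_subset)
  have "{y \<in> topspace Y. f y \<in> f ` U} = (\<Union>g\<in>G. g ` U)"
  proof (intro equalityI subsetI)
    fix y assume "y \<in> {y \<in> topspace Y. f y \<in> f ` U}"
    then obtain u where u: "y \<in> topspace Y" "u \<in> U" "f u = f y"
      by fastforce
    then show "y \<in> (\<Union>g\<in>G. g ` U)"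
      using orbit_eq[of u y] Usub by blast
  next
    fix y assume "y \<in> (\<Union>g\<in>G. g ` U)"
    then obtain g u where gu: "g \<in> G" "u \<in> U" "y = g u"
      by blast
    then show "y \<in> {y \<in> topspace Y. f y \<in> f ` U}"
      using f_invariant[of g u] G_closed[of g u] Usub by auto
  qed
  then have "openin Y {y \<in> topspace Y. f y \<in> f ` U}"
    using openin_translates[OF U order_refl] by simp
  moreover have "f ` U \<subseteq> topspace X"
    using Usub f_surj by blast
  ultimately show "openin X (f ` U)"
    using continuous_imp_quotient_map[OF continuous_f Y_facts(1) X_facts(4) f_surj]
    unfolding quotient_map_def by blast
qed

abbreviation N :: "('b \<times> 'b) set \<Rightarrow> ('b \<Rightarrow> 'b) set" where
  "N F \<equiv> N_subgroup (topspace Y) G F"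

lemma S_set_G: "S_set (topspace Y) G F \<subseteq> carrier GG"
  by (auto simp: S_set_def)

lemma N_incl: "g \<in> G \<Longrightarrow> y \<in> topspace Y \<Longrightarrow> (y, g y) \<in> F \<Longrightarrow> g \<in> N F"
  unfolding N_subgroup_def by (rule generate.incl) (auto simp: S_set_def)

lemma N_G: "n \<in> N F \<Longrightarrow> n \<in> G"
  using group.generate_in_carrier[OF group_GG S_set_G] unfolding N_subgroup_def by simp

lemma subgroup_N: "subgroup (N F) GG"
  unfolding N_subgroup_def using group.generate_is_subgroup[OF group_GG S_set_G] .

lemma normal_N:
  assumes F: "invariant F"
  shows "N F \<lhd> GG"
  unfolding N_subgroup_def
proof (rule group.normal_generateI[OF group_GG S_set_G])
  fix h g assume h: "h \<in> S_set (topspace Y) G F" and "g \<in> carrier GG"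
  then have g: "g \<in> G"
    by simp
  obtain y where y: "h \<in> G" "y \<in> topspace Y" "(y, h y) \<in> F"
    using h by (auto simp: S_set_def)
  have gh: "g \<otimes>\<^bsub>GG\<^esub> h \<in> G"
    using g y(1) by (rule mult_G)
  have "(g \<otimes>\<^bsub>GG\<^esub> h \<otimes>\<^bsub>GG\<^esub> inv\<^bsub>GG\<^esub> g) (g y) = g (h y)"
    using mult_apply[OF gh inv_G[OF g] G_closed[OF g y(2)]] mult_apply[OF g y(1,2)] inv_apply(1)[OF g y(2)]
    by simp
  moreover have "(g y, g (h y)) \<in> F"
    using F g y(3) by (simp add: invariant_def)
  ultimately show "g \<otimes>\<^bsub>GG\<^esub> h \<otimes>\<^bsub>GG\<^esub> inv\<^bsub>GG\<^esub> g \<in> S_set (topspace Y) G F"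
    using mult_G[OF gh inv_G[OF g]] G_closed[OF g y(2)] unfolding S_set_def
    by (intro CollectI conjI bexI[of _ "g y"]) simp_all
qed

text \<open>
  Prodiscreteness lets the groups \<open>N F\<close> shrink to the identity, and replacing \<open>F\<close> by a smaller
  invariant entourage only makes \<open>N F\<close> smaller.
\<close>

lemma N_separates:
  assumes g: "g \<in> G" "g \<noteq> \<one>\<^bsub>GG\<^esub>"
  shows "\<exists>F. invariant F \<and> g \<notin> N F"
proof -
  obtain y where y: "y \<in> topspace Y" "g y \<noteq> y"
  proof (rule ccontr)
    assume neg: "\<not> thesis"
    have "g = \<one>\<^bsub>GG\<^esub>"
    proof (rule extensionalityI[of g "topspace Y"])
      show "g \<in> extensional (topspace Y)" "\<one>\<^bsub>GG\<^esub> \<in> extensional (topspace Y)"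
        using G_Bij[OF g(1)] G_Bij[OF one_G] by (simp_all add: Bij_def)
      show "g y = \<one>\<^bsub>GG\<^esub> y" if "y \<in> topspace Y" for y
        using neg that one_apply \<open>\<And>y. \<lbrakk>y \<in> topspace Y; g y \<noteq> y\<rbrakk> \<Longrightarrow> thesis\<close> by metis
    qed
    then show False
      using g(2) by simp
  qed
  let ?U = "topspace Y - {g y}"
  let ?E = "?U \<times> ?U \<union> (topspace Y - {y}) \<times> (topspace Y - {y})"
  have "openin Y ?U"
    using closedin_Hausdorff_singleton[OF Y_facts(4) G_closed[OF g(1) y(1)]] by blast
  then have "?E \<in> compact_uniformity Y"
    using diagonal_neighbourhood_isolating[OF Y_facts(4), of ?U y] y
    unfolding compact_uniformity_eq[OF Y] by simp
  then obtain F where F: "F \<in> compact_uniformity Y" "N F \<subseteq> U_set (topspace Y) G ?E"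
    using prodiscrete unfolding acts_prodiscretely_def by blast
  obtain F' where F': "invariant F'" "F' \<subseteq> F"
    using invariant_basis[OF F(1)] by blast
  have "S_set (topspace Y) G F' \<subseteq> S_set (topspace Y) G F"
    using F'(2) by (auto simp: S_set_def)
  then have "N F' \<subseteq> N F"
    unfolding N_subgroup_def by (rule group.mono_generate[OF group_GG])
  moreover have "g \<notin> U_set (topspace Y) G ?E"
    using y by (auto simp: U_set_def)
  ultimately show ?thesis
    using F(2) F'(1) by blast
qed

text \<open>
  An element with a fixed point lies in \<open>S_set (topspace Y) G F\<close> for every \<open>F\<close>, hence in every \<open>N F\<close>.
\<close>

lemma G_free:
  assumes g: "g \<in> G" "g' \<in> G" and y: "y \<in> topspace Y" "g y = g' y"
  shows "g = g'"
proof -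
  let ?k = "inv\<^bsub>GG\<^esub> g' \<otimes>\<^bsub>GG\<^esub> g"
  have k: "?k \<in> G"
    using mult_G[OF inv_G[OF g(2)] g(1)] .
  have ky: "?k y = y"
    using mult_apply[OF inv_G[OF g(2)] g(1) y(1)] inv_apply(1)[OF g(2) y(1)] y(2) by simp
  have "?k = \<one>\<^bsub>GG\<^esub>"
  proof (rule ccontr)
    assume "?k \<noteq> \<one>\<^bsub>GG\<^esub>"
    then obtain F where F: "invariant F" "?k \<notin> N F"
      using N_separates[OF k] by blast
    have "(y, ?k y) \<in> F"
      using F(1) entourage(1) y(1) ky by (simp add: invariant_def)
    then show False
      using N_incl[OF k y(1)] F(2) by blast
  qed
  then have "g' \<otimes>\<^bsub>GG\<^esub> ?k = g'"
    using group.is_monoid[OF group_GG] monoid.r_one g(2) by fastforce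
  moreover have "g' \<otimes>\<^bsub>GG\<^esub> ?k = g"
    using monoid.m_assoc[OF group.is_monoid[OF group_GG], of g' "inv\<^bsub>GG\<^esub> g'" g]
      group.r_inv[OF group_GG, of g'] monoid.l_one[OF group.is_monoid[OF group_GG], of g] g inv_G[OF g(2)]
    by simp
  ultimately show ?thesis
    by simp
qed

text \<open>
  For an invariant entourage \<open>F\<close> the orbits of \<open>N F\<close> are uniformly separated inside each fibre of \<open>f\<close>:
  if two points of a fibre are \<open>F\<close>-close, the element of \<open>G\<close> joining them lies in \<open>N F\<close>. So \<open>Y\<close> modulo
  \<open>N F\<close> is Hausdorff and maps locally injectively to \<open>X\<close>; as \<open>N F\<close> is normal, \<open>G\<close> still acts on it.
  The points of the quotient are the orbits themselves.
\<close>

lemma quotient_by_N: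
  assumes F: "invariant F"
  shows "\<exists>(Z :: 'b set topology) q p. continuum Z \<and> normal_cover Z X p \<and> continuous_map Y Z q \<and>
    (\<forall>y\<in>topspace Y. p (q y) = f y) \<and>
    (\<forall>y\<in>topspace Y. \<forall>y'\<in>topspace Y. q y = q y' \<longleftrightarrow> (\<exists>n\<in>N F. n y = y'))"
proof -
  define q where "q y = (\<lambda>n. n y) ` N F" for y
  define Z where "Z = quotient_space Y q"
  have NG: "\<And>n. n \<in> N F \<Longrightarrow> n \<in> G" and N1: "\<one>\<^bsub>GG\<^esub> \<in> N F"
    and Nm: "\<And>n m. n \<in> N F \<Longrightarrow> m \<in> N F \<Longrightarrow> n \<otimes>\<^bsub>GG\<^esub> m \<in> N F"
    and Ni: "\<And>n. n \<in> N F \<Longrightarrow> inv\<^bsub>GG\<^esub> n \<in> N F"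
    using N_G subgroup.one_closed[OF subgroup_N] subgroup.m_closed[OF subgroup_N]
      subgroup.m_inv_closed[OF subgroup_N] by blast+
  have q_self: "y \<in> q y" if "y \<in> topspace Y" for y
    unfolding q_def using N1 one_apply[OF that] by (metis imageI)
  have q_eq: "q y = q y' \<longleftrightarrow> (\<exists>n\<in>N F. n y = y')" if y: "y \<in> topspace Y" "y' \<in> topspace Y" for y y'
  proof
    assume "q y = q y'"
    then have "y' \<in> q y"
      using q_self[OF y(2)] by simp
    then show "\<exists>n\<in>N F. n y = y'"
      unfolding q_def by blast
  next
    assume "\<exists>n\<in>N F. n y = y'"
    then obtain n where n: "n \<in> N F" "n y = y'"
      by blast
    have "m y = (m \<otimes>\<^bsub>GG\<^esub> inv\<^bsub>GG\<^esub> n) y'" if "m \<in> N F" for m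
      using mult_apply[OF NG[OF that] NG[OF Ni[OF n(1)]] y(2)] inv_apply(1)[OF NG[OF n(1)] y(1)] n(2) by simp
    moreover have "m y' = (m \<otimes>\<^bsub>GG\<^esub> n) y" if "m \<in> N F" for m
      using mult_apply[OF NG[OF that] NG[OF n(1)] y(1)] n(2) by simp
    ultimately show "q y = q y'"
      unfolding q_def using Nm Ni n(1) by blast
  qed
  have fq: "f y = f y'" if "y \<in> topspace Y" "y' \<in> topspace Y" "q y = q y'" for y y'
    using q_eq[OF that(1,2)] that(3) f_invariant[OF NG that(1)] by metis
  obtain F1 where F1: "F1 \<in> compact_uniformity Y" "F1 O F1 \<subseteq> F"
    using entourage(6)[of F] F by (auto simp: invariant_def)
  obtain F2 where F2: "invariant F2" "F2 \<subseteq> F1"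
    using invariant_basis[OF F1(1)] by blast
  have F2U: "F2 \<in> compact_uniformity Y" and F2G: "\<And>g x y. g \<in> G \<Longrightarrow> (x, y) \<in> F2 \<Longrightarrow> (g x, g y) \<in> F2"
    using F2(1) by (simp_all add: invariant_def)
  have F22: "(x, z) \<in> F" if "(x, y) \<in> F2" "(y, z) \<in> F2" for x y z
    using that F1(2) F2(2) by blast
  define W where "W y = Y interior_of (F2 `` {y})" for y
  have W: "openin Y (W y)" "y \<in> W y" "\<And>u. u \<in> W y \<Longrightarrow> (y, u) \<in> F2" if "y \<in> topspace Y" for y
    using entourage_interior[OF compatible F2U that] interior_of_subset[of Y "F2 `` {y}"]
    by (auto simp: W_def)
  have close: "q u = q u'" if u: "u \<in> topspace Y" "u' \<in> topspace Y" "f u = f u'" "(u, u') \<in> F" for u u'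
  proof -
    obtain g where g: "g \<in> G" "g u = u'"
      using orbit_eq[OF u(1,2)] u(3) by blast
    then have "g \<in> N F"
      using N_incl[OF g(1) u(1)] u(4) by simp
    then show ?thesis
      using q_eq[OF u(1,2)] g(2) by blast
  qed
  have "\<exists>p. normal_cover (quotient_space Y q) X p \<and> (\<forall>y\<in>topspace Y. p (q y) = f y)"
  proof (rule normal_cover_quotient[OF Y_facts(1,3) continuous_f f_surj X_facts(4) fq])
    fix y y' assume yy: "y \<in> topspace Y" "y' \<in> topspace Y" "f y = f y'" "q y \<noteq> q y'"
    have far: "q u \<noteq> q u'" if u: "u \<in> W y" "u' \<in> W y'" for u u'
    proof
      assume eq: "q u = q u'"
      have uY: "u \<in> topspace Y" "u' \<in> topspace Y"
        using u openin_subset[OF W(1)] yy(1,2) by blast+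
      obtain n where n: "n \<in> N F" "n u = u'"
        using q_eq[OF uY] eq by blast
      \<comment> \<open>\<open>n y\<close> is close to \<open>n u = u'\<close>, which is close to \<open>y'\<close>\<close>
      have "(n y, u') \<in> F2"
        using F2G[OF NG[OF n(1)] W(3)[OF yy(1) u(1)]] n(2) by simp
      moreover have "(u', y') \<in> F2"
        using W(3)[OF yy(2) u(2)] entourage(3)[OF F2U] by blast
      ultimately have "(n y, y') \<in> F"
        by (rule F22)
      then have "q (n y) = q y'"
        using close[OF G_closed[OF NG[OF n(1)] yy(1)] yy(2)] f_invariant[OF NG[OF n(1)] yy(1)] yy(3) by simp
      moreover have "q y = q (n y)"
        using q_eq[OF yy(1) G_closed[OF NG[OF n(1)] yy(1)]] n(1) by blast
      ultimately show False
        using yy(4) by simp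
    qed
    then show "\<exists>U V. openin Y U \<and> openin Y V \<and> y \<in> U \<and> y' \<in> V \<and> (\<forall>u\<in>U. \<forall>v\<in>V. q u \<noteq> q v)"
      using W(1,2)[OF yy(1)] W(1,2)[OF yy(2)] by (intro exI[of _ "W y"] exI[of _ "W y'"]) simp
  next
    fix y assume y: "y \<in> topspace Y"
    let ?U = "\<Union>n\<in>N F. n ` W y"
    have "openin Y ?U"
      using openin_translates[OF W(1)[OF y]] NG by blast
    moreover have "{v \<in> topspace Y. q v = q y} \<subseteq> ?U"
    proof
      fix v assume "v \<in> {v \<in> topspace Y. q v = q y}"
      then obtain n where "n \<in> N F" "n y = v"
        using q_eq[OF y, of v] by auto
      then show "v \<in> ?U"
        using W(2)[OF y] by blast
    qed
    moreover have "q u = q v" if u: "u \<in> ?U" and v: "v \<in> ?U" and eq: "f u = f v" for u v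
    proof -
      have *: "\<exists>a\<in>W y. a \<in> topspace Y \<and> q a = q t \<and> f a = f t" if "t \<in> ?U" for t
      proof -
        obtain n a where na: "n \<in> N F" "a \<in> W y" "t = n a"
          using \<open>t \<in> ?U\<close> by blast
        have a: "a \<in> topspace Y"
          using na(2) openin_subset[OF W(1)[OF y]] by blast
        have t: "t \<in> topspace Y"
          using G_closed[OF NG[OF na(1)] a] na(3) by simp
        have "q a = q t"
          using q_eq[OF a t] na(1,3) by blast
        then show ?thesis
          using na(2) a fq[OF a t] by blast
      qed
      obtain a c where ac: "a \<in> W y" "a \<in> topspace Y" "q a = q u" "f a = f u"
          "c \<in> W y" "c \<in> topspace Y" "q c = q v" "f c = f v"
        using *[OF u] *[OF v] by blast
      have "(a, c) \<in> F"
        using F22 W(3)[OF y ac(1)] W(3)[OF y ac(5)] entourage(3)[OF F2U] by blast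
      then show ?thesis
        using close[OF ac(2,6)] ac(3,4,7,8) eq by simp
    qed
    ultimately show "\<exists>U. openin Y U \<and> {v \<in> topspace Y. q v = q y} \<subseteq> U \<and>
        (\<forall>u\<in>U. \<forall>v\<in>U. f u = f v \<longrightarrow> q u = q v)"
      by (intro exI[of _ ?U] conjI ballI impI)
  next
    fix y y' assume y: "y \<in> topspace Y" "y' \<in> topspace Y" "f y = f y'"
    then obtain g where g: "g \<in> G" "g y = y'"
      using orbit_eq by blast
    have image_q: "g ` q u = q (g u)" if g: "g \<in> G" and u: "u \<in> topspace Y" for g u
    proof -
      have "g (n u) \<in> q (g u)" if n: "n \<in> N F" for n
      proof -
        let ?m = "g \<otimes>\<^bsub>GG\<^esub> n \<otimes>\<^bsub>GG\<^esub> inv\<^bsub>GG\<^esub> g"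
        have "?m \<in> N F"
          using normal.inv_op_closed2[OF normal_N[OF F], of g n] g n by simp
        moreover have "?m (g u) = g (n u)"
          using mult_apply[OF mult_G[OF g NG[OF n]] inv_G[OF g] G_closed[OF g u]]
            mult_apply[OF g NG[OF n] u] inv_apply(1)[OF g u] by simp
        ultimately show ?thesis
          unfolding q_def by (intro image_eqI[where x = ?m]) (rule sym)
      qed
      moreover have "n (g u) \<in> g ` q u" if n: "n \<in> N F" for n
      proof -
        let ?m = "inv\<^bsub>GG\<^esub> g \<otimes>\<^bsub>GG\<^esub> n \<otimes>\<^bsub>GG\<^esub> g"
        have "?m \<in> N F"
          using normal.inv_op_closed1[OF normal_N[OF F], of g n] g n by simp
        moreover have "g (?m u) = n (g u)"
          using mult_apply[OF mult_G[OF inv_G[OF g] NG[OF n]] g u]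
            mult_apply[OF inv_G[OF g] NG[OF n] G_closed[OF g u]]
            inv_apply(2)[OF g G_closed[OF NG[OF n] G_closed[OF g u]]] by simp
        ultimately show ?thesis
          unfolding q_def image_image by (intro image_eqI[where x = ?m]) (rule sym)
      qed
      ultimately show ?thesis
        by (auto simp: q_def)
    qed
    have "q (g u) = q (g v) \<longleftrightarrow> q u = q v" if "u \<in> topspace Y" "v \<in> topspace Y" for u v
    proof -
      have "inj_on g (topspace Y)"
        using homeomorphic_imp_injective_map[OF homeomorphic_G[OF g(1)]] .
      moreover have "q u \<subseteq> topspace Y" "q v \<subseteq> topspace Y"
        unfolding q_def using G_closed[OF NG] that by blast+
      ultimately have "g ` q u = g ` q v \<longleftrightarrow> q u = q v"
        by (rule inj_on_image_eq_iff)
      then show ?thesis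
        using image_q[OF g(1) that(1)] image_q[OF g(1) that(2)] by simp
    qed
    then show "\<exists>h. homeomorphic_map Y Y h \<and> (\<forall>u\<in>topspace Y. f (h u) = f u) \<and>
        (\<forall>u\<in>topspace Y. \<forall>v\<in>topspace Y. q (h u) = q (h v) \<longleftrightarrow> q u = q v) \<and> q (h y) = q y'"
      using homeomorphic_G[OF g(1)] f_invariant[OF g(1)] g(2) by blast
  qed
  then obtain p where p: "normal_cover Z X p" "\<forall>y\<in>topspace Y. p (q y) = f y"
    unfolding Z_def by blast
  have quo: "quotient_map Y Z q"
    unfolding Z_def by (rule quotient_map_quotient_space)
  have qc: "continuous_map Y Z q"
    using quo by (rule quotient_imp_continuous_map)
  have "connected_space Z"
    using Y_facts(2) quo connected_space_quotient_map_image by blast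
  moreover have "topspace Z \<noteq> {}"
    using quotient_imp_surjective_map[OF quo] Y_facts(5) by blast
  ultimately have "continuum Z"
    using normal_coverD[OF p(1)] by (simp add: continuum_def)
  then show ?thesis
    using p qc q_eq by (intro exI[of _ Z] exI[of _ q] exI[of _ p] conjI ballI) simp_all
qed

end

section \<open>Uniqueness of the compact universal cover\<close>

context cover_system
begin

text \<open>
  The lifts \<open>h c\<close> of \<open>f\<close> to the covers are the coordinates of the equivalence \<open>H\<close>. It separates the points
  \<open>y\<close> and \<open>g y\<close>, where \<open>g\<close> is not the identity, because for some \<open>F\<close> they have different images in \<open>Y\<close>
  modulo \<open>N F\<close>; this quotient is one of the covers, and \<open>h c\<close> agrees with the quotient map up to a deck
  transformation.
\<close>

lemma equivalent_universal_cover: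
  fixes Y :: "'b topology"
  assumes csc: "compactly_simply_connected Y"
    and gen: "generalized_regular_covering_map
      (topspace Y) (compact_uniformity Y) G f (topspace X) (compact_uniformity X)"
  shows "equivalent_quotient_maps
    (topspace Y) (compact_uniformity Y) (bij_subgroup (topspace Y) G) (\<lambda>g. g) f
    (topspace Xhat) (compact_uniformity Xhat) piP (coordinatewise_action C) (universal_projection C)"
proof -
  have cY: "continuum Y"
    using csc by (simp add: compactly_simply_connected_def)
  interpret A: prodiscrete_action Y G f X
    using cY X gen by unfold_locales
  obtain c0 where c0: "c0 \<in> C"
    using C_nonempty by blast
  have "cmap c0 (b c0) \<in> f ` topspace Y"
    using basepoint[OF c0] cmap_facts(5)[OF c0] A.f_surj by blast
  then obtain y0 where y0: "y0 \<in> topspace Y" "f y0 = cmap c0 (b c0)"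
    by (elim imageE) simp
  have "\<forall>c\<in>C. \<exists>h. continuous_map Y (cspace c) h \<and> h y0 = b c \<and> (\<forall>y\<in>topspace Y. cmap c (h y) = f y)"
  proof
    fix c assume c: "c \<in> C"
    have "f y0 = cmap c (b c)"
      using y0(2) cmap_basepoint[OF c c0] by simp
    then show "\<exists>h. continuous_map Y (cspace c) h \<and> h y0 = b c \<and> (\<forall>y\<in>topspace Y. cmap c (h y) = f y)"
      using compactly_simply_connected_lift[OF csc A.continuous_f X_facts(4) normal[OF c] y0(1) basepoint[OF c]]
      by blast
  qed
  then obtain h where h: "\<And>c. c \<in> C \<Longrightarrow> continuous_map Y (cspace c) (h c)"
      "\<And>c. c \<in> C \<Longrightarrow> h c y0 = b c"
      "\<And>c y. c \<in> C \<Longrightarrow> y \<in> topspace Y \<Longrightarrow> cmap c (h c y) = f y"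
    by metis
  have hc: "h c y \<in> cpoints c" if "c \<in> C" "y \<in> topspace Y" for c y
    using continuous_map_image_subset_topspace[OF h(1)[OF that(1)]] that(2) by blast
  have hcomp: "bonding_map b c d (h d y) = h c y"
    if cd: "c \<in> C" "d \<in> C" "cover_le c d" and y: "y \<in> topspace Y" for c d y
  proof -
    note B = bonding[OF cd]
    have "(bonding_map b c d \<circ> h d) y = h c y"
    proof (rule lifts_unique[OF A.Y_facts(2) cspace_facts(4)[OF cd(1)] cmap_facts(6)[OF cd(1)],
          of "bonding_map b c d \<circ> h d" "h c" y0 y])
      show "continuous_map Y (cspace c) (bonding_map b c d \<circ> h d)"
        using h(1)[OF cd(2)] B(1) by (rule continuous_map_compose)
      show "cmap c ((bonding_map b c d \<circ> h d) z) = cmap c (h c z)" if z: "z \<in> topspace Y" for z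
        using B(3)[OF hc[OF cd(2) z]] h(3)[OF cd(1) z] h(3)[OF cd(2) z] by simp
      show "(bonding_map b c d \<circ> h d) y0 = h c y0"
        using h(2)[OF cd(1)] h(2)[OF cd(2)] B(4) by simp
    qed (use h(1) cd(1) y0(1) y in auto)
    then show ?thesis
      by simp
  qed
  define H where "H y = (\<lambda>c\<in>C. h c y)" for y
  have Hc: "continuous_map Y Xhat H"
    unfolding H_def using h(1) hcomp by (rule continuous_map_into_Xhat)
  have HX: "H y \<in> topspace Xhat" if "y \<in> topspace Y" for y
    using continuous_map_image_subset_topspace[OF Hc] that by blast
  have Hh: "H y c = h c y" if "c \<in> C" for y c
    using that by (simp add: H_def)
  have over: "universal_projection C (H y) = f y" if "y \<in> topspace Y" for y
    using universal_projection[OF HX[OF that] c0] Hh[OF c0] h(3)[OF c0 that] by simp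
  have surj: "\<exists>y\<in>topspace Y. H y = x" if x: "x \<in> topspace Xhat" for x
  proof -
    define P where "P c = {y \<in> topspace Y. h c y = x c}" for c
    have "\<exists>y\<in>topspace Y. \<forall>c\<in>C. y \<in> P c"
    proof (rule directed_closed_family_meets[OF A.Y_facts(1) C_nonempty])
      fix c assume c: "c \<in> C"
      have "closedin Y {y \<in> topspace Y. h c y \<in> {x c}}"
        using h(1)[OF c] closedin_Hausdorff_singleton[OF cspace_facts(4)[OF c] XhatD(1)[OF x c]]
        by (rule closedin_continuous_map_preimage)
      then show "closedin Y (P c)"
        by (simp add: P_def)
      have "h c ` topspace Y = cpoints c"
        using lift_of_open_map_surjective[OF A.Y_facts(1,5) cspace_facts(2,4)[OF c] cmap_facts(6,4)[OF c]
            h(1)[OF c] A.open_f h(3)[OF c]] .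
      then have "x c \<in> h c ` topspace Y"
        using XhatD(1)[OF x c] by simp
      then show "P c \<noteq> {}"
        by (auto simp: P_def)
    next
      fix c d assume cd: "c \<in> C" "d \<in> C"
      then obtain e where e: "e \<in> C" "cover_le c e" "cover_le d e"
        using directed by blast
      have "h c y = x c" "h d y = x d" if "y \<in> topspace Y" "h e y = x e" for y
        using hcomp[OF cd(1) e(1,2) that(1)] hcomp[OF cd(2) e(1,3) that(1)]
          XhatD(3)[OF x cd(1) e(1,2)] XhatD(3)[OF x cd(2) e(1,3)] that(2) by simp_all
      then have "P e \<subseteq> P c \<inter> P d"
        by (auto simp: P_def)
      then show "\<exists>e\<in>C. P e \<subseteq> P c \<inter> P d"
        using e(1) by blast
    qed
    then obtain y where y: "y \<in> topspace Y" "\<And>c. c \<in> C \<Longrightarrow> h c y = x c"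
      by (auto simp: P_def)
    have "H y = x"
    proof (rule extensionalityI[of "H y" C])
      show "H y \<in> extensional C" "x \<in> extensional C"
        using XhatD(2)[OF x] by (simp_all add: H_def)
      show "H y c = x c" if "c \<in> C" for c
        using Hh[OF that] y(2)[OF that] by simp
    qed
    then show ?thesis
      using y(1) by blast
  qed
  have inj: "y = y'" if y: "y \<in> topspace Y" "y' \<in> topspace Y" "H y = H y'" for y y'
  proof -
    have "f y = f y'"
      using over[OF y(1)] over[OF y(2)] y(3) by simp
    then obtain g where g: "g \<in> G" "g y = y'"
      using A.orbit_eq[OF y(1,2)] by blast
    have "g = \<one>\<^bsub>A.GG\<^esub>"
    proof (rule ccontr)
      assume "g \<noteq> \<one>\<^bsub>A.GG\<^esub>"
      then obtain F where F: "A.invariant F" "g \<notin> A.N F"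
        using A.N_separates[OF g(1)] by blast
      obtain Z :: "'b set topology" and q p where Z: "continuum Z" "normal_cover Z X p" "continuous_map Y Z q"
          "\<forall>y\<in>topspace Y. p (q y) = f y"
          "\<forall>y\<in>topspace Y. \<forall>y'\<in>topspace Y. q y = q y' \<longleftrightarrow> (\<exists>n\<in>A.N F. n y = y')"
        using A.quotient_by_N[OF F(1)] by blast
      obtain c k where c: "c \<in> C" and k: "homeomorphic_map Z (cspace c) k"
          "\<forall>z\<in>topspace Z. cmap c (k z) = p z"
        using representative[OF Z(2,1)] by blast
      have qZ: "q u \<in> topspace Z" if "u \<in> topspace Y" for u
        using continuous_map_image_subset_topspace[OF Z(3)] that by blast
      have kq: "continuous_map Y (cspace c) (k \<circ> q)"
        using Z(3) homeomorphic_imp_continuous_map[OF k(1)] by (rule continuous_map_compose)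
      have kqo: "cmap c (h c u) = cmap c ((k \<circ> q) u)" if "u \<in> topspace Y" for u
        using h(3)[OF c that] k(2) qZ[OF that] Z(4) that by simp
      obtain l where l: "\<forall>u\<in>topspace Y. l (h c u) = (k \<circ> q) u"
        using lifts_differ_by_deck[OF regular[OF c] continuum_cspace[OF c] A.Y_facts(2) y0(1) h(1)[OF c] kq kqo]
        by blast
      have "h c y = h c y'"
        using y(3) Hh[OF c] by metis
      then have "k (q y) = k (q y')"
        using bspec[OF l y(1)] bspec[OF l y(2)] by simp
      then have "q y = q y'"
        using homeomorphic_imp_injective_map[OF k(1)] qZ[OF y(1)] qZ[OF y(2)] by (auto dest: inj_onD)
      then obtain n where n: "n \<in> A.N F" "n y = y'"
        using Z(5) y(1,2) by blast
      have "n = g"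
        using A.G_free[OF A.N_G[OF n(1)] g(1) y(1)] n(2) g(2) by simp
      then show False
        using n(1) F(2) by simp
    qed
    then show ?thesis
      using g(2) A.one_apply[OF y(1)] by simp
  qed
  have "topspace Xhat \<subseteq> H ` topspace Y"
    using surj by blast
  moreover have "H ` topspace Y \<subseteq> topspace Xhat"
    using HX by blast
  ultimately have bij: "bij_betw H (topspace Y) (topspace Xhat)"
    using inj unfolding bij_betw_def by (intro conjI inj_onI equalityI)
  then have "homeomorphic_map Y Xhat H"
    using Hc A.Y_facts(1) continuumD(4)[OF continuum_Xhat]
    by (intro continuous_imp_homeomorphic_map) (simp_all add: bij_betw_def)
  then have uH: "uniform_homeomorphism (topspace Y) (compact_uniformity Y) (topspace Xhat) (compact_uniformity Xhat) H"
    using uniform_homeomorphism_iff[OF cY continuum_Xhat] by blast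
  have "\<exists>\<gamma>\<in>carrier piP. \<forall>c\<in>C. \<forall>y\<in>topspace Y. \<gamma> c (h c y) = h c (g y)" if g: "g \<in> G" for g
  proof -
    have gy: "g y \<in> topspace Y" if "y \<in> topspace Y" for y
      using A.G_closed[OF g that] .
    have "universal_projection C (H y0) = universal_projection C (H (g y0))"
      using over[OF y0(1)] over[OF gy[OF y0(1)]] A.f_invariant[OF g y0(1)] by simp
    then obtain \<gamma> where \<gamma>: "\<gamma> \<in> carrier piP" "\<forall>c\<in>C. \<gamma> c (H y0 c) = H (g y0) c"
      using piP_transitive[OF HX[OF y0(1)] HX[OF gy[OF y0(1)]]] by blast
    have "\<gamma> c (h c y) = h c (g y)" if c: "c \<in> C" and y: "y \<in> topspace Y" for c y
    proof -
      have "(\<gamma> c \<circ> h c) y = (h c \<circ> g) y"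
      proof (rule lifts_unique[OF A.Y_facts(2) cspace_facts(4)[OF c] cmap_facts(6)[OF c],
            of "\<gamma> c \<circ> h c" "h c \<circ> g" y0 y])
        show "continuous_map Y (cspace c) (\<gamma> c \<circ> h c)"
          using h(1)[OF c] homeomorphic_imp_continuous_map[OF deck(1)[OF c piPD(1)[OF \<gamma>(1) c]]]
          by (rule continuous_map_compose)
        show "continuous_map Y (cspace c) (h c \<circ> g)"
          using homeomorphic_imp_continuous_map[OF A.homeomorphic_G[OF g]] h(1)[OF c]
          by (rule continuous_map_compose)
        show "cmap c ((\<gamma> c \<circ> h c) z) = cmap c ((h c \<circ> g) z)" if z: "z \<in> topspace Y" for z
          using deck(4)[OF c piPD(1)[OF \<gamma>(1) c] hc[OF c z]] h(3)[OF c z] h(3)[OF c gy[OF z]]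
            A.f_invariant[OF g z] by simp
        show "(\<gamma> c \<circ> h c) y0 = (h c \<circ> g) y0"
          using bspec[OF \<gamma>(2) c] Hh[OF c] by simp
      qed (fact y0(1) y)+
      then show ?thesis
        by simp
    qed
    then show ?thesis
      using \<gamma>(1) by blast
  qed
  then have "\<forall>g\<in>G. \<exists>\<gamma>. \<gamma> \<in> carrier piP \<and> (\<forall>c\<in>C. \<forall>y\<in>topspace Y. \<gamma> c (h c y) = h c (g y))"
    by blast
  from bchoice[OF this] obtain \<theta> where
      th: "\<forall>g\<in>G. \<theta> g \<in> carrier piP \<and> (\<forall>c\<in>C. \<forall>y\<in>topspace Y. \<theta> g c (h c y) = h c (g y))"
    by (elim exE)
  have \<theta>: "\<theta> g \<in> carrier piP" "\<And>c y. c \<in> C \<Longrightarrow> y \<in> topspace Y \<Longrightarrow> \<theta> g c (h c y) = h c (g y)" if "g \<in> G" for g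
    using th that by simp_all
  have "\<theta> \<in> hom A.GG piP"
  proof (rule homI)
    show "\<theta> g \<in> carrier piP" if "g \<in> carrier A.GG" for g
      using \<theta>(1) that by simp
    fix g g' assume "g \<in> carrier A.GG" "g' \<in> carrier A.GG"
    then have g: "g \<in> G" "g' \<in> G"
      by simp_all
    have gg: "g \<otimes>\<^bsub>A.GG\<^esub> g' \<in> G"
      using g by (rule A.mult_G)
    show "\<theta> (g \<otimes>\<^bsub>A.GG\<^esub> g') = \<theta> g \<otimes>\<^bsub>piP\<^esub> \<theta> g'"
    proof (rule extensionalityI[OF piPD(2)[OF \<theta>(1)[OF gg]]])
      show "\<theta> g \<otimes>\<^bsub>piP\<^esub> \<theta> g' \<in> extensional C"
        by (simp add: mult_piP)
      fix c assume c: "c \<in> C"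
      note t = piPD(1)[OF \<theta>(1)[OF g(1)] c] piPD(1)[OF \<theta>(1)[OF g(2)] c]
      have "\<theta> (g \<otimes>\<^bsub>A.GG\<^esub> g') c (h c y0) = compose (cpoints c) (\<theta> g c) (\<theta> g' c) (h c y0)"
        using \<theta>(2)[OF gg c y0(1)] \<theta>(2)[OF g(1) c A.G_closed[OF g(2) y0(1)]] \<theta>(2)[OF g(2) c y0(1)]
          A.mult_apply[OF g y0(1)] hc[OF c y0(1)] by (simp add: compose_eq)
      then have "\<theta> (g \<otimes>\<^bsub>A.GG\<^esub> g') c = compose (cpoints c) (\<theta> g c) (\<theta> g' c)"
        using deck(6)[OF c piPD(1)[OF \<theta>(1)[OF gg] c] regular_covering_compose[OF regular[OF c] t] hc[OF c y0(1)]]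
        by blast
      then show "\<theta> (g \<otimes>\<^bsub>A.GG\<^esub> g') c = (\<theta> g \<otimes>\<^bsub>piP\<^esub> \<theta> g') c"
        using bij_subgroup_mult[OF deck(7)[OF c t(1)] deck(7)[OF c t(2)]] c by (simp add: mult_piP)
    qed
  qed
  moreover have "inj_on \<theta> G"
  proof (rule inj_onI)
    fix g g' assume g: "g \<in> G" "g' \<in> G" "\<theta> g = \<theta> g'"
    have "h c (g y0) = h c (g' y0)" if "c \<in> C" for c
      using \<theta>(2)[OF g(1) that y0(1)] \<theta>(2)[OF g(2) that y0(1)] g(3) by simp
    then have "H (g y0) = H (g' y0)"
      unfolding H_def by (intro restrict_ext)
    then have "g y0 = g' y0"
      using inj A.G_closed g(1,2) y0(1) by blast
    then show "g = g'"
      using A.G_free[OF g(1,2) y0(1)] by blast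
  qed
  moreover have "\<gamma> \<in> \<theta> ` G" if \<gamma>: "\<gamma> \<in> carrier piP" for \<gamma>
  proof -
    obtain y1 where y1: "y1 \<in> topspace Y" "H y1 = coordinatewise_action C \<gamma> (H y0)"
      using surj[OF action_in_Xhat[OF \<gamma> HX[OF y0(1)]]] by blast
    have y1h: "h c y1 = \<gamma> c (h c y0)" if "c \<in> C" for c
      using fun_cong[OF y1(2), of c] that by (simp add: H_def coordinatewise_action_def)
    have "f y0 = f y1"
      using h(3)[OF c0 y0(1)] h(3)[OF c0 y1(1)] y1h[OF c0]
        deck(4)[OF c0 piPD(1)[OF \<gamma> c0] hc[OF c0 y0(1)]] by simp
    then obtain g where g: "g \<in> G" "g y0 = y1"
      using A.orbit_eq[OF y0(1) y1(1)] by blast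
    have "\<theta> g = \<gamma>"
    proof (rule piP_eqI[OF \<theta>(1)[OF g(1)] \<gamma>])
      show "h c y0 \<in> cpoints c" if "c \<in> C" for c
        using hc[OF that y0(1)] .
      show "\<theta> g c (h c y0) = \<gamma> c (h c y0)" if "c \<in> C" for c
        using \<theta>(2)[OF g(1) that y0(1)] g(2) y1h[OF that] by simp
    qed
    then show ?thesis
      using g(1) by blast
  qed
  ultimately have iso: "\<theta> \<in> iso A.GG piP"
    using \<theta>(1) by (auto simp: iso_def bij_betw_def)
  have equiv: "H (g y) = coordinatewise_action C (\<theta> g) (H y)" if "g \<in> G" "y \<in> topspace Y" for g y
    unfolding coordinatewise_action_def using \<theta>(2)[OF that(1) _ that(2)] Hh by (simp add: H_def cong: restrict_cong)
  show ?thesis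
    unfolding equivalent_quotient_maps_def
    using uH iso equiv over by (intro exI[of _ H] exI[of _ \<theta>]) simp
qed

end

section \<open>Towers of normal covers\<close>

text \<open>
  The Galois closure of \<open>Z\<close> over \<open>Y\<close> over \<open>X = Y/G\<close>, possibly disconnected: the fibre product over \<open>Y\<close> of
  the pullbacks of \<open>Z\<close> along all elements of \<open>G\<close>. A point \<open>\<sigma>\<close> lies over the point \<open>r (\<sigma> \<one>)\<close> of \<open>Y\<close>, and \<open>\<sigma> g\<close>
  lies over its image under \<open>g\<close>.
\<close>

definition tower_space ::
    "'b topology \<Rightarrow> ('b \<Rightarrow> 'b) set \<Rightarrow> 'c topology \<Rightarrow> ('c \<Rightarrow> 'b) \<Rightarrow> (('b \<Rightarrow> 'b) \<Rightarrow> 'c) topology" where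
  "tower_space Y G Z r = subtopology (product_topology (\<lambda>_. Z) G)
     {\<sigma>. \<forall>g\<in>G. r (\<sigma> g) = g (r (\<sigma> \<one>\<^bsub>bij_subgroup (topspace Y) G\<^esub>))}"

text \<open>
  Deck transformations of \<open>Z\<close>, applied in each coordinate separately, act transitively on the points
  over a point of \<open>Y\<close>; re-indexing by an element of \<open>G\<close> moves the point of \<open>Y\<close> within its fibre over \<open>X\<close>.
\<close>

lemma normal_cover_tower_space:
  fixes X :: "'a topology" and Y :: "'b topology" and Z :: "'c topology"
  assumes f: "regular_covering_map Y G f X" and Y: "continuum Y" and X: "Hausdorff_space X"
    and Z: "normal_cover Z Y r"
  shows "normal_cover (tower_space Y G Z r) X (\<lambda>\<sigma>. f (r (\<sigma> \<one>\<^bsub>bij_subgroup (topspace Y) G\<^esub>)))"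
proof -
  let ?B = "bij_subgroup (topspace Y) G"
  let ?e = "\<one>\<^bsub>?B\<^esub>"
  let ?Q = "product_topology (\<lambda>_. Z) G"
  let ?P = "tower_space Y G Z r"
  let ?p = "\<lambda>\<sigma>. f (r (\<sigma> ?e))"
  note fD = regular_coveringD[OF f Y] and A = bij_subgroup_apply[OF regular_covering_subgroup[OF f]]
  note Y' = continuumD[OF Y] and Z' = normal_coverD[OF Z]
  note F' = normal_coverD[OF regular_covering_imp_normal_cover[OF f Y]]
  have fin: "finite G"
    using f Y X by (rule regular_covering_finite_group)
  have rY: "r z \<in> topspace Y" if "z \<in> topspace Z" for z
    using continuous_map_image_subset_topspace[OF Z'(4)] that by blast
  have P_iff: "\<sigma> \<in> topspace ?P \<longleftrightarrow> \<sigma> \<in> PiE G (\<lambda>_. topspace Z) \<and> (\<forall>g\<in>G. r (\<sigma> g) = g (r (\<sigma> ?e)))" for \<sigma>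
    unfolding tower_space_def by auto
  have PZ: "\<sigma> g \<in> topspace Z" if "\<sigma> \<in> topspace ?P" "g \<in> G" for \<sigma> g
    using that unfolding P_iff by (auto simp: PiE_iff)
  have Pr: "r (\<sigma> g) = g (r (\<sigma> ?e))" if "\<sigma> \<in> topspace ?P" "g \<in> G" for \<sigma> g
    using that unfolding P_iff by blast
  have Pext: "\<sigma> \<in> extensional G" if "\<sigma> \<in> topspace ?P" for \<sigma>
    using that unfolding P_iff by (auto simp: PiE_iff)
  have coordQ: "continuous_map ?Q Z (\<lambda>\<sigma>. \<sigma> g)" if "g \<in> G" for g
    using that by (rule continuous_map_product_projection)
  have coord: "continuous_map ?P Z (\<lambda>\<sigma>. \<sigma> g)" if "g \<in> G" for g
    unfolding tower_space_def using coordQ[OF that] by (rule continuous_map_from_subtopology)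
  have compQ: "compact_space ?Q"
    using Z'(1) by (simp add: compact_space_product_topology)
  have metQ: "metrizable_space ?Q"
    using Z'(2) countable_subset[OF _ countable_finite[OF fin]] by (auto simp: metrizable_space_product_topology)
  have "closedin ?Q {\<sigma> \<in> topspace ?Q. r (\<sigma> g) = g (r (\<sigma> ?e))}" if g: "g \<in> G" for g
  proof (rule closedin_continuous_maps_eq[OF Y'(4)])
    show "continuous_map ?Q Y (\<lambda>\<sigma>. r (\<sigma> g))"
      using continuous_map_compose[OF coordQ[OF g] Z'(4)] by (simp add: o_def)
    show "continuous_map ?Q Y (\<lambda>\<sigma>. g (r (\<sigma> ?e)))"
      using continuous_map_compose[OF continuous_map_compose[OF coordQ[OF A(1)] Z'(4)]
          homeomorphic_imp_continuous_map[OF fD(1)[OF g]]] by (simp only: o_def)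
  qed
  then have "closedin ?Q (\<Inter>g\<in>G. {\<sigma> \<in> topspace ?Q. r (\<sigma> g) = g (r (\<sigma> ?e))})"
    using A(1) by (intro closedin_Inter) auto
  then have "compactin ?Q (\<Inter>g\<in>G. {\<sigma> \<in> topspace ?Q. r (\<sigma> g) = g (r (\<sigma> ?e))})"
    using compQ closedin_compact_space by blast
  moreover have "(\<Inter>g\<in>G. {\<sigma> \<in> topspace ?Q. r (\<sigma> g) = g (r (\<sigma> ?e))}) =
      topspace ?Q \<inter> {\<sigma>. \<forall>g\<in>G. r (\<sigma> g) = g (r (\<sigma> ?e))}"
    using A(1) by blast
  ultimately have "compact_space (subtopology ?Q (topspace ?Q \<inter> {\<sigma>. \<forall>g\<in>G. r (\<sigma> g) = g (r (\<sigma> ?e))}))"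
    by (simp only: compact_space_subtopology)
  then have comp: "compact_space ?P"
    unfolding tower_space_def by (simp only: subtopology_restrict)
  have met: "metrizable_space ?P"
    unfolding tower_space_def using metQ by (rule metrizable_space_subtopology)
  have cont: "continuous_map ?P X ?p"
    using continuous_map_compose[OF continuous_map_compose[OF coord[OF A(1)] Z'(4)] F'(4)]
    by (simp only: o_def)
  have surj: "?p ` topspace ?P = topspace X"
  proof (intro equalityI subsetI)
    fix x assume "x \<in> ?p ` topspace ?P"
    then show "x \<in> topspace X"
      using continuous_map_image_subset_topspace[OF cont] by blast
  next
    fix x assume "x \<in> topspace X"
    then have "x \<in> f ` topspace Y"
      using F'(5) by simp
    then obtain y where y: "y \<in> topspace Y" "f y = x"
      by (elim imageE) simp
    have "\<exists>z\<in>topspace Z. r z = g y" if g: "g \<in> G" for g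
    proof -
      have "g y \<in> r ` topspace Z"
        using Z'(5) fD(3)[OF g y(1)] by simp
      then show ?thesis
        by (elim imageE) auto
    qed
    then obtain \<zeta> where \<zeta>: "\<And>g. g \<in> G \<Longrightarrow> \<zeta> g \<in> topspace Z \<and> r (\<zeta> g) = g y"
      by metis
    have "restrict \<zeta> G \<in> topspace ?P"
      unfolding P_iff using \<zeta> A(1,2) y(1) by simp
    moreover have "?p (restrict \<zeta> G) = x"
      using \<zeta>[OF A(1)] A(1) A(2)[OF y(1)] y(2) by simp
    ultimately show "x \<in> ?p ` topspace ?P"
      by (intro image_eqI[of _ _ "restrict \<zeta> G"]) (rule sym)
  qed
  have loc: "locally_injective ?P ?p"
    unfolding locally_injective_def
  proof
    fix \<sigma> assume s: "\<sigma> \<in> topspace ?P"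
    have "\<exists>U. openin Z U \<and> \<sigma> g \<in> U \<and> inj_on r U" if "g \<in> G" for g
      using Z'(6) PZ[OF s that] unfolding locally_injective_def by blast
    then obtain U where U: "\<And>g. g \<in> G \<Longrightarrow> openin Z (U g) \<and> \<sigma> g \<in> U g \<and> inj_on r (U g)"
      by metis
    obtain V where V: "openin Y V" "r (\<sigma> ?e) \<in> V" "inj_on f V"
      using F'(6) rY[OF PZ[OF s A(1)]] unfolding locally_injective_def by blast
    let ?T = "{\<tau> \<in> topspace ?P. r (\<tau> ?e) \<in> V} \<inter> (\<Inter>g\<in>G. {\<tau> \<in> topspace ?P. \<tau> g \<in> U g})"
    have "openin ?P (\<Inter>g\<in>G. {\<tau> \<in> topspace ?P. \<tau> g \<in> U g})"
      using fin A(1) U coord by (intro openin_INT2 openin_continuous_map_preimage) auto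
    moreover have "openin ?P {\<tau> \<in> topspace ?P. r (\<tau> ?e) \<in> V}"
      using continuous_map_compose[OF coord[OF A(1)] Z'(4)] V(1)
      by (intro openin_continuous_map_preimage) (simp_all only: o_def)
    ultimately have "openin ?P ?T"
      by (intro openin_Int)
    moreover have "\<sigma> \<in> ?T"
      using s V(2) U by simp
    moreover have "inj_on ?p ?T"
    proof (rule inj_onI)
      fix \<tau> \<tau>' assume t: "\<tau> \<in> ?T" "\<tau>' \<in> ?T" "?p \<tau> = ?p \<tau>'"
      then have tP: "\<tau> \<in> topspace ?P" "\<tau>' \<in> topspace ?P"
        by simp_all
      have "r (\<tau> ?e) = r (\<tau>' ?e)"
        using inj_onD[OF V(3) t(3)] t(1,2) by simp
      then have "r (\<tau> g) = r (\<tau>' g)" if "g \<in> G" for g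
        using Pr[OF tP(1) that] Pr[OF tP(2) that] by simp
      then have "\<tau> g = \<tau>' g" if "g \<in> G" for g
        using U[OF that] t(1,2) that inj_onD[of r "U g" "\<tau> g" "\<tau>' g"] by simp
      then show "\<tau> = \<tau>'"
        by (rule extensionalityI[OF Pext[OF tP(1)] Pext[OF tP(2)]])
    qed
    ultimately show "\<exists>U. openin ?P U \<and> \<sigma> \<in> U \<and> inj_on ?p U"
      by blast
  qed
  \<comment> \<open>re-indexing by \<open>k\<close>, followed by deck transformations of \<open>Z\<close> in the coordinates\<close>
  define T where "T t k \<tau> = (\<lambda>g\<in>G. t g (\<tau> (g \<otimes>\<^bsub>?B\<^esub> k)))" for t :: "('b \<Rightarrow> 'b) \<Rightarrow> 'c \<Rightarrow> 'c" and k \<tau>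
  have Tmap: "continuous_map ?P ?P (T t k)"
    and Tr: "\<And>\<tau>. \<tau> \<in> topspace ?P \<Longrightarrow> r (T t k \<tau> ?e) = k (r (\<tau> ?e))"
    if k: "k \<in> G" and t: "\<And>g. g \<in> G \<Longrightarrow> continuous_map Z Z (t g)"
        "\<And>g z. g \<in> G \<Longrightarrow> z \<in> topspace Z \<Longrightarrow> r (t g z) = r z" for t k
  proof -
    have Tg: "r (T t k \<tau> g) = g (k (r (\<tau> ?e)))" if \<tau>: "\<tau> \<in> topspace ?P" and g: "g \<in> G" for \<tau> g
    proof -
      have "r (T t k \<tau> g) = r (\<tau> (g \<otimes>\<^bsub>?B\<^esub> k))"
        unfolding T_def using t(2)[OF g PZ[OF \<tau> A(3)[OF g k]]] g by simp
      also have "\<dots> = (g \<otimes>\<^bsub>?B\<^esub> k) (r (\<tau> ?e))"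
        using Pr[OF \<tau> A(3)[OF g k]] .
      also have "\<dots> = g (k (r (\<tau> ?e)))"
        using A(4)[OF g k rY[OF PZ[OF \<tau> A(1)]]] .
      finally show ?thesis .
    qed
    have T1: "r (T t k \<tau> ?e) = k (r (\<tau> ?e))" if \<tau>: "\<tau> \<in> topspace ?P" for \<tau>
      using Tg[OF \<tau> A(1)] A(2)[OF fD(3)[OF k rY[OF PZ[OF \<tau> A(1)]]]] by (rule trans)
    have "continuous_map ?P Z (\<lambda>\<tau>. T t k \<tau> g)" if g: "g \<in> G" for g
      using continuous_map_compose[OF coord[OF A(3)[OF g k]] t(1)[OF g]] g by (simp add: T_def o_def)
    then have "continuous_map ?P ?Q (T t k)"
      unfolding continuous_map_componentwise by (auto simp: T_def)
    then show "continuous_map ?P ?P (T t k)"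
      unfolding tower_space_def[of Y G Z r] continuous_map_in_subtopology
      using Tg T1 unfolding tower_space_def[of Y G Z r] by auto
    show "\<And>\<tau>. \<tau> \<in> topspace ?P \<Longrightarrow> r (T t k \<tau> ?e) = k (r (\<tau> ?e))"
      by (rule T1)
  qed
  have "\<exists>h. homeomorphic_map ?P ?P h \<and> (\<forall>u\<in>topspace ?P. ?p (h u) = ?p u) \<and> h \<sigma> = \<sigma>'"
    if s: "\<sigma> \<in> topspace ?P" "\<sigma>' \<in> topspace ?P" "?p \<sigma> = ?p \<sigma>'" for \<sigma> \<sigma>'
  proof -
    obtain k where k: "k \<in> G" "k (r (\<sigma> ?e)) = r (\<sigma>' ?e)"
      using fD(5)[OF rY[OF PZ[OF s(1) A(1)]] rY[OF PZ[OF s(2) A(1)]] s(3)] by blast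
    let ?k' = "inv\<^bsub>?B\<^esub> k"
    have k': "?k' \<in> G"
      using A(5)[OF k(1)] .
    have "\<exists>t t'. homeomorphic_maps Z Z t t' \<and> (\<forall>z\<in>topspace Z. r (t z) = r z) \<and> t (\<sigma> (g \<otimes>\<^bsub>?B\<^esub> k)) = \<sigma>' g"
      if g: "g \<in> G" for g
    proof -
      have "r (\<sigma> (g \<otimes>\<^bsub>?B\<^esub> k)) = r (\<sigma>' g)"
        using Pr[OF s(1) A(3)[OF g k(1)]] A(4)[OF g k(1) rY[OF PZ[OF s(1) A(1)]]] k(2) Pr[OF s(2) g] by metis
      then obtain t where t: "homeomorphic_map Z Z t" "\<And>z. z \<in> topspace Z \<Longrightarrow> r (t z) = r z"
          "t (\<sigma> (g \<otimes>\<^bsub>?B\<^esub> k)) = \<sigma>' g"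
        using normal_cover_translation[OF Z PZ[OF s(1) A(3)[OF g k(1)]] PZ[OF s(2) g]] by metis
      then show ?thesis
        using homeomorphic_map_maps by blast
    qed
    then obtain t t' where t: "\<And>g. g \<in> G \<Longrightarrow> homeomorphic_maps Z Z (t g) (t' g) \<and>
        (\<forall>z\<in>topspace Z. r (t g z) = r z) \<and> t g (\<sigma> (g \<otimes>\<^bsub>?B\<^esub> k)) = \<sigma>' g"
      by metis
    have tc: "continuous_map Z Z (t g)" and t'c: "continuous_map Z Z (t' g)"
      and t't: "\<And>z. z \<in> topspace Z \<Longrightarrow> t' g (t g z) = z" and tt': "\<And>z. z \<in> topspace Z \<Longrightarrow> t g (t' g z) = z"
      and rt: "\<And>z. z \<in> topspace Z \<Longrightarrow> r (t g z) = r z" if "g \<in> G" for g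
      using t[OF that] unfolding homeomorphic_maps_def by blast+
    have rt': "r (t' g z) = r z" if "g \<in> G" "z \<in> topspace Z" for g z
    proof -
      have "t' g z \<in> topspace Z"
        using continuous_map_image_subset_topspace[OF t'c[OF that(1)]] that(2) by blast
      then show ?thesis
        using rt[OF that(1)] tt'[OF that] by metis
    qed
    let ?h = "T t k" and ?h' = "T (\<lambda>g. t' (g \<otimes>\<^bsub>?B\<^esub> ?k')) ?k'"
    have hc: "continuous_map ?P ?P ?h"
      using tc rt by (rule Tmap[OF k(1)])
    have hr: "r (?h \<tau> ?e) = k (r (\<tau> ?e))" if "\<tau> \<in> topspace ?P" for \<tau>
      using tc rt that by (rule Tr[OF k(1)])
    have h': "continuous_map ?P ?P ?h'"
    proof (rule Tmap[OF k'])
      fix g assume "g \<in> G"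
      then have g: "g \<otimes>\<^bsub>?B\<^esub> ?k' \<in> G"
        using k' by (rule A(3))
      show "continuous_map Z Z (t' (g \<otimes>\<^bsub>?B\<^esub> ?k'))"
        using g by (rule t'c)
      show "r (t' (g \<otimes>\<^bsub>?B\<^esub> ?k') z) = r z" if "z \<in> topspace Z" for z
        using g that by (rule rt')
    qed
    have "?h' (?h \<tau>) = \<tau>" if \<tau>: "\<tau> \<in> topspace ?P" for \<tau>
    proof (rule extensionalityI[of _ G])
      show "?h' (?h \<tau>) \<in> extensional G" "\<tau> \<in> extensional G"
        using Pext[OF \<tau>] by (simp_all add: T_def)
      fix g assume g: "g \<in> G"
      have "?h' (?h \<tau>) g = t' (g \<otimes>\<^bsub>?B\<^esub> ?k') (t (g \<otimes>\<^bsub>?B\<^esub> ?k') (\<tau> ((g \<otimes>\<^bsub>?B\<^esub> ?k') \<otimes>\<^bsub>?B\<^esub> k)))"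
        unfolding T_def by (simp only: restrict_apply' g A(3)[OF g k'])
      also have "\<dots> = \<tau> g"
        unfolding A(7)[OF g k(1)] using t't[OF A(3)[OF g k'] PZ[OF \<tau> g]] .
      finally show "?h' (?h \<tau>) g = \<tau> g" .
    qed
    moreover have "?h (?h' \<tau>) = \<tau>" if \<tau>: "\<tau> \<in> topspace ?P" for \<tau>
    proof (rule extensionalityI[of _ G])
      show "?h (?h' \<tau>) \<in> extensional G" "\<tau> \<in> extensional G"
        using Pext[OF \<tau>] by (simp_all add: T_def)
      fix g assume g: "g \<in> G"
      have "?h (?h' \<tau>) g = t g (t' ((g \<otimes>\<^bsub>?B\<^esub> k) \<otimes>\<^bsub>?B\<^esub> ?k') (\<tau> ((g \<otimes>\<^bsub>?B\<^esub> k) \<otimes>\<^bsub>?B\<^esub> ?k')))"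
        unfolding T_def by (simp only: restrict_apply' g A(3)[OF g k(1)])
      also have "\<dots> = \<tau> g"
        unfolding A(6)[OF g k(1)] using tt'[OF g PZ[OF \<tau> g]] .
      finally show "?h (?h' \<tau>) g = \<tau> g" .
    qed
    ultimately have "homeomorphic_maps ?P ?P ?h ?h'"
      using hc h' unfolding homeomorphic_maps_def by blast
    then have "homeomorphic_map ?P ?P ?h"
      by (rule homeomorphic_maps_imp_map)
    moreover have "?p (?h \<tau>) = ?p \<tau>" if \<tau>: "\<tau> \<in> topspace ?P" for \<tau>
      using hr[OF \<tau>] fD(4)[OF k(1) rY[OF PZ[OF \<tau> A(1)]]] by simp
    moreover have "?h \<sigma> = \<sigma>'"
    proof (rule extensionalityI[of _ G])
      show "?h \<sigma> \<in> extensional G" "\<sigma>' \<in> extensional G"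
        using Pext[OF s(2)] by (simp_all add: T_def)
      show "?h \<sigma> g = \<sigma>' g" if "g \<in> G" for g
        unfolding T_def using t[OF that] that by simp
    qed
    ultimately show ?thesis
      by blast
  qed
  then show ?thesis
    unfolding normal_cover_def using comp met cont surj loc by blast
qed

context cover_system
begin

section \<open>Covers of the compact universal cover\<close>

text \<open>
  The two steps \<open>Z\<close> over \<open>cspace c\<close> over \<open>X\<close> need not compose to a normal cover, but a connected piece
  of their Galois closure is one, so it is a copy of some \<open>cspace e\<close> with \<open>e \<in> C\<close>. The \<open>e\<close>-th coordinate
  of \<open>Xhat\<close>, followed by a coordinate of the Galois closure, is then a lift to \<open>Z\<close>.
\<close>

lemma Xhat_lifts_through_tower:
  assumes c: "c \<in> C" and Z: "normal_cover Z (cspace c) r"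
  shows "\<exists>s. continuous_map Xhat Z s \<and> (\<forall>x\<in>topspace Xhat. r (s x) = x c)"
proof -
  let ?B = "cgroup c"
  let ?T = "tower_space (cspace c) (cdeck c) Z r"
  let ?p = "\<lambda>\<sigma>. cmap c (r (\<sigma> \<one>\<^bsub>?B\<^esub>))"
  note A = bij_subgroup_apply[OF regular_covering_subgroup[OF regular[OF c]]]
  have T: "normal_cover ?T X ?p"
    using normal_cover_tower_space[OF regular[OF c] continuum_cspace[OF c] X_facts(4) Z] .
  have "?p ` topspace ?T \<noteq> {}"
    using normal_coverD(5)[OF T] X_facts(5) by simp
  then obtain \<sigma>0 where "\<sigma>0 \<in> topspace ?T"
    by blast
  then obtain K where K: "K \<subseteq> topspace ?T" "continuum (subtopology ?T K)"
      "normal_cover (subtopology ?T K) X ?p"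
    using normal_cover_connected_piece[OF T X_facts(2,4)] by metis
  obtain e \<psi> where e: "e \<in> C" "homeomorphic_map (subtopology ?T K) (cspace e) \<psi>"
      "\<forall>z\<in>topspace (subtopology ?T K). cmap e (\<psi> z) = ?p z"
    using representative[OF K(3,2)] by blast
  obtain \<psi>' where \<psi>: "homeomorphic_maps (subtopology ?T K) (cspace e) \<psi> \<psi>'"
    using e(2) homeomorphic_map_maps by blast
  have \<psi>c: "continuous_map (cspace e) ?T \<psi>'"
    using \<psi> by (auto simp: homeomorphic_maps_def continuous_map_in_subtopology)
  have \<psi>K: "\<psi>' y \<in> topspace (subtopology ?T K)" "\<psi> (\<psi>' y) = y" if "y \<in> cpoints e" for y
    using \<psi> that continuous_map_image_subset_topspace[of "cspace e" "subtopology ?T K" \<psi>']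
    unfolding homeomorphic_maps_def by blast+
  define m where "m = \<psi>' \<circ> (\<lambda>x. x e)"
  have mc: "continuous_map Xhat ?T m"
    unfolding m_def using continuous_map_Xhat_coordinate[OF e(1)] \<psi>c by (rule continuous_map_compose)
  have mT: "m x \<in> topspace ?T" if "x \<in> topspace Xhat" for x
    using continuous_map_image_subset_topspace[OF mc] that by blast
  have mo: "?p (m x) = universal_projection C x" if x: "x \<in> topspace Xhat" for x
    using bspec[OF e(3) \<psi>K(1)[OF XhatD(1)[OF x e(1)]]] \<psi>K(2)[OF XhatD(1)[OF x e(1)]]
      universal_projection[OF x e(1)] by (simp add: m_def)
  have coord: "continuous_map ?T Z (\<lambda>\<sigma>. \<sigma> g)" if "g \<in> cdeck c" for g
    unfolding tower_space_def using that
    by (intro continuous_map_from_subtopology continuous_map_product_projection)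
  have mr: "r (m x g) = g (r (m x \<one>\<^bsub>?B\<^esub>))" if "x \<in> topspace Xhat" "g \<in> cdeck c" for x g
    using mT[OF that(1)] that(2) by (auto simp: tower_space_def)
  have rc: "continuous_map Xhat (cspace c) (r \<circ> (\<lambda>\<sigma>. \<sigma> \<one>\<^bsub>?B\<^esub>) \<circ> m)"
    using continuous_map_compose[OF mc continuous_map_compose[OF coord[OF A(1)] normal_coverD(4)[OF Z]]] .
  obtain x0 where x0: "x0 \<in> topspace Xhat"
    using continuumD(5)[OF continuum_Xhat] by blast
  have "cmap c ((r \<circ> (\<lambda>\<sigma>. \<sigma> \<one>\<^bsub>?B\<^esub>) \<circ> m) x) = cmap c (x c)" if "x \<in> topspace Xhat" for x
    using mo[OF that] universal_projection[OF that c] by simp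
  then obtain k where k: "k \<in> cdeck c"
      "\<forall>x\<in>topspace Xhat. k ((r \<circ> (\<lambda>\<sigma>. \<sigma> \<one>\<^bsub>?B\<^esub>) \<circ> m) x) = x c"
    using lifts_differ_by_deck[OF regular[OF c] continuum_cspace[OF c] continuumD(2)[OF continuum_Xhat] x0
        rc continuous_map_Xhat_coordinate[OF c]] by blast
  \<comment> \<open>the coordinate \<open>k\<close> of the Galois closure corrects the deck transformation \<open>k\<close>\<close>
  have "continuous_map Xhat Z (\<lambda>x. m x k)"
    using continuous_map_compose[OF mc coord[OF k(1)]] by (simp add: o_def)
  moreover have "r (m x k) = x c" if "x \<in> topspace Xhat" for x
    using mr[OF that k(1)] k(2) that by simp
  ultimately show ?thesis
    by blast
qed

text \<open>
  Identify points of the cover \<open>W\<close> that are close and have the same \<open>c\<close>-th coordinate downstairs. For a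
  suitable \<open>c\<close> this is an equivalence relation with a well-behaved quotient: points of \<open>Xhat\<close> with equal
  \<open>c\<close>-th coordinate are then so close that the fibres of \<open>W\<close> over them match up, each point being close
  to exactly one point of the other fibre. The quotient \<open>Z\<close> is a normal cover of \<open>cspace c\<close>, so
  \<open>Xhat\<close> maps to it over \<open>cspace c\<close>, and by uniqueness of lifts \<open>W \<rightarrow> Z\<close> factors through this map. Since the
  quotient map is injective on the fibres of \<open>W\<close> over \<open>Xhat\<close>, these are single points.
\<close>

lemma cover_of_Xhat_trivial:
  assumes d: "cover_by_continuum Xhat d"
  shows "inj_on (cmap d) (cpoints d)"
proof -
  let ?W = "cspace d" and ?p = "cmap d" and ?H = "cdeck d"
  note D = cover_by_continuumD[OF d]
  note dD = regular_coveringD[OF D(1,2)] and A = bij_subgroup_apply[OF regular_covering_subgroup[OF D(1)]]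
  note W' = continuumD[OF D(2)] and p' = normal_coverD[OF D(3)]
  note Xh = continuumD[OF continuum_Xhat]
  have fin: "finite ?H"
    using D(1,2) Xh(4) by (rule regular_covering_finite_group)
  have pX: "?p w \<in> topspace Xhat" if "w \<in> cpoints d" for w
    using continuous_map_image_subset_topspace[OF p'(4)] that by blast
  obtain \<delta> where \<delta>: "compatible_distance ?W \<delta>"
    using compact_metrizable_distance[OF W'(1,3)] by blast
  note \<delta>D = compatible_distanceD[OF \<delta>]
  obtain e0 where e0: "e0 > 0"
      "\<forall>x\<in>cpoints d. \<forall>y\<in>cpoints d. \<delta> x y < e0 \<longrightarrow> ?p x = ?p y \<longrightarrow> x = y"
    using locally_injective_separation[OF \<delta> p'(6)] by blast
  \<comment> \<open>two points of a fibre over \<open>Xhat\<close> joined by three steps of length less than \<open>e\<close> are equal\<close>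
  define e where "e = e0 / 3"
  have e: "e > 0" "3 * e = e0"
    using e0(1) by (simp_all add: e_def)
  \<comment> \<open>the deck transformations \<open>h\<close> make \<open>N\<close> invariant, so that they act on the quotient by closeness\<close>
  define N where "N = (\<Inter>h\<in>?H. {s \<in> topspace (prod_topology ?W ?W). (h (fst s), h (snd s)) \<in>
      {(x, y) \<in> cpoints d \<times> cpoints d. \<delta> x y < e}})"
  have N_iff: "(w, w') \<in> N \<longleftrightarrow> w \<in> cpoints d \<and> w' \<in> cpoints d \<and> (\<forall>h\<in>?H. \<delta> (h w) (h w') < e)" for w w'
    using A(1) dD(3) by (auto simp: N_def)
  have Nopen: "openin (prod_topology ?W ?W) N"
    unfolding N_def
  proof (rule openin_INT2[OF fin])
    show "?H \<noteq> {}"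
      using A(1) by blast
    fix h assume h: "h \<in> ?H"
    have hc: "continuous_map ?W ?W h"
      using homeomorphic_imp_continuous_map[OF dD(1)[OF h]] .
    have "continuous_map (prod_topology ?W ?W) (prod_topology ?W ?W) (\<lambda>s. ((h \<circ> fst) s, (h \<circ> snd) s))"
      by (intro continuous_map_pairedI continuous_map_compose[OF continuous_map_fst hc]
          continuous_map_compose[OF continuous_map_snd hc])
    then have "continuous_map (prod_topology ?W ?W) (prod_topology ?W ?W) (\<lambda>s. (h (fst s), h (snd s)))"
      by (simp add: o_def)
    then show "openin (prod_topology ?W ?W) {s \<in> topspace (prod_topology ?W ?W). (h (fst s), h (snd s)) \<in>
      {(x, y) \<in> cpoints d \<times> cpoints d. \<delta> x y < e}}"
      using \<delta>D(5) by (rule openin_continuous_map_preimage)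
  qed
  have Nrefl: "(w, w) \<in> N" if "w \<in> cpoints d" for w
    unfolding N_iff using that dD(3) \<delta>D(4) e(1) by simp
  have Nsym: "(w', w) \<in> N" if "(w, w') \<in> N" for w w'
    using that \<delta>D(2) unfolding N_iff by simp
  have Ninv: "(h w, h w') \<in> N" if h: "h \<in> ?H" and w: "(w, w') \<in> N" for h w w'
  proof -
    have "\<delta> (k (h w)) (k (h w')) < e" if k: "k \<in> ?H" for k
      using w A(3)[OF k h] A(4)[OF k h, of w] A(4)[OF k h, of w'] unfolding N_iff by metis
    then show ?thesis
      using w dD(3)[OF h] unfolding N_iff by blast
  qed
  have Ndist: "\<delta> w w' < e" if "(w, w') \<in> N" for w w'
    using that A(1) A(2)[of w] A(2)[of w'] unfolding N_iff by metis
  have "\<exists>c\<in>C. \<forall>x\<in>topspace Xhat. \<forall>y\<in>topspace Xhat. x c = y c \<longrightarrow>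
      (\<exists>w w'. (w, w') \<in> N \<and> ?p w = x \<and> ?p w' = y)"
  proof -
    let ?\<C> = "(\<lambda>U. ?p ` U) ` {U. openin ?W U \<and> U \<times> U \<subseteq> N}"
    have "openin (prod_topology Xhat Xhat) (\<Union>V\<in>?\<C>. V \<times> V)"
      using normal_cover_open_map[OF D(3) Xh(4)] unfolding open_map_def
      by (intro openin_square_cover) blast
    moreover have "(x, x) \<in> (\<Union>V\<in>?\<C>. V \<times> V)" if x: "x \<in> topspace Xhat" for x
    proof -
      have "x \<in> ?p ` cpoints d"
        using p'(5) x by simp
      then obtain w where w: "w \<in> cpoints d" "?p w = x"
        by (elim imageE) simp
      obtain U V where UV: "openin ?W U" "openin ?W V" "w \<in> U" "w \<in> V" "U \<times> V \<subseteq> N"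
        using Nopen[unfolded openin_prod_topology_alt, rule_format, OF Nrefl[OF w(1)]] by metis
      have "openin ?W (U \<inter> V)"
        using UV(1,2) by (rule openin_Int)
      moreover have "(U \<inter> V) \<times> (U \<inter> V) \<subseteq> N"
        using UV(5) by blast
      ultimately have "?p ` (U \<inter> V) \<in> ?\<C>"
        by blast
      moreover have "x \<in> ?p ` (U \<inter> V)"
        using UV(3,4) w(2) by blast
      ultimately show ?thesis
        by blast
    qed
    ultimately obtain c where c: "c \<in> C" "\<forall>x\<in>topspace Xhat. \<forall>y\<in>topspace Xhat. x c = y c \<longrightarrow>
        (x, y) \<in> (\<Union>V\<in>?\<C>. V \<times> V)"
      using Xhat_level by meson
    have "\<exists>w w'. (w, w') \<in> N \<and> ?p w = x \<and> ?p w' = y" if "(x, y) \<in> (\<Union>V\<in>?\<C>. V \<times> V)" for x y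
      using that by blast
    with c(2) have "\<forall>x\<in>topspace Xhat. \<forall>y\<in>topspace Xhat. x c = y c \<longrightarrow>
        (\<exists>w w'. (w, w') \<in> N \<and> ?p w = x \<and> ?p w' = y)"
      by (intro ballI impI) (simp only:)
    then show ?thesis
      by (rule bexI[OF _ c(1)])
  qed
  then obtain c where c: "c \<in> C" and level: "\<And>x y. \<lbrakk>x \<in> topspace Xhat; y \<in> topspace Xhat; x c = y c\<rbrakk> \<Longrightarrow>
      \<exists>w w'. (w, w') \<in> N \<and> ?p w = x \<and> ?p w' = y"
    by blast
  \<comment> \<open>by invariance of \<open>N\<close> the point over \<open>x\<close> can be prescribed\<close>
  have key: "\<exists>w'. (w, w') \<in> N \<and> ?p w' = y" if w: "w \<in> cpoints d" "y \<in> topspace Xhat" "?p w c = y c" for w y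
  proof -
    obtain v v' where v: "(v, v') \<in> N" "?p v = ?p w" "?p v' = y"
      using level[OF pX[OF w(1)] w(2,3)] by blast
    have vW: "v \<in> cpoints d" "v' \<in> cpoints d"
      using v(1) by (simp_all add: N_iff)
    obtain h where h: "h \<in> ?H" "h v = w"
      using dD(5)[OF vW(1) w(1) v(2)] by blast
    show ?thesis
      using Ninv[OF h(1) v(1)] h(2) dD(4)[OF h(1) vW(2)] v(3) by metis
  qed
  \<comment> \<open>such pairs are never at distance between \<open>e\<close> and \<open>2 * e\<close>: closeness is transitive, and classes
     over the same point of \<open>cspace c\<close> stay apart\<close>
  have close: "(w, w') \<in> N" if w: "w \<in> cpoints d" "w' \<in> cpoints d" "?p w c = ?p w' c" "\<delta> w w' < 2 * e" for w w'
  proof -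
    obtain v where v: "(w, v) \<in> N" "?p v = ?p w'"
      using key[OF w(1) pX[OF w(2)] w(3)] by blast
    have vW: "v \<in> cpoints d"
      using v(1) by (simp add: N_iff)
    have "\<delta> v w' \<le> \<delta> v w + \<delta> w w'"
      using \<delta>D(3)[OF vW w(1,2)] .
    then have "\<delta> v w' < e0"
      using Ndist[OF v(1)] \<delta>D(2)[of v w] w(4) e(2) by simp
    then have "v = w'"
      using e0(2) vW w(2) v(2) by blast
    then show ?thesis
      using v(1) by simp
  qed
  define \<kappa> where "\<kappa> w = {w' \<in> cpoints d. ?p w c = ?p w' c \<and> (w, w') \<in> N}" for w
  have \<kappa>_self: "w \<in> \<kappa> w" if "w \<in> cpoints d" for w
    using that Nrefl by (simp add: \<kappa>_def)
  have trans: "(u, w) \<in> N" if "(u, v) \<in> N" "(v, w) \<in> N" "?p u c = ?p v c" "?p v c = ?p w c" for u v w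
  proof -
    have top: "u \<in> cpoints d" "v \<in> cpoints d" "w \<in> cpoints d"
      using that(1,2) by (simp_all add: N_iff)
    have "\<delta> u w < 2 * e"
      using \<delta>D(3)[OF top] Ndist[OF that(1)] Ndist[OF that(2)] by simp
    then show ?thesis
      using close[OF top(1,3)] that(3,4) by simp
  qed
  have \<kappa>_eq: "\<kappa> u = \<kappa> v \<longleftrightarrow> ?p u c = ?p v c \<and> (u, v) \<in> N" if uv: "u \<in> cpoints d" "v \<in> cpoints d" for u v
  proof
    assume "\<kappa> u = \<kappa> v"
    then have "v \<in> \<kappa> u"
      using \<kappa>_self[OF uv(2)] by simp
    then show "?p u c = ?p v c \<and> (u, v) \<in> N"
      by (simp add: \<kappa>_def)
  next
    assume *: "?p u c = ?p v c \<and> (u, v) \<in> N"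
    have "(u, w) \<in> N \<longleftrightarrow> (v, w) \<in> N" if "?p v c = ?p w c" for w
      using trans[of u v w] trans[of v u w] * Nsym[of u v] that by metis
    then show "\<kappa> u = \<kappa> v"
      using * unfolding \<kappa>_def by auto
  qed
  define \<phi> where "\<phi> w = ?p w c" for w
  have \<phi>c: "continuous_map ?W (cspace c) \<phi>"
    using continuous_map_compose[OF p'(4) continuous_map_Xhat_coordinate[OF c]]
    by (rule continuous_map_eq) (simp add: \<phi>_def)
  define Z where "Z = quotient_space ?W \<kappa>"
  have \<kappa>c: "continuous_map ?W Z \<kappa>" and \<kappa>s: "\<kappa> ` cpoints d = topspace Z"
    unfolding Z_def by (rule quotient_imp_continuous_map[OF quotient_map_quotient_space],
        rule quotient_imp_surjective_map[OF quotient_map_quotient_space])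
  have \<phi>s: "\<phi> ` cpoints d = cpoints c"
  proof (intro equalityI subsetI)
    fix y assume "y \<in> cpoints c"
    then obtain x where x: "x \<in> topspace Xhat" "x c = y"
      using Xhat_coordinate_surjective[OF c] by blast
    then have "x \<in> ?p ` cpoints d"
      using p'(5) by simp
    then show "y \<in> \<phi> ` cpoints d"
      using x(2) by (auto simp: \<phi>_def)
  qed (use continuous_map_image_subset_topspace[OF \<phi>c] in blast)
  have "\<exists>r. normal_cover (quotient_space ?W \<kappa>) (cspace c) r \<and> (\<forall>w\<in>cpoints d. r (\<kappa> w) = \<phi> w)"
  proof (rule normal_cover_quotient[OF W'(1,3) \<phi>c \<phi>s cspace_facts(4)[OF c]])
    show "\<phi> x = \<phi> y" if "x \<in> cpoints d" "y \<in> cpoints d" "\<kappa> x = \<kappa> y" for x y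
      using \<kappa>_eq[OF that(1,2)] that(3) by (simp add: \<phi>_def)
    fix x y assume xy: "x \<in> cpoints d" "y \<in> cpoints d" "\<phi> x = \<phi> y" "\<kappa> x \<noteq> \<kappa> y"
    have far: "2 * e \<le> \<delta> x y"
      using close[OF xy(1,2)] \<kappa>_eq[OF xy(1,2)] xy(3,4) by (force simp: \<phi>_def)
    let ?b = "\<lambda>w. {v \<in> cpoints d. \<delta> w v < e / 2}"
    have "\<kappa> u \<noteq> \<kappa> v" if u: "u \<in> ?b x" and v: "v \<in> ?b y" for u v
    proof
      have uv: "u \<in> cpoints d" "v \<in> cpoints d" "\<delta> x u < e / 2" "\<delta> v y < e / 2"
        using u v \<delta>D(2)[of v y] by simp_all
      assume "\<kappa> u = \<kappa> v"
      then have "\<delta> u v < e"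
        using \<kappa>_eq[OF uv(1,2)] Ndist by blast
      then show False
        using far uv(3,4) \<delta>D(3)[OF xy(1) uv(1) xy(2)] \<delta>D(3)[OF uv(1,2) xy(2)] by simp
    qed
    moreover have "openin (cspace d) (?b x)" "openin (cspace d) (?b y)"
      by (rule openin_distance_ball[OF \<delta> xy(1)], rule openin_distance_ball[OF \<delta> xy(2)])
    moreover have "x \<in> ?b x" "y \<in> ?b y"
      using \<delta>D(4) xy(1,2) e(1) by simp_all
    ultimately show "\<exists>U V. openin (cspace d) U \<and> openin (cspace d) V \<and> x \<in> U \<and> y \<in> V \<and>
        (\<forall>u\<in>U. \<forall>v\<in>V. \<kappa> u \<noteq> \<kappa> v)"
      by (intro exI[of _ "?b x"] exI[of _ "?b y"] conjI ballI)
  next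
    fix w assume w: "w \<in> cpoints d"
    let ?U = "{v \<in> cpoints d. \<delta> w v < e}"
    have "openin ?W ?U"
      using \<delta> w by (rule openin_distance_ball)
    moreover have "{v \<in> cpoints d. \<kappa> v = \<kappa> w} \<subseteq> ?U"
      using \<kappa>_eq[OF w] Ndist[of w] by auto
    moreover have "\<kappa> u = \<kappa> v" if uv: "u \<in> ?U" "v \<in> ?U" "\<phi> u = \<phi> v" for u v
    proof -
      have top: "u \<in> cpoints d" "v \<in> cpoints d"
        using uv(1,2) by simp_all
      have "\<delta> u v < 2 * e"
        using \<delta>D(3)[OF top(1) w top(2)] \<delta>D(2)[of u w] uv(1,2) by simp
      then show ?thesis
        using close[OF top] \<kappa>_eq[OF top] uv(3) by (simp add: \<phi>_def)
    qed
    ultimately show "\<exists>U. openin ?W U \<and> {v \<in> cpoints d. \<kappa> v = \<kappa> w} \<subseteq> U \<and>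
        (\<forall>u\<in>U. \<forall>v\<in>U. \<phi> u = \<phi> v \<longrightarrow> \<kappa> u = \<kappa> v)"
      by blast
  next
    fix w w' assume w: "w \<in> cpoints d" "w' \<in> cpoints d" "\<phi> w = \<phi> w'"
    have ww': "?p w c = ?p w' c"
      using w(3) by (simp add: \<phi>_def)
    obtain v where v: "(w, v) \<in> N" "?p v = ?p w'"
      using key[OF w(1) pX[OF w(2)] ww'] by blast
    have vW: "v \<in> cpoints d"
      using v(1) by (simp add: N_iff)
    have wv: "\<kappa> w = \<kappa> v"
      using \<kappa>_eq[OF w(1) vW] v ww' by simp
    obtain h where h: "h \<in> ?H" "h v = w'"
      using dD(5)[OF vW w(2) v(2)] by blast
    let ?i = "inv\<^bsub>cgroup d\<^esub> h"
    have i: "?i \<in> ?H"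
      using A(5)[OF h(1)] .
    have \<kappa>inv: "\<kappa> (g u) = \<kappa> (g u')" if g: "g \<in> ?H" and u: "u \<in> cpoints d" "u' \<in> cpoints d" "\<kappa> u = \<kappa> u'" for g u u'
      using \<kappa>_eq[OF u(1,2)] \<kappa>_eq[OF dD(3)[OF g u(1)] dD(3)[OF g u(2)]] u(3) Ninv[OF g]
        dD(4)[OF g u(1)] dD(4)[OF g u(2)] by simp
    have "\<kappa> (h u) = \<kappa> (h u') \<longleftrightarrow> \<kappa> u = \<kappa> u'" if u: "u \<in> cpoints d" "u' \<in> cpoints d" for u u'
      using \<kappa>inv[OF h(1) u] \<kappa>inv[OF i dD(3)[OF h(1) u(1)] dD(3)[OF h(1) u(2)]]
        A(8)[OF h(1) u(1)] A(8)[OF h(1) u(2)] by metis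
    moreover have "\<kappa> (h w) = \<kappa> w'"
      using \<kappa>inv[OF h(1) w(1) vW wv] h(2) by simp
    moreover have "\<phi> (h u) = \<phi> u" if "u \<in> cpoints d" for u
      using dD(4)[OF h(1) that] by (simp add: \<phi>_def)
    ultimately show "\<exists>h. homeomorphic_map ?W ?W h \<and> (\<forall>u\<in>cpoints d. \<phi> (h u) = \<phi> u) \<and>
        (\<forall>u\<in>cpoints d. \<forall>v\<in>cpoints d. \<kappa> (h u) = \<kappa> (h v) \<longleftrightarrow> \<kappa> u = \<kappa> v) \<and> \<kappa> (h w) = \<kappa> w'"
      using dD(1)[OF h(1)] by blast
  qed
  then obtain r where Znc: "normal_cover Z (cspace c) r" and r\<kappa>': "\<forall>w\<in>cpoints d. r (\<kappa> w) = \<phi> w"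
    unfolding Z_def by blast
  note r\<kappa> = bspec[OF r\<kappa>'] and rloc = normal_coverD(6)[OF Znc] and ZHaus = normal_coverD(3)[OF Znc]
  obtain s where s: "continuous_map Xhat Z s" "\<forall>x\<in>topspace Xhat. r (s x) = x c"
    using Xhat_lifts_through_tower[OF c Znc] by blast
  obtain w0 where w0: "w0 \<in> cpoints d"
    using W'(5) by blast
  have "s (?p w0) \<in> \<kappa> ` cpoints d"
    unfolding \<kappa>s using continuous_map_image_subset_topspace[OF s(1)] pX[OF w0] by blast
  then obtain w1 where w1: "w1 \<in> cpoints d" "s (?p w0) = \<kappa> w1"
    by blast
  have w10: "?p w1 c = ?p w0 c"
    using r\<kappa>[OF w1(1)] w1(2) bspec[OF s(2) pX[OF w0]] by (simp add: \<phi>_def)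
  obtain w where w: "(w1, w) \<in> N" "?p w = ?p w0"
    using key[OF w1(1) pX[OF w0] w10] by blast
  have wW: "w \<in> cpoints d"
    using w(1) by (simp add: N_iff)
  have agree: "\<kappa> w = (s \<circ> ?p) w"
    using \<kappa>_eq[OF w1(1) wW] w w10 w1(2) by simp
  have all: "\<kappa> u = (s \<circ> ?p) u" if u: "u \<in> cpoints d" for u
  proof (rule lifts_unique[OF W'(2) ZHaus rloc \<kappa>c, of "s \<circ> ?p" w u])
    show "continuous_map ?W Z (s \<circ> ?p)"
      using p'(4) s(1) by (rule continuous_map_compose)
    show "r (\<kappa> v) = r ((s \<circ> ?p) v)" if "v \<in> cpoints d" for v
      using r\<kappa>[OF that] s(2) pX[OF that] by (simp add: \<phi>_def)
  qed (fact wW agree u)+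
  show ?thesis
  proof (rule inj_onI)
    fix u v assume uv: "u \<in> cpoints d" "v \<in> cpoints d" "?p u = ?p v"
    then have "\<kappa> u = \<kappa> v"
      using all[OF uv(1)] all[OF uv(2)] by simp
    then have "\<delta> u v < e0"
      using \<kappa>_eq[OF uv(1,2)] Ndist[of u v] e by simp
    then show "u = v"
      using e0(2) uv by blast
  qed
qed

lemma compactly_simply_connected_Xhat: "compactly_simply_connected Xhat"
  using compactly_simply_connected_iff[OF continuum_Xhat] cover_of_Xhat_trivial by blast

end

theorem theorem5:
  fixes X :: "'a topology"
    and C :: "'a cover set" and b :: "'a cover \<Rightarrow> real"
  assumes "continuum X"
    and "pointed_cover_system X C b"
  shows "compactly_simply_connected (compact_universal_cover C b) \<and>
    (\<forall>(Y :: 'b topology) G f.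
       compactly_simply_connected Y \<and>
       generalized_regular_covering_map
         (topspace Y) (compact_uniformity Y) G f (topspace X) (compact_uniformity X) \<longrightarrow>
       equivalent_quotient_maps
         (topspace Y) (compact_uniformity Y) (bij_subgroup (topspace Y) G) (\<lambda>g. g) f
         (topspace (compact_universal_cover C b))
         (compact_uniformity (compact_universal_cover C b))
         (profinite_fundamental_group C b) (coordinatewise_action C)
         (universal_projection C))"
proof -
  interpret cover_system X C b
    using assms by unfold_locales
  show ?thesis
    using compactly_simply_connected_Xhat equivalent_universal_cover by blast
qed

end
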